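(* Let $n\ge 2$, let $D$ and $D'$ be two proper subdomains of $\mathbb{R}^n$, and let $f:D\to f(D)=D'$ be a homeomorphism which is an isometry of $(D,\lambda_D)$ onto $(D',\lambda_{D'})$, i.e. $\lambda_{D'}(f(x),f(y))=\lambda_D(x,y)$ for all $x,y\in D$ with $x\ne y$. Then $f$ is quasiconformal with linear dilatation $H(f)\le 256$.
   Context: $\overline{\mathbb{R}^n}=\mathbb{R}^n\cup\{\infty\}$; boundaries of domains are taken in $\overline{\mathbb{R}^n}$. For a family $\Gamma$ of curves, $M(\Gamma)$ denotes its conformal modulus, $M(\Gamma)=\inf_\rho\int_{\mathbb{R}^n}\rho^n\,dm_n$, where the infimum is over all nonnegative Borel functions $\rho$ with $\int_\gamma\rho\,ds\ge1$ for every locally rectifiable $\gamma\in\Gamma$. For sets $E,F,D$, $\Delta(E,F;D)$ is the family of all curves joining $E$ to $F$ in $D$. For a proper subdomain $D$ of $\mathbb{R}^n$ and distinct $x,y\in D$, $$\lambda_D(x,y)=\inf_{C_x,C_y}M(\Delta(C_x,C_y;D)),$$ where the infimum is over all pairs of curves $C_x,C_y$ in $D$ such that $C_z$ (for $z=x,y$) joins $z$ to the boundary of $D$; that is, $C_z=\gamma_z([0,1))\subset D$ with $\gamma_z$ continuous, $\gamma_z(0)=z$ and $\gamma_z(t)\to\partial D$ as $t\to1$. The linear dilatation of a homeomorphism $f$ at $x$ is $$H(x,f)=\limsup_{r\to0+,\ |x-y|=|x-z|=r}\frac{|f(x)-f(y)|}{|f(x)-f(z)|}.$$ The homeomorphism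 $f:D\to D'$ is quasiconformal (metric definition) if $H(x,f)$ is bounded on $D$; $H(f)\le c$ means $H(x,f)\le c$ for every $x\in D$. *)

theory Defs
  imports "HOL-Analysis.Analysis"
begin

definition proper_subdomain :: "('a::real_normed_vector) set \<Rightarrow> bool" where
  "proper_subdomain D \<longleftrightarrow> open D \<and> connected D \<and> D \<noteq> {} \<and> D \<noteq> UNIV"

definition curve_length :: "(real \<Rightarrow> 'a::real_normed_vector) \<Rightarrow> real \<Rightarrow> real \<Rightarrow> ennreal" where
  "curve_length \<gamma> a b =
     (SUP d\<in>{d. d division_of {a..b}}. \<Sum>k\<in>d. ennreal (norm (\<gamma> (Sup k) - \<gamma> (Inf k))))"

(* Curves are parametrised on the compact interval {0..1}, where locally rectifiable
   and rectifiable mean the same. *)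
definition rectifiable :: "(real \<Rightarrow> 'a::real_normed_vector) \<Rightarrow> bool" where
  "rectifiable \<gamma> \<longleftrightarrow> curve_length \<gamma> 0 1 < \<infinity>"

(* The curve reparametrised by arc length, meaningful for u between 0 and the length of \<gamma>.
   The choice of t is irrelevant, since \<gamma> is constant where its length function is. *)
definition arc_length_param :: "(real \<Rightarrow> 'a::real_normed_vector) \<Rightarrow> real \<Rightarrow> 'a" where
  "arc_length_param \<gamma> u = \<gamma> (SOME t. t \<in> {0..1} \<and> curve_length \<gamma> 0 t = ennreal u)"

definition line_integral ::
    "('a::real_normed_vector \<Rightarrow> ennreal) \<Rightarrow> (real \<Rightarrow> 'a) \<Rightarrow> ennreal" where
  "line_integral \<rho> \<gamma> =
     (\<integral>\<^sup>+u\<in>{0..enn2real (curve_length \<gamma> 0 1)}. \<rho> (arc_length_param \<gamma> u) \<partial>lborel)"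

definition admissible ::
    "(real \<Rightarrow> 'a::real_normed_vector) set \<Rightarrow> ('a \<Rightarrow> ennreal) \<Rightarrow> bool" where
  "admissible \<Gamma> \<rho> \<longleftrightarrow>
     \<rho> \<in> borel_measurable borel \<and> (\<forall>\<gamma>\<in>\<Gamma>. rectifiable \<gamma> \<longrightarrow> 1 \<le> line_integral \<rho> \<gamma>)"

definition modulus :: "(real \<Rightarrow> real ^ 'n) set \<Rightarrow> ennreal" where
  "modulus \<Gamma> = (INF \<rho>\<in>{\<rho>. admissible \<Gamma> \<rho>}. \<integral>\<^sup>+x. \<rho> x ^ CARD('n) \<partial>lborel)"

definition joining_curves ::
    "'a::topological_space set \<Rightarrow> 'a set \<Rightarrow> 'a set \<Rightarrow> (real \<Rightarrow> 'a) set" where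
  "joining_curves E F D =
     {\<gamma>. path \<gamma> \<and> pathstart \<gamma> \<in> E \<and> pathfinish \<gamma> \<in> F \<and> \<gamma> ` {0<..<1} \<subseteq> D}"

(* The extended space adds the point at infinity, None; so None belongs to the boundary of D
   exactly if D is unbounded. *)
abbreviation extended_space :: "'a::topological_space option topology" where
  "extended_space \<equiv> Alexandroff_compactification euclidean"

definition extended_boundary :: "'a::topological_space set \<Rightarrow> 'a option set" where
  "extended_boundary D = extended_space frontier_of (Some ` D)"

(* Convergence to the boundary as a set: \<gamma> t is eventually in every neighbourhood of it,
   without having to converge to a single boundary point. The boundary being compact, this is
   convergence to 0 of the spherical distance to it. *)
definition tends_to_boundary :: "(real \<Rightarrow> 'a::topological_space) \<Rightarrow> 'a set \<Rightarrow> bool" where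
  "tends_to_boundary \<gamma> D \<longleftrightarrow>
     (\<forall>U. openin extended_space U \<longrightarrow> extended_boundary D \<subseteq> U \<longrightarrow>
        (\<forall>\<^sub>F t in at_left 1. Some (\<gamma> t) \<in> U))"

definition curves_to_boundary :: "'a::topological_space set \<Rightarrow> 'a \<Rightarrow> 'a set set" where
  "curves_to_boundary D z =
     {\<gamma> ` {0..<1} | \<gamma>. continuous_on {0..<1} \<gamma> \<and> \<gamma> ` {0..<1} \<subseteq> D \<and> \<gamma> 0 = z \<and>
                     tends_to_boundary \<gamma> D}"

definition lambda_mod :: "(real ^ 'n) set \<Rightarrow> real ^ 'n \<Rightarrow> real ^ 'n \<Rightarrow> ennreal" where
  "lambda_mod D x y =
     (INF (Cx, Cy)\<in>curves_to_boundary D x \<times> curves_to_boundary D y.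
        modulus (joining_curves Cx Cy D))"

(* For x in an open domain of f, the values of f outside the domain do not matter, since small
   spheres about x lie in the domain. *)
definition linear_dilatation ::
    "('a::real_normed_vector \<Rightarrow> 'b::real_normed_vector) \<Rightarrow> 'a \<Rightarrow> ereal" where
  "linear_dilatation f x =
     Limsup (at_right 0) (\<lambda>r. SUP (y, z)\<in>sphere x r \<times> sphere x r.
       ereal (norm (f x - f y) / norm (f x - f z)))"

definition quasiconformal ::
    "('a::real_normed_vector) set \<Rightarrow> ('b::real_normed_vector) set \<Rightarrow> ('a \<Rightarrow> 'b) \<Rightarrow> bool" where
  "quasiconformal D D' f \<longleftrightarrow>
     (\<exists>g. homeomorphism D D' f g) \<and> (\<exists>c::real. \<forall>x\<in>D. linear_dilatation f x \<le> ereal c)"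

end

theory Submission
  imports Defs "HOL-Real_Asymp.Real_Asymp"
begin

text \<open>For \<open>y\<close> close to \<open>x\<close>, put \<open>r = dist x y\<close> and let \<open>d\<close> be the distance of \<open>x\<close> to the complement of
  \<open>D\<close>. Then \<open>c * ln (2 * d / r - 1) \<le> lambda_mod D x y \<le> c * ln (31 * d / r)\<close>, where \<open>c\<close> depends only
  on the dimension. The lower bound is the spherical cap inequality on the spheres about the midpoint
  of \<open>x\<close> and \<open>y\<close> which meet both curves. For the upper bound, one curve runs from \<open>x\<close> to a
  nearest boundary point \<open>p\<close> and the other one from \<open>y\<close> to infinity; both are logarithmic spirals about \<open>x\<close>
  whose common axis turns slowly enough, with the logarithm of the radius, not to affect the leading
  terms. At scale \<open>r\<close> the two curves look like the rays left of a line when an open segment is removed,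
  and so they do at scale \<open>d\<close> after an inversion; the test function is glued from the two explicit
  potentials, functions of one prolate
  spheroidal coordinate, at the radius \<open>sqrt (r * d)\<close>. Since both estimates hold in \<open>D\<close> and in \<open>D'\<close>
  with the same constants, \<open>dist (f x) (f y)\<close> equals \<open>d' * r / d\<close> up to a factor of 16.\<close>

text \<open>Both bounds carry the same factor \<open>c\<close>, so comparing them costs only a
  constant factor in the ratio of distances; the upper bound must have exactly this leading
  coefficient and a bounded error. This dictates the potential: the exponent \<open>pe\<close> comes
  from the equality case of the cap inequality, where the density on a sphere is the power
  -(n-2)/(n-1) of the sine of the polar angle. The obstacle is that a nearest boundary point may lie
  in any direction relative to \<open>y - x\<close>, while the potentials need both curves on one
  axis. Hence the rotation, by a total angle of at most pi spread over the logarithmic length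
  \<open>ln M\<close>, \<open>M = d / r\<close>. Constants, in units of \<open>c\<close>: each half
  of the test function costs about \<open>ln (4 * sqrt M)\<close>, together
  \<open>ln (16 * M)\<close>; turning and gluing add less than \<open>ln (31/16)\<close> for large
  \<open>M\<close>. From \<open>2 * q - 1 \<le> 31 * q'\<close> follows
  \<open>q \<le> 16 * q'\<close> for the two ratios, and using this once in each direction gives 16
  * 16 = 256.\<close>

section \<open>Length of curves and the arc length parametrisation\<close>

text \<open>Since \<open>min s v\<close> and \<open>max s v\<close> are \<open>s\<close> and
  \<open>v\<close> in some order, the values at \<open>v\<close> cancel and the triangle inequality
  is all that remains.\<close>

lemma division_sum_split_le:
  fixes \<gamma> :: "real \<Rightarrow> 'a::real_normed_vector"
  shows "norm (\<gamma> s - \<gamma> i) \<le> norm (\<gamma> (min s v) - \<gamma> (min i v)) + norm (\<gamma> (max s v) - \<gamma> (max i v))"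
proof -
  have "\<gamma> s - \<gamma> i = (\<gamma> (min s v) - \<gamma> (min i v)) + (\<gamma> (max s v) - \<gamma> (max i v))"
    by (auto simp: min_def max_def)
  then show ?thesis
    by (metis norm_triangle_ineq)
qed

lemma division_real_interval:
  assumes "d division_of {a..b::real}" "k \<in> d"
  shows "k = {Inf k..Sup k}" "Inf k \<le> Sup k" "a \<le> Inf k" "Sup k \<le> b"
proof -
  obtain u v where k: "k = cbox u v" and ne: "k \<noteq> {}" and sub: "k \<subseteq> {a..b}"
    using division_ofD(2,3,4)[OF assms(1)] assms(2) by metis
  then have "u \<le> v" by auto
  with k have "Inf k = u" "Sup k = v" by auto
  with k sub \<open>u \<le> v\<close> show "k = {Inf k..Sup k}" "Inf k \<le> Sup k" "a \<le> Inf k" "Sup k \<le> b" by auto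
qed

lemma curve_length_upper:
  assumes "d division_of {a..b}"
  shows "(\<Sum>k\<in>d. ennreal (norm (\<gamma> (Sup k) - \<gamma> (Inf k)))) \<le> curve_length \<gamma> a b"
  unfolding curve_length_def using assms by (intro SUP_upper) auto

lemma curve_length_least:
  assumes "\<And>d. d division_of {a..b} \<Longrightarrow> (\<Sum>k\<in>d. ennreal (norm (\<gamma> (Sup k) - \<gamma> (Inf k)))) \<le> B"
  shows "curve_length \<gamma> a b \<le> B"
  unfolding curve_length_def using assms by (intro SUP_least) auto

text \<open>Instances \<open>h = min v\<close> and \<open>h = max v\<close> restrict a division to one side of \<open>v\<close>.\<close>

lemma sum_map_division_le_curve_length:
  fixes \<gamma> :: "real \<Rightarrow> 'a::real_normed_vector"
  assumes d: "d division_of {a..b}" and h: "mono h" and hab: "h a = a'" "h b = b'" "a \<le> b"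
    and hid: "\<And>x y. h x < h y \<Longrightarrow> {h x<..<h y} \<subseteq> {x<..<y}"
    and conv: "\<And>x y. x \<le> y \<Longrightarrow> {h x..h y} \<subseteq> h ` {x..y}"
  shows "(\<Sum>k\<in>d. ennreal (norm (\<gamma> (h (Sup k)) - \<gamma> (h (Inf k))))) \<le> curve_length \<gamma> a' b'"
proof -
  let ?g = "\<lambda>k. {h (Inf k)..h (Sup k)}"
  let ?f = "\<lambda>k. ennreal (norm (\<gamma> (Sup k) - \<gamma> (Inf k)))"
  have fin: "finite d" using d by auto
  have mono: "h x \<le> h y" if "x \<le> y" for x y using h that by (auto dest: monoD)
  have ivl: "k = {Inf k..Sup k}" "Inf k \<le> Sup k" "a \<le> Inf k" "Sup k \<le> b" if "k \<in> d" for k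
    using division_real_interval[OF d that] by auto
  have le: "h (Inf k) \<le> h (Sup k)" "a' \<le> h (Inf k)" "h (Sup k) \<le> b'" if "k \<in> d" for k
    using ivl[OF that] mono hab by auto
  have SI: "Sup (?g k) = h (Sup k)" "Inf (?g k) = h (Inf k)" if "k \<in> d" for k
    using le[OF that] by auto
  have disj: "{h (Inf k)<..<h (Sup k)} \<inter> {h (Inf l)<..<h (Sup l)} = {}"
    if "k \<in> d" "l \<in> d" "k \<noteq> l" for k l
  proof -
    have sub: "{h (Inf k)<..<h (Sup k)} \<subseteq> interior k" if "k \<in> d" for k
    proof (cases "h (Inf k) < h (Sup k)")
      case True
      then have "{h (Inf k)<..<h (Sup k)} \<subseteq> {Inf k<..<Sup k}"
        by (rule hid)
      also have "\<dots> = interior k" using ivl(1)[OF that] by (metis interior_atLeastAtMost_real)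
      finally show ?thesis .
    qed auto
    show ?thesis
      using sub[OF that(1)] sub[OF that(2)] division_ofD(5)[OF d that] by blast
  qed
  have div: "(?g ` d) division_of {a'..b'}"
  proof (rule division_ofI)
    show "finite (?g ` d)" using fin by auto
    show "K \<subseteq> {a'..b'}" "K \<noteq> {}" "\<exists>a b. K = cbox a b" if "K \<in> ?g ` d" for K
    proof -
      obtain k where "k \<in> d" "K = ?g k" using \<open>K \<in> ?g ` d\<close> by blast
      then show "K \<subseteq> {a'..b'}" "K \<noteq> {}" "\<exists>a b. K = cbox a b" using le[of k] by auto
    qed
    show "interior K \<inter> interior L = {}" if "K \<in> ?g ` d" "L \<in> ?g ` d" "K \<noteq> L" for K L
    proof -
      obtain k l where kl: "k \<in> d" "K = ?g k" "l \<in> d" "L = ?g l"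
        using \<open>K \<in> ?g ` d\<close> \<open>L \<in> ?g ` d\<close> by blast
      with \<open>K \<noteq> L\<close> have "k \<noteq> l" by blast
      then show ?thesis using disj[OF kl(1,3)] kl by (simp add: interior_atLeastAtMost_real)
    qed
    show "\<Union> (?g ` d) = {a'..b'}"
    proof
      show "\<Union> (?g ` d) \<subseteq> {a'..b'}" using le by fastforce
      show "{a'..b'} \<subseteq> \<Union> (?g ` d)"
      proof
        fix z assume "z \<in> {a'..b'}"
        then obtain x where x: "x \<in> {a..b}" "z = h x" using conv[OF hab(3)] hab by blast
        then obtain k where k: "k \<in> d" "x \<in> k" using division_ofD(6)[OF d] by blast
        then have "Inf k \<le> x" "x \<le> Sup k" using ivl(1)[OF k(1)] by (metis atLeastAtMost_iff)+
        then show "z \<in> \<Union> (?g ` d)" using k x mono by auto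
      qed
    qed
  qed
  have "(\<Sum>k\<in>d. ennreal (norm (\<gamma> (h (Sup k)) - \<gamma> (h (Inf k))))) = (\<Sum>k\<in>d. ?f (?g k))"
    using SI by (intro sum.cong) auto
  \<comment> \<open>Several pieces may be mapped to the same interval; disjointness of interiors
    forces such an interval to be a point, which contributes nothing.\<close>
  also have "\<dots> = sum ?f (?g ` d)"
  proof (rule sum.reindex_nontrivial[symmetric, unfolded o_def])
    fix k l assume kl: "k \<in> d" "l \<in> d" "k \<noteq> l" "?g k = ?g l"
    then have "h (Inf k) = h (Inf l)" "h (Sup k) = h (Sup l)"
      using SI by metis+
    then have "{h (Inf k)<..<h (Sup k)} = {}" using disj[OF kl(1-3)] by auto
    then have "h (Inf k) = h (Sup k)" using le[OF kl(1)] by auto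
    then show "?f (?g k) = 0" using SI[OF kl(1)] by auto
  qed (rule fin)
  also have "\<dots> \<le> curve_length \<gamma> a' b'"
    by (rule curve_length_upper[OF div])
  finally show ?thesis .
qed

lemma sum_min_division_le:
  assumes "d division_of {a..b}" "a \<le> v" "v \<le> b"
  shows "(\<Sum>k\<in>d. ennreal (norm (\<gamma> (min (Sup k) v) - \<gamma> (min (Inf k) v)))) \<le> curve_length \<gamma> a v"
proof (rule sum_map_division_le_curve_length[OF assms(1)])
  show "{min x v..min y v} \<subseteq> (\<lambda>x. min x v) ` {x..y}" if "x \<le> y" for x y
  proof
    fix z assume "z \<in> {min x v..min y v}"
    then show "z \<in> (\<lambda>x. min x v) ` {x..y}" using that
      by (intro image_eqI[of _ _ "if x \<le> v then z else x"]) (auto simp: min_def split: if_splits)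
  qed
qed (use assms in \<open>auto simp: mono_def min_def\<close>)

lemma sum_max_division_le:
  assumes "d division_of {a..b}" "a \<le> v" "v \<le> b"
  shows "(\<Sum>k\<in>d. ennreal (norm (\<gamma> (max (Sup k) v) - \<gamma> (max (Inf k) v)))) \<le> curve_length \<gamma> v b"
proof (rule sum_map_division_le_curve_length[OF assms(1)])
  show "{max x v..max y v} \<subseteq> (\<lambda>x. max x v) ` {x..y}" if "x \<le> y" for x y
  proof
    fix z assume "z \<in> {max x v..max y v}"
    then show "z \<in> (\<lambda>x. max x v) ` {x..y}" using that
      by (intro image_eqI[of _ _ "if v \<le> y then (if z = v then max x v else z) else y"]) (auto simp: max_def split: if_splits)
  qed
qed (use assms in \<open>auto simp: mono_def max_def\<close>)

lemma sum_division_split_le: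
  fixes \<gamma> :: "real \<Rightarrow> 'a::real_normed_vector"
  assumes d: "d division_of {a..b}"
  shows "(\<Sum>k\<in>d. ennreal (norm (\<gamma> (Sup k) - \<gamma> (Inf k)))) \<le>
    (\<Sum>k\<in>d. ennreal (norm (\<gamma> (min (Sup k) v) - \<gamma> (min (Inf k) v)))) +
    (\<Sum>k\<in>d. ennreal (norm (\<gamma> (max (Sup k) v) - \<gamma> (max (Inf k) v))))"
  unfolding sum.distrib[symmetric]
  by (intro sum_mono)
     (simp add: division_sum_split_le ennreal_plus[symmetric] del: ennreal_plus)

lemma curve_length_subadd:
  assumes "a \<le> v" "v \<le> b"
  shows "curve_length \<gamma> a b \<le> curve_length \<gamma> a v + curve_length \<gamma> v b"
proof (rule curve_length_least)
  fix d assume d: "d division_of {a..b}"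
  show "(\<Sum>k\<in>d. ennreal (norm (\<gamma> (Sup k) - \<gamma> (Inf k)))) \<le> curve_length \<gamma> a v + curve_length \<gamma> v b"
    using sum_division_split_le[OF d, of \<gamma> v] sum_min_division_le[OF d assms, of \<gamma>]
      sum_max_division_le[OF d assms, of \<gamma>]
    by (meson add_mono order_trans)
qed

lemma curve_length_superadd:
  assumes "a \<le> v" "v \<le> b"
  shows "curve_length \<gamma> a v + curve_length \<gamma> v b \<le> curve_length \<gamma> a b"
proof -
  let ?f = "\<lambda>k. ennreal (norm (\<gamma> (Sup k) - \<gamma> (Inf k)))"
  have ne: "{d. d division_of {x..y::real}} \<noteq> {}" if "x \<le> y" for x y
    using that division_of_self[of x y] by auto
  have key: "sum ?f d + sum ?f e \<le> curve_length \<gamma> a b"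
    if d: "d division_of {a..v}" and e: "e division_of {v..b}" for d e
  proof -
    have "(d \<union> e) division_of ({a..v} \<union> {v..b})"
      by (rule division_disjoint_union[OF d e]) (auto simp: interior_atLeastAtMost_real)
    then have de: "(d \<union> e) division_of {a..b}"
      using assms by (simp add: ivl_disj_un)
    have "?f k = 0" if "k \<in> d \<inter> e" for k
    proof -
      have "Sup k = Inf k"
        using division_real_interval(2,4)[OF d, of k] division_real_interval(2,3)[OF e, of k] that by auto
      then show ?thesis by simp
    qed
    then have "sum ?f d + sum ?f e = sum ?f (d \<union> e)"
      using sum.union_inter[of d e ?f] d e by (simp add: division_of_finite)
    with curve_length_upper[OF de] show ?thesis by metis
  qed
  have "sum ?f d + curve_length \<gamma> v b \<le> curve_length \<gamma> a b" if d: "d division_of {a..v}" for d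
    unfolding curve_length_def[of \<gamma> v b] using key[OF d] ne[OF assms(2)]
    by (subst ennreal_SUP_add_right) (auto intro!: SUP_least)
  then show ?thesis
    unfolding curve_length_def[of \<gamma> a v] using ne[OF assms(1)]
    by (subst ennreal_SUP_add_left[symmetric]) (auto intro!: SUP_least)
qed

lemma norm_diff_le_curve_length:
  assumes "a \<le> b"
  shows "ennreal (norm (\<gamma> b - \<gamma> a)) \<le> curve_length \<gamma> a b"
  using curve_length_upper[of "{{a..b}}" a b \<gamma>] assms by (simp add: division_of_self[of a b, simplified])

lemma curve_length_same [simp]: "curve_length \<gamma> a a = 0"
proof -
  have "curve_length \<gamma> a a \<le> 0"
  proof (rule curve_length_least)
    fix d assume d: "d division_of {a..a}"
    have "Sup k = Inf k" if "k \<in> d" for k using division_real_interval[OF d that] by simp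
    then show "(\<Sum>k\<in>d. ennreal (norm (\<gamma> (Sup k) - \<gamma> (Inf k)))) \<le> 0" by simp
  qed
  then show ?thesis by simp
qed

lemma curve_length_mono:
  assumes "a \<le> u" "u \<le> v"
  shows "curve_length \<gamma> a u \<le> curve_length \<gamma> a v"
  using curve_length_superadd[OF assms, of \<gamma>] by (metis add.right_neutral add_left_mono order_trans zero_le)

lemma curve_length_nearly_attained:
  assumes "curve_length \<gamma> a b < \<infinity>" "0 < \<epsilon>" "a \<le> b"
  obtains d where "d division_of {a..b}"
    "curve_length \<gamma> a b \<le> (\<Sum>k\<in>d. ennreal (norm (\<gamma> (Sup k) - \<gamma> (Inf k)))) + ennreal \<epsilon>"
proof -
  have ne: "{d. d division_of {a..b::real}} \<noteq> {}"
    using assms division_of_self[of a b] by auto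
  have "\<exists>d\<in>{d. d division_of {a..b}}. curve_length \<gamma> a b < (\<Sum>k\<in>d. ennreal (norm (\<gamma> (Sup k) - \<gamma> (Inf k)))) + ennreal \<epsilon>"
    using assms(1) by (intro SUP_approx_ennreal[OF assms(2) ne curve_length_def]) simp
  then show thesis using that by (auto intro: less_imp_le)
qed

lemma card_bound_sum:
  assumes d: "finite d" and "\<And>k. k \<in> d \<Longrightarrow> norm (\<gamma> (h (Sup k)) - \<gamma> (h (Inf k))) \<le> M"
  shows "(\<Sum>k\<in>d. ennreal (norm (\<gamma> (h (Sup k)) - \<gamma> (h (Inf k))))) \<le> ennreal (of_nat (card d) * M)"
proof -
  have "(\<Sum>k\<in>d. ennreal (norm (\<gamma> (h (Sup k)) - \<gamma> (h (Inf k))))) \<le> (\<Sum>k\<in>d. ennreal M)"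
    using assms by (intro sum_mono ennreal_leI) auto
  also have "\<dots> = ennreal (of_nat (card d) * M)"
    by (cases "M \<ge> 0") (auto simp: ennreal_mult ennreal_of_nat_eq_real_of_nat ennreal_neg mult_nonneg_nonpos)
  finally show ?thesis .
qed

text \<open>A division of \<open>{0..t0}\<close> that nearly attains the length is split at a nearby
  \<open>v\<close>. The part beyond \<open>v\<close> is a sum of finitely many increments of
  \<open>\<gamma>\<close> near \<open>t0\<close>, small by continuity, so hardly any length lies
  beyond \<open>v\<close>. For \<open>v\<close> to the right of \<open>t0\<close> a division of
  \<open>{t0..1}\<close> is used in the same way.\<close>

lemma continuous_curve_length:
  fixes \<gamma> :: "real \<Rightarrow> 'a::real_normed_vector"
  assumes cont: "continuous_on {0..1} \<gamma>" and rect: "curve_length \<gamma> 0 1 < \<infinity>"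
  shows "continuous_on {0..1} (\<lambda>t. enn2real (curve_length \<gamma> 0 t))"
  unfolding continuous_on_iff
proof (intro ballI allI impI)
  fix t0 :: real and e :: real
  assume t0: "t0 \<in> {0..1}" and e: "0 < e"
  let ?s = "curve_length \<gamma>"
  have fin: "?s u v < \<infinity>" if "0 \<le> u" "u \<le> v" "v \<le> 1" for u v
  proof -
    have "?s u v \<le> ?s 0 v"
      using curve_length_superadd[OF that(1,2), of \<gamma>] by (metis add.left_neutral add_right_mono order_trans zero_le)
    also have "\<dots> \<le> ?s 0 1" using that by (intro curve_length_mono) auto
    finally show ?thesis using rect by (auto intro: le_less_trans)
  qed
  obtain d1 where d1: "d1 division_of {0..t0}"
    "?s 0 t0 \<le> (\<Sum>k\<in>d1. ennreal (norm (\<gamma> (Sup k) - \<gamma> (Inf k)))) + ennreal (e/4)"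
    using curve_length_nearly_attained[of \<gamma> 0 t0 "e/4"] t0 e fin[of 0 t0] by auto
  obtain d2 where d2: "d2 division_of {t0..1}"
    "?s t0 1 \<le> (\<Sum>k\<in>d2. ennreal (norm (\<gamma> (Sup k) - \<gamma> (Inf k)))) + ennreal (e/4)"
    using curve_length_nearly_attained[of \<gamma> t0 1 "e/4"] t0 e fin[of t0 1] by auto
  \<comment> \<open>\<open>N\<close> exceeds the number of pieces of both divisions, so increments
    of size \<open>e / (4 * N)\<close> add up to at most \<open>e / 4\<close>; the summand 1 makes
    it positive.\<close>
  define N where "N = real (card d1) + real (card d2) + 1"
  have N: "N > 0" unfolding N_def by simp
  obtain \<delta> where \<delta>: "\<delta> > 0" "\<And>t. t \<in> {0..1} \<Longrightarrow> \<bar>t - t0\<bar> < \<delta> \<Longrightarrow> norm (\<gamma> t - \<gamma> t0) < e / (8 * N)"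
    using cont[unfolded continuous_on_iff, rule_format, OF t0, of "e / (8 * N)"] e N
    by (auto simp: dist_norm)
  have osc: "norm (\<gamma> s - \<gamma> t) \<le> e / (4 * N)"
    if "s \<in> {0..1}" "\<bar>s - t0\<bar> < \<delta>" "t \<in> {0..1}" "\<bar>t - t0\<bar> < \<delta>" for s t
  proof -
    have "norm (\<gamma> s - \<gamma> t) \<le> norm (\<gamma> s - \<gamma> t0) + norm (\<gamma> t - \<gamma> t0)"
      using norm_triangle_ineq4[of "\<gamma> s - \<gamma> t0" "\<gamma> t - \<gamma> t0"] by simp
    also have "\<dots> \<le> e / (8 * N) + e / (8 * N)" using \<delta>(2) that by (intro add_mono) (auto intro: less_imp_le)
    finally show ?thesis by (simp add: field_simps)
  qed
  have small: "real (card d1) * (e / (4*N)) \<le> e / 4" "real (card d2) * (e / (4*N)) \<le> e / 4"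
    using e N by (auto simp: field_simps N_def)
  have "\<bar>enn2real (?s 0 v) - enn2real (?s 0 t0)\<bar> < e" if v: "v \<in> {0..1}" "\<bar>v - t0\<bar> < \<delta>" for v
  proof (cases "v \<le> t0")
    case True
    have "(\<Sum>k\<in>d1. ennreal (norm (\<gamma> (max (Sup k) v) - \<gamma> (max (Inf k) v)))) \<le> ennreal (real (card d1) * (e / (4*N)))"
      using division_of_finite[OF d1(1)]
    proof (rule card_bound_sum)
      fix k assume "k \<in> d1"
      note ivl = division_real_interval[OF d1(1) this]
      show "norm (\<gamma> (max (Sup k) v) - \<gamma> (max (Inf k) v)) \<le> e / (4 * N)"
        using ivl v True t0 by (intro osc) (auto simp: max_def)
    qed
    also have "\<dots> \<le> ennreal (e/4)" using small by (intro ennreal_leI) auto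
    finally have "(\<Sum>k\<in>d1. ennreal (norm (\<gamma> (Sup k) - \<gamma> (Inf k)))) \<le> ?s 0 v + ennreal (e/4)"
      using sum_division_split_le[OF d1(1), of \<gamma> v] sum_min_division_le[OF d1(1) _ True, of \<gamma>] v
      by (meson add_mono order_trans atLeastAtMost_iff)
    then have "?s 0 t0 \<le> ?s 0 v + ennreal (e/4) + ennreal (e/4)"
      using d1(2) by (meson add_mono order_trans order_refl)
    also have "\<dots> = ennreal (enn2real (?s 0 v) + e/2)"
      using fin[of 0 v] v e
      by (cases "?s 0 v") (auto simp: ennreal_plus[symmetric] simp del: ennreal_plus)
    finally have "enn2real (?s 0 t0) \<le> enn2real (?s 0 v) + e/2"
      using e by (metis enn2real_leI add_nonneg_nonneg enn2real_nonneg half_gt_zero less_imp_le)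
    moreover have "enn2real (?s 0 v) \<le> enn2real (?s 0 t0)"
      using v True fin[of 0 t0] t0 by (intro enn2real_mono curve_length_mono) auto
    ultimately show ?thesis using e by auto
  next
    case False
    then have tv: "t0 \<le> v" by simp
    have "(\<Sum>k\<in>d2. ennreal (norm (\<gamma> (min (Sup k) v) - \<gamma> (min (Inf k) v)))) \<le> ennreal (real (card d2) * (e / (4*N)))"
      using division_of_finite[OF d2(1)]
    proof (rule card_bound_sum)
      fix k assume "k \<in> d2"
      note ivl = division_real_interval[OF d2(1) this]
      show "norm (\<gamma> (min (Sup k) v) - \<gamma> (min (Inf k) v)) \<le> e / (4 * N)"
        using ivl v tv t0 by (intro osc) (auto simp: min_def)
    qed
    also have "\<dots> \<le> ennreal (e/4)" using small by (intro ennreal_leI) auto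
    finally have "(\<Sum>k\<in>d2. ennreal (norm (\<gamma> (Sup k) - \<gamma> (Inf k)))) \<le> ennreal (e/4) + ?s v 1"
      using sum_division_split_le[OF d2(1), of \<gamma> v] sum_max_division_le[OF d2(1) tv, of \<gamma>] v
      by (meson add_mono order_trans atLeastAtMost_iff)
    then have "?s t0 1 \<le> ennreal (e/4) + ?s v 1 + ennreal (e/4)"
      using d2(2) by (meson add_mono order_trans order_refl)
    then have "?s t0 v + ?s v 1 \<le> ennreal (e/2) + ?s v 1"
      using curve_length_superadd[OF tv, of 1 \<gamma>] v e
      by (simp add: add.commute add.left_commute ennreal_plus[symmetric] order_trans del: ennreal_plus)
    then have "?s t0 v \<le> ennreal (e/2)"
      using fin[of v 1] v by (auto simp: ennreal_add_left_cancel_le add.commute)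
    then have "?s 0 v \<le> ?s 0 t0 + ennreal (e/2)"
      using curve_length_subadd[of 0 t0 v \<gamma>] t0 tv by (meson add_left_mono atLeastAtMost_iff order_trans)
    also have "\<dots> = ennreal (enn2real (?s 0 t0) + e/2)"
      using fin[of 0 t0] t0 e
      by (cases "?s 0 t0") (auto simp: ennreal_plus[symmetric] simp del: ennreal_plus)
    finally have "enn2real (?s 0 v) \<le> enn2real (?s 0 t0) + e/2"
      using e by (metis enn2real_leI add_nonneg_nonneg enn2real_nonneg half_gt_zero less_imp_le)
    moreover have "enn2real (?s 0 t0) \<le> enn2real (?s 0 v)"
      using v tv fin[of 0 v] t0 by (intro enn2real_mono curve_length_mono) auto
    ultimately show ?thesis using e by auto
  qed
  then show "\<exists>d>0. \<forall>x'\<in>{0..1}. dist x' t0 < d \<longrightarrow>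
      dist (enn2real (?s 0 x')) (enn2real (?s 0 t0)) < e"
    using \<delta>(1) by (auto simp: dist_real_def)
qed

lemma arc_length_param_spec:
  fixes \<gamma> :: "real \<Rightarrow> 'a::real_normed_vector"
  assumes "path \<gamma>" "rectifiable \<gamma>" "u \<in> {0..enn2real (curve_length \<gamma> 0 1)}"
  obtains t where "t \<in> {0..1}" "curve_length \<gamma> 0 t = ennreal u" "arc_length_param \<gamma> u = \<gamma> t"
proof -
  have rect: "curve_length \<gamma> 0 1 < \<infinity>" using assms(2) by (simp add: rectifiable_def)
  have "\<exists>t. 0 \<le> t \<and> t \<le> 1 \<and> enn2real (curve_length \<gamma> 0 t) = u"
    using continuous_curve_length[OF _ rect] assms by (intro IVT') (auto simp: path_def)
  then obtain t where t: "0 \<le> t" "t \<le> 1" "enn2real (curve_length \<gamma> 0 t) = u" by auto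
  have "curve_length \<gamma> 0 t < \<infinity>"
    using curve_length_mono[OF t(1,2), of \<gamma>] rect by (auto intro: le_less_trans)
  then have "t \<in> {0..1} \<and> curve_length \<gamma> 0 t = ennreal u"
    using t by (auto simp: ennreal_enn2real)
  then have "(SOME t. t \<in> {0..1} \<and> curve_length \<gamma> 0 t = ennreal u) \<in> {0..1} \<and>
      curve_length \<gamma> 0 (SOME t. t \<in> {0..1} \<and> curve_length \<gamma> 0 t = ennreal u) = ennreal u"
    by (rule someI)
  then show thesis using that by (auto simp: arc_length_param_def)
qed

text \<open>The chord is no longer than the arc, by superadditivity. This makes the arc length
  parametrisation 1-Lipschitz, and with \<open>u = v\<close> it shows that parameters of equal arc
  length give the same point.\<close>

lemma curve_length_eq_imp_norm_le:
  assumes "0 \<le> s" "s \<le> t" "curve_length \<gamma> 0 s = ennreal u" "curve_length \<gamma> 0 t = ennreal v" "0 \<le> u" "0 \<le> v"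
  shows "norm (\<gamma> t - \<gamma> s) \<le> v - u"
proof -
  have "ennreal u + ennreal (norm (\<gamma> t - \<gamma> s)) \<le> ennreal v"
    using curve_length_superadd[OF assms(1,2), of \<gamma>] norm_diff_le_curve_length[OF assms(2), of \<gamma>] assms(3,4)
    by (metis add_left_mono order_trans)
  then show ?thesis using assms by (simp add: ennreal_plus[symmetric] del: ennreal_plus)
qed

lemma arc_length_param_lipschitz:
  fixes \<gamma> :: "real \<Rightarrow> 'a::real_normed_vector"
  assumes "path \<gamma>" "rectifiable \<gamma>"
    "u \<in> {0..enn2real (curve_length \<gamma> 0 1)}" "v \<in> {0..enn2real (curve_length \<gamma> 0 1)}"
  shows "norm (arc_length_param \<gamma> u - arc_length_param \<gamma> v) \<le> \<bar>u - v\<bar>"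
proof -
  obtain s where s: "s \<in> {0..1}" "curve_length \<gamma> 0 s = ennreal u" "arc_length_param \<gamma> u = \<gamma> s"
    using arc_length_param_spec[OF assms(1-3)] .
  obtain t where t: "t \<in> {0..1}" "curve_length \<gamma> 0 t = ennreal v" "arc_length_param \<gamma> v = \<gamma> t"
    using arc_length_param_spec[OF assms(1,2,4)] .
  show ?thesis
    using curve_length_eq_imp_norm_le[of s t \<gamma> u v] curve_length_eq_imp_norm_le[of t s \<gamma> v u] s t assms(3,4)
    by (cases "s \<le> t") (auto simp: norm_minus_commute)
qed

lemma arc_length_param_ends:
  fixes \<gamma> :: "real \<Rightarrow> 'a::real_normed_vector"
  assumes "path \<gamma>" "rectifiable \<gamma>"
  shows "arc_length_param \<gamma> 0 = \<gamma> 0" "arc_length_param \<gamma> (enn2real (curve_length \<gamma> 0 1)) = \<gamma> 1"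
proof -
  obtain s where s: "s \<in> {0..1}" "curve_length \<gamma> 0 s = ennreal 0" "arc_length_param \<gamma> 0 = \<gamma> s"
    using arc_length_param_spec[OF assms, of 0] by auto
  show "arc_length_param \<gamma> 0 = \<gamma> 0"
    using curve_length_eq_imp_norm_le[of 0 s \<gamma> 0 0] s by auto
  let ?l = "enn2real (curve_length \<gamma> 0 1)"
  have l: "curve_length \<gamma> 0 1 = ennreal ?l" using assms(2) by (simp add: rectifiable_def ennreal_enn2real)
  obtain t where t: "t \<in> {0..1}" "curve_length \<gamma> 0 t = ennreal ?l" "arc_length_param \<gamma> ?l = \<gamma> t"
    using arc_length_param_spec[OF assms, of ?l] by auto
  show "arc_length_param \<gamma> ?l = \<gamma> 1"
    using curve_length_eq_imp_norm_le[of t 1 \<gamma> ?l ?l] t l by auto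
qed

section \<open>Upper gradients and line integrals\<close>

text \<open>The slope condition holds at every point, which a gauge can exploit: on a tagged
  division fine both for the Henstock-Kurzweil integral of \<open>g\<close> and for the radii of the
  slope condition, the telescoping sum of \<open>\<phi>\<close> is dominated by the Riemann sum of
  \<open>g\<close>.\<close>

lemma slope_integral_bound:
  fixes \<phi> g :: "real \<Rightarrow> real"
  assumes ab: "a \<le> b" and meas: "(\<lambda>v. indicator {a..b} v * g v) \<in> borel_measurable borel"
    and g0: "\<And>v. 0 \<le> g v"
    and slope: "\<And>v \<epsilon>. v \<in> {a..b} \<Longrightarrow> 0 < \<epsilon> \<Longrightarrow>
      \<exists>\<delta>>0. \<forall>w\<in>{a..b}. \<bar>w - v\<bar> < \<delta> \<longrightarrow> \<bar>\<phi> w - \<phi> v\<bar> \<le> (g v + \<epsilon>) * \<bar>w - v\<bar>"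
  shows "ennreal \<bar>\<phi> b - \<phi> a\<bar> \<le> (\<integral>\<^sup>+v\<in>{a..b}. ennreal (g v) \<partial>lborel)"
proof (cases "(\<integral>\<^sup>+v\<in>{a..b}. ennreal (g v) \<partial>lborel) < \<infinity>")
  case True
  have eq: "ennreal (g v) * indicator {a..b} v = ennreal (indicator {a..b} v * g v)" for v
    by (auto simp: indicator_def)
  have int: "set_integrable lborel {a..b} g"
    unfolding set_integrable_def real_scaleR_def
    using True meas g0 by (intro integrableI_nonneg) (auto simp: eq)
  define I where "I = (LINT v:{a..b}|lborel. g v)"
  have I: "(\<integral>\<^sup>+v\<in>{a..b}. ennreal (g v) \<partial>lborel) = ennreal I"
    unfolding I_def set_lebesgue_integral_def eq real_scaleR_def
    using int g0 by (intro nn_integral_eq_integral) (auto simp: set_integrable_def)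
  have hI: "(g has_integral I) (cbox a b)"
    unfolding I_def using set_borel_integral_eq_integral[OF int] by (simp add: has_integral_iff)
  have "\<bar>\<phi> b - \<phi> a\<bar> \<le> I + e" if e: "0 < e" for e
  proof -
    \<comment> \<open>Over the whole interval the slack \<open>\<epsilon>\<close> adds up to at most
      \<open>e / 2\<close>; the other half pays for the Riemann sum.\<close>
    define \<epsilon> where "\<epsilon> = e / (2 * (b - a + 1))"
    have \<epsilon>: "0 < \<epsilon>" using e ab by (auto simp: \<epsilon>_def)
    have \<epsilon>e: "\<epsilon> * (b - a) \<le> e / 2" using e ab by (auto simp: \<epsilon>_def field_simps)
    obtain G where G: "gauge G" "\<And>D. D tagged_division_of cbox a b \<Longrightarrow> G fine D \<Longrightarrow>
        norm ((\<Sum>(x,k)\<in>D. measure lborel k *\<^sub>R g x) - I) < e/2"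
      using hI[unfolded has_integral, rule_format, of "e/2"] e by auto
    have "\<exists>\<delta>. \<forall>v. 0 < \<delta> v \<and> (v \<in> {a..b} \<longrightarrow>
        (\<forall>w\<in>{a..b}. \<bar>w - v\<bar> < \<delta> v \<longrightarrow> \<bar>\<phi> w - \<phi> v\<bar> \<le> (g v + \<epsilon>) * \<bar>w - v\<bar>))"
    proof (rule choice, rule allI)
      fix v
      show "\<exists>\<delta>. 0 < \<delta> \<and> (v \<in> {a..b} \<longrightarrow>
        (\<forall>w\<in>{a..b}. \<bar>w - v\<bar> < \<delta> \<longrightarrow> \<bar>\<phi> w - \<phi> v\<bar> \<le> (g v + \<epsilon>) * \<bar>w - v\<bar>))"
      proof (cases "v \<in> {a..b}")
        case True
        then show ?thesis using slope[OF True \<epsilon>] by blast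
      next
        case False
        then show ?thesis using zero_less_one by blast
      qed
    qed
    then obtain \<delta> where \<delta>: "\<And>v. 0 < \<delta> v" "\<And>v w. v \<in> {a..b} \<Longrightarrow> w \<in> {a..b} \<Longrightarrow> \<bar>w - v\<bar> < \<delta> v \<Longrightarrow>
       \<bar>\<phi> w - \<phi> v\<bar> \<le> (g v + \<epsilon>) * \<bar>w - v\<bar>" by blast
    have gauge: "gauge (\<lambda>x. G x \<inter> ball x (\<delta> x))"
      using G(1) \<delta>(1) by (intro gauge_Int gauge_ball_dependent) auto
    obtain D where D: "D tagged_division_of {a..b}" "(\<lambda>x. G x \<inter> ball x (\<delta> x)) fine D"
      using fine_division_exists_real[OF gauge] by blast
    have D': "G fine D" "(\<lambda>x. ball x (\<delta> x)) fine D" using D(2) by (auto simp: fine_Int)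
    have "\<bar>\<phi> b - \<phi> a\<bar> = \<bar>\<Sum>(x,K)\<in>D. \<phi> (Sup K) - \<phi> (Inf K)\<bar>"
      using additive_tagged_division_1[OF ab D(1), of \<phi>] by simp
    also have "\<dots> \<le> (\<Sum>(x,K)\<in>D. \<bar>\<phi> (Sup K) - \<phi> (Inf K)\<bar>)"
      by (rule order_trans[OF sum_abs]) (auto intro: sum_mono)
    also have "\<dots> \<le> (\<Sum>(x,K)\<in>D. measure lborel K *\<^sub>R g x + \<epsilon> * measure lborel K)"
    proof (rule sum_mono, clarify)
      fix x K assume xK: "(x, K) \<in> D"
      obtain u v where K: "K = cbox u v" using tagged_division_ofD(4)[OF D(1) xK] by auto
      have xin: "x \<in> K" "K \<subseteq> {a..b}" using tagged_division_ofD(2,3)[OF D(1) xK] by auto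
      then have uv: "u \<le> x" "x \<le> v" "u \<in> {a..b}" "v \<in> {a..b}" "x \<in> {a..b}" using K by auto
      have "K \<subseteq> ball x (\<delta> x)" using D'(2) xK by (auto simp: fine_def)
      moreover have "u \<in> K" "v \<in> K" using K uv by auto
      ultimately have "u \<in> ball x (\<delta> x)" "v \<in> ball x (\<delta> x)" by blast+
      then have "\<bar>u - x\<bar> < \<delta> x" "\<bar>v - x\<bar> < \<delta> x" by (auto simp: dist_real_def)
      \<comment> \<open>Both end points are compared with the tag, which lies between them, so their
        distances to it add up to the length of \<open>K\<close>.\<close>
      then have "\<bar>\<phi> u - \<phi> x\<bar> \<le> (g x + \<epsilon>) * \<bar>u - x\<bar>" "\<bar>\<phi> v - \<phi> x\<bar> \<le> (g x + \<epsilon>) * \<bar>v - x\<bar>"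
        using \<delta>(2)[OF uv(5,3)] \<delta>(2)[OF uv(5,4)] by blast+
      moreover have "\<bar>u - x\<bar> = x - u" "\<bar>v - x\<bar> = v - x" using uv by auto
      moreover have "\<bar>\<phi> v - \<phi> u\<bar> \<le> \<bar>\<phi> u - \<phi> x\<bar> + \<bar>\<phi> v - \<phi> x\<bar>" by linarith
      ultimately have "\<bar>\<phi> v - \<phi> u\<bar> \<le> (g x + \<epsilon>) * (x - u) + (g x + \<epsilon>) * (v - x)"
        by simp
      also have "\<dots> = measure lborel K *\<^sub>R g x + \<epsilon> * measure lborel K" using K uv by (simp add: algebra_simps)
      finally show "\<bar>\<phi> (Sup K) - \<phi> (Inf K)\<bar> \<le> measure lborel K *\<^sub>R g x + \<epsilon> * measure lborel K"
        using K uv by auto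
    qed
    also have "\<dots> = (\<Sum>(x,K)\<in>D. measure lborel K *\<^sub>R g x) + \<epsilon> * (\<Sum>(x,K)\<in>D. measure lborel K)"
      by (simp add: sum.distrib sum_distrib_left split_def)
    also have "(\<Sum>(x,K)\<in>D. measure lborel K) = b - a"
      using additive_content_tagged_division[of D a b] D(1) ab by simp
    also have "(\<Sum>(x,K)\<in>D. measure lborel K *\<^sub>R g x) \<le> I + e / 2"
    proof -
      have "\<bar>(\<Sum>(x,K)\<in>D. measure lborel K *\<^sub>R g x) - I\<bar> < e/2"
        using G(2)[of D] D(1) D'(1) by (simp only: cbox_interval real_norm_def)
      then show ?thesis by linarith
    qed
    finally show ?thesis using \<epsilon>e by linarith
  qed
  then have "\<bar>\<phi> b - \<phi> a\<bar> \<le> I" by (rule field_le_epsilon)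
  then show ?thesis unfolding I by (rule ennreal_leI)
next
  case False
  then have "(\<integral>\<^sup>+v\<in>{a..b}. ennreal (g v) \<partial>lborel) = \<infinity>" by (simp add: less_top[symmetric])
  then show ?thesis by simp
qed

text \<open>Upper gradients: stopping at the levels \<open>\<eta>\<close> and \<open>1 - \<eta>\<close> keeps the curve inside
  \<open>{0 < u < 1}\<close>, the only place where \<open>\<rho>\<close> controls the slope of \<open>u\<close>.\<close>

lemma line_integral_ge_one:
  fixes u \<rho> :: "'a::euclidean_space \<Rightarrow> real"
  assumes \<gamma>: "path \<gamma>" "rectifiable \<gamma>" "u (\<gamma> 0) = 1" "u (\<gamma> 1) = 0"
    and cont: "continuous_on UNIV u" and meas: "\<rho> \<in> borel_measurable borel" and \<rho>0: "\<And>p. 0 \<le> \<rho> p"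
    and slope: "\<And>p \<epsilon>. 0 < u p \<Longrightarrow> u p < 1 \<Longrightarrow> 0 < \<epsilon> \<Longrightarrow>
      \<forall>\<^sub>F q in nhds p. \<bar>u q - u p\<bar> \<le> (\<rho> p + \<epsilon>) * norm (q - p)"
  shows "1 \<le> line_integral (\<lambda>p. ennreal (\<rho> p)) \<gamma>"
proof -
  define l where "l = enn2real (curve_length \<gamma> 0 1)"
  define G where "G = arc_length_param \<gamma>"
  have l0: "0 \<le> l" by (simp add: l_def)
  have lip: "norm (G v - G w) \<le> \<bar>v - w\<bar>" if "v \<in> {0..l}" "w \<in> {0..l}" for v w
    using arc_length_param_lipschitz[OF \<gamma>(1,2)] that by (simp add: G_def l_def)
  have Gcont: "continuous_on {0..l} G"
    unfolding continuous_on_iff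
  proof (intro ballI allI impI)
    fix x e :: real assume "x \<in> {0..l}" "0 < e"
    then show "\<exists>d>0. \<forall>x'\<in>{0..l}. dist x' x < d \<longrightarrow> dist (G x') (G x) < e"
      using lip[of _ x] by (intro exI[of _ e]) (force simp: dist_norm)
  qed
  have ends: "u (G 0) = 1" "u (G l) = 0"
    using arc_length_param_ends[OF \<gamma>(1,2)] \<gamma>(3,4) by (auto simp: G_def l_def)
  have \<phi>cont: "continuous_on {0..l} (\<lambda>v. u (G v))"
    by (rule continuous_on_compose2[OF cont Gcont]) auto
  have "ennreal (1 - 2 * \<eta>) \<le> line_integral (\<lambda>p. ennreal (\<rho> p)) \<gamma>" if \<eta>: "0 < \<eta>" "\<eta> < 1/2" for \<eta>
  proof -
    \<comment> \<open>\<open>a\<close> will be the last parameter with value at least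
      \<open>1 - \<eta>\<close>, and \<open>b\<close> the first one after it with value at most
      \<open>\<eta>\<close>; between them the curve stays in \<open>{0 < u < 1}\<close>.\<close>
    let ?A = "{v\<in>{0..l}. 1 - \<eta> \<le> u (G v)}"
    have "compact ?A"
      unfolding compact_eq_bounded_closed 
    proof
      show "bounded ?A" by (rule bounded_subset[OF bounded_closed_interval[of 0 l]]) auto
      show "closed ?A" by (intro continuous_on_closed_Collect_le continuous_intros \<phi>cont closed_atLeastAtMost)
    qed
    moreover have "0 \<in> ?A" using ends l0 \<eta> by auto
    ultimately obtain a where a: "a \<in> ?A" "\<And>v. v \<in> ?A \<Longrightarrow> v \<le> a"
      using compact_attains_sup[of ?A] by blast
    have al: "a \<le> l" "0 \<le> a" using a by auto
    have acont: "continuous_on {a..l} (\<lambda>v. u (G v))"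
      by (rule continuous_on_subset[OF \<phi>cont]) (use al in auto)
    have ua: "u (G a) = 1 - \<eta>"
    proof (rule ccontr)
      assume "u (G a) \<noteq> 1 - \<eta>"
      obtain v where v: "a \<le> v" "v \<le> l" "u (G v) = 1 - \<eta>"
        using IVT2'[of "\<lambda>v. u (G v)" l "1 - \<eta>" a] acont a ends \<eta> al by auto
      then have "v \<in> ?A" using al by auto
      then have "v = a" using a(2) v(1) by (meson antisym)
      with v \<open>u (G a) \<noteq> 1 - \<eta>\<close> show False by simp
    qed
    let ?B = "{v\<in>{a..l}. u (G v) \<le> \<eta>}"
    have "compact ?B"
      unfolding compact_eq_bounded_closed 
    proof
      show "bounded ?B" by (rule bounded_subset[OF bounded_closed_interval[of a l]]) auto
      show "closed ?B" by (intro continuous_on_closed_Collect_le continuous_intros acont closed_atLeastAtMost)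
    qed
    moreover have "l \<in> ?B" using ends al \<eta> by auto
    ultimately obtain b where b: "b \<in> ?B" "\<And>v. v \<in> ?B \<Longrightarrow> b \<le> v"
      using compact_attains_inf[of ?B] by blast
    have bl: "a \<le> b" "b \<le> l" using b by auto
    have ub: "u (G b) = \<eta>"
    proof (rule ccontr)
      assume "u (G b) \<noteq> \<eta>"
      obtain v where v: "a \<le> v" "v \<le> b" "u (G v) = \<eta>"
        using IVT2'[of "\<lambda>v. u (G v)" b "\<eta>" a] continuous_on_subset[OF acont, of "{a..b}"] b ua \<eta> bl by auto
      then have "v \<in> ?B" using bl by auto
      then have "v = b" using b(2) v(2) by (meson antisym)
      with v \<open>u (G b) \<noteq> \<eta>\<close> show False by simp
    qed
    have between: "0 < u (G v)" "u (G v) < 1" if "v \<in> {a..b}" for v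
    proof -
      have "\<not> 1 - \<eta> \<le> u (G v)" if "v \<noteq> a" using a(2)[of v] that \<open>v \<in> {a..b}\<close> al bl by auto
      then show "u (G v) < 1" using ua \<eta> by (cases "v = a") auto
      have "\<not> u (G v) \<le> \<eta>" if "v \<noteq> b" using b(2)[of v] that \<open>v \<in> {a..b}\<close> al bl by auto
      then show "0 < u (G v)" using ub \<eta> by (cases "v = b") auto
    qed
    have sub: "{a..b} \<subseteq> {0..l}" using al bl by auto
    have "ennreal \<bar>u (G b) - u (G a)\<bar> \<le> (\<integral>\<^sup>+v\<in>{a..b}. ennreal (\<rho> (G v)) \<partial>lborel)"
    proof (rule slope_integral_bound[OF bl(1), where \<phi> = "\<lambda>v. u (G v)"])
      have "(\<lambda>v. indicator {a..b} v *\<^sub>R G v) \<in> borel_measurable borel"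
        using continuous_on_subset[OF Gcont sub]
        by (intro borel_measurable_continuous_on_indicator) auto
      then have "(\<lambda>v. indicator {a..b} v * \<rho> (indicator {a..b} v *\<^sub>R G v)) \<in> borel_measurable borel"
        using meas by measurable
      also have "(\<lambda>v. indicator {a..b} v * \<rho> (indicator {a..b} v *\<^sub>R G v)) = (\<lambda>v. indicator {a..b} v * \<rho> (G v))"
        by (auto simp: indicator_def)
      finally show "(\<lambda>v. indicator {a..b} v * \<rho> (G v)) \<in> borel_measurable borel" .
      fix v \<epsilon> :: real assume v: "v \<in> {a..b}" and "0 < \<epsilon>"
      then obtain d where d: "d > 0" "\<And>q. dist q (G v) < d \<Longrightarrow> \<bar>u q - u (G v)\<bar> \<le> (\<rho> (G v) + \<epsilon>) * norm (q - G v)"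
        using slope[OF between[OF v] \<open>0 < \<epsilon>\<close>] unfolding eventually_nhds_metric by blast
      have "\<bar>u (G w) - u (G v)\<bar> \<le> (\<rho> (G v) + \<epsilon>) * \<bar>w - v\<bar>" if w: "w \<in> {a..b}" "\<bar>w - v\<bar> < d" for w
      proof -
        have n: "norm (G w - G v) \<le> \<bar>w - v\<bar>" using lip v w sub by blast
        then have "\<bar>u (G w) - u (G v)\<bar> \<le> (\<rho> (G v) + \<epsilon>) * norm (G w - G v)"
          using d(2) w by (auto simp: dist_norm)
        also have "\<dots> \<le> (\<rho> (G v) + \<epsilon>) * \<bar>w - v\<bar>"
          using n \<rho>0[of "G v"] \<open>0 < \<epsilon>\<close> by (intro mult_left_mono) auto
        finally show ?thesis .
      qed
      then show "\<exists>\<delta>>0. \<forall>w\<in>{a..b}. \<bar>w - v\<bar> < \<delta> \<longrightarrow> \<bar>u (G w) - u (G v)\<bar> \<le> (\<rho> (G v) + \<epsilon>) * \<bar>w - v\<bar>"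
        using d(1) by blast
    qed (use \<rho>0 in auto)
    also have "\<dots> \<le> (\<integral>\<^sup>+v\<in>{0..l}. ennreal (\<rho> (G v)) \<partial>lborel)"
      using sub by (intro nn_integral_mono mult_left_mono) (auto simp: indicator_def)
    finally show ?thesis
      using ua ub \<eta> by (simp add: line_integral_def G_def l_def)
  qed
  note le = this
  show ?thesis
  proof (rule ccontr)
    assume "\<not> ?thesis"
    then have *: "line_integral (\<lambda>p. ennreal (\<rho> p)) \<gamma> < 1" by simp
    then obtain x where x: "line_integral (\<lambda>p. ennreal (\<rho> p)) \<gamma> = ennreal x" "0 \<le> x" "x < 1"
      by (cases "line_integral (\<lambda>p. ennreal (\<rho> p)) \<gamma>") auto
    define \<eta> where "\<eta> = (1 - x) / 4"
    have "ennreal (1 - 2 * \<eta>) \<le> ennreal x"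
      using x le[of \<eta>] by (auto simp: \<eta>_def)
    then have "1 - 2 * \<eta> \<le> x" using x by simp
    then show False using x by (simp add: \<eta>_def field_simps)
  qed
qed

section \<open>Curves of constant speed\<close>

lemma local_growth_imp_growth:
  fixes s :: "real \<Rightarrow> real"
  assumes \<delta>: "0 < \<delta>" and s: "\<And>u v. a \<le> u \<Longrightarrow> u \<le> v \<Longrightarrow> v \<le> b \<Longrightarrow> v - u < \<delta> \<Longrightarrow> K * (v - u) \<le> s v - s u"
    and "a \<le> b"
  shows "K * (b - a) \<le> s b - s a"
proof -
  have "K * (v - a) \<le> s v - s a" if "a \<le> v" "v \<le> b" "v - a \<le> real N * (\<delta>/2)" for N v
    using that
  proof (induction N arbitrary: v)
    case (Suc N)
    \<comment> \<open>A step back by half of \<open>\<delta>\<close> keeps the strict inequality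
      which the local hypothesis demands.\<close>
    define w where "w = max a (v - \<delta>/2)"
    have "K * (w - a) \<le> s w - s a" using Suc.prems \<delta> by (intro Suc.IH) (auto simp: w_def max_def algebra_simps)
    moreover have "K * (v - w) \<le> s v - s w" using Suc.prems \<delta> by (intro s) (auto simp: w_def)
    ultimately show ?case by (simp add: algebra_simps)
  qed auto
  moreover obtain N :: nat where "b - a \<le> real N * (\<delta>/2)"
    using reals_Archimedean3[of "\<delta>/2"] \<delta> by (metis half_gt_zero less_imp_le)
  ultimately show ?thesis using assms by auto
qed

text \<open>The lower estimate is required only for pairs on one side of \<open>1/2\<close>, because
  the curves in question have a corner there. Local chords bound the growth of the length function
  from below on each half, and the two halves are added.\<close>

lemma curve_length_const_speed:
  fixes \<gamma> :: "real \<Rightarrow> 'a::real_normed_vector"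
  assumes l: "0 \<le> l"
    and upper: "\<And>u v. u \<in> {0..1} \<Longrightarrow> v \<in> {0..1} \<Longrightarrow> norm (\<gamma> v - \<gamma> u) \<le> l * \<bar>v - u\<bar>"
    and lower: "\<And>\<epsilon>. 0 < \<epsilon> \<Longrightarrow> \<exists>\<delta>>0. \<forall>u v. 0 \<le> u \<longrightarrow> u \<le> v \<longrightarrow> v \<le> 1 \<longrightarrow> v - u < \<delta> \<longrightarrow>
       (v \<le> 1/2 \<or> 1/2 \<le> u) \<longrightarrow> (l - \<epsilon>) * (v - u) \<le> norm (\<gamma> v - \<gamma> u)"
    and t: "t \<in> {0..1}"
  shows "curve_length \<gamma> 0 t = ennreal (l * t)"
proof (rule antisym)
  have up: "curve_length \<gamma> 0 t \<le> ennreal (l * t)" if t: "t \<in> {0..1}" for t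
  proof (rule curve_length_least)
    fix d assume d: "d division_of {0..t}"
    have "(\<Sum>k\<in>d. ennreal (norm (\<gamma> (Sup k) - \<gamma> (Inf k)))) \<le> (\<Sum>k\<in>d. ennreal (l * measure lborel k))"
    proof (intro sum_mono ennreal_leI)
      fix k assume k: "k \<in> d"
      note ivl = division_real_interval[OF d k]
      have "measure lborel k = Sup k - Inf k" using ivl(1,2) by (metis content_real)
      with ivl t upper[of "Inf k" "Sup k"]
      show "norm (\<gamma> (Sup k) - \<gamma> (Inf k)) \<le> l * measure lborel k" by auto
    qed
    also have "\<dots> = ennreal (l * (\<Sum>k\<in>d. measure lborel k))"
      using l by (simp add: sum_distrib_left sum_ennreal)
    also have "(\<Sum>k\<in>d. measure lborel k) = t"
      using additive_content_division[of d 0 t] d t by simp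
    finally show "(\<Sum>k\<in>d. ennreal (norm (\<gamma> (Sup k) - \<gamma> (Inf k)))) \<le> ennreal (l * t)" .
  qed
  from up[OF t] show "curve_length \<gamma> 0 t \<le> ennreal (l * t)" .
  define s where "s = (\<lambda>t. enn2real (curve_length \<gamma> 0 t))"
  have fin: "curve_length \<gamma> 0 t = ennreal (s t)" if "t \<in> {0..1}" for t
    unfolding s_def using up[OF that] by (cases "curve_length \<gamma> 0 t") (auto simp: top_unique)
  have step: "norm (\<gamma> v - \<gamma> u) \<le> s v - s u" if "0 \<le> u" "u \<le> v" "v \<le> 1" for u v
    using that fin[of u] fin[of v]
    by (intro curve_length_eq_imp_norm_le) (auto simp: s_def)
  have "l * t \<le> s t + \<epsilon>" if \<epsilon>: "0 < \<epsilon>" for \<epsilon>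
  proof -
    obtain \<delta> where \<delta>: "\<delta> > 0" "\<And>u v. 0 \<le> u \<Longrightarrow> u \<le> v \<Longrightarrow> v \<le> 1 \<Longrightarrow> v - u < \<delta> \<Longrightarrow>
       v \<le> 1/2 \<or> 1/2 \<le> u \<Longrightarrow> (l - \<epsilon>) * (v - u) \<le> norm (\<gamma> v - \<gamma> u)"
      using lower[OF \<epsilon>] by blast
    have A: "(l - \<epsilon>) * (v - 0) \<le> s v - s 0" if "0 \<le> v" "v \<le> 1/2" for v
    proof (rule local_growth_imp_growth[OF \<delta>(1)])
      fix u w assume "0 \<le> u" "u \<le> w" "w \<le> v" "w - u < \<delta>"
      then show "(l - \<epsilon>) * (w - u) \<le> s w - s u"
        using \<delta>(2)[of u w] step[of u w] that by auto
    qed (use that in auto)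
    have B: "(l - \<epsilon>) * (v - 1/2) \<le> s v - s (1/2)" if "1/2 \<le> v" "v \<le> 1" for v
    proof (rule local_growth_imp_growth[OF \<delta>(1)])
      fix u w assume "1/2 \<le> u" "u \<le> w" "w \<le> v" "w - u < \<delta>"
      then show "(l - \<epsilon>) * (w - u) \<le> s w - s u"
        using \<delta>(2)[of u w] step[of u w] that by auto
    qed (use that in auto)
    have s0: "s 0 = 0" by (simp add: s_def)
    have "(l - \<epsilon>) * t \<le> s t"
    proof (cases "t \<le> 1/2")
      case False
      have "(l - \<epsilon>) * t = (l - \<epsilon>) * (t - 1/2) + (l - \<epsilon>) * (1/2 - 0)" by (simp add: algebra_simps)
      also have "\<dots> \<le> (s t - s (1/2)) + (s (1/2) - s 0)"
        using t False by (intro add_mono A B) auto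
      finally show ?thesis using s0 by simp
    qed (use A[of t] t s0 in auto)
    moreover have "\<epsilon> * t \<le> \<epsilon>" using t \<epsilon> by (simp add: mult_left_le)
    ultimately show ?thesis by (simp add: algebra_simps)
  qed
  then have "l * t \<le> s t" by (rule field_le_epsilon)
  then show "ennreal (l * t) \<le> curve_length \<gamma> 0 t" using fin[OF t] by (simp add: ennreal_leI)
qed

text \<open>At constant speed the parameter with arc length \<open>u\<close> is unique, namely
  \<open>u / l\<close>, so the choice in \<open>arc_length_param\<close> is determined.\<close>

lemma line_integral_const_speed:
  fixes \<gamma> :: "real \<Rightarrow> 'a::real_normed_vector"
  assumes l: "0 < l" and len: "\<And>t. t \<in> {0..1} \<Longrightarrow> curve_length \<gamma> 0 t = ennreal (l * t)"
  shows "rectifiable \<gamma>" "line_integral \<rho> \<gamma> = (\<integral>\<^sup>+u\<in>{0..l}. \<rho> (\<gamma> (u / l)) \<partial>lborel)"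
proof -
  show "rectifiable \<gamma>" using len[of 1] by (simp add: rectifiable_def)
  have "arc_length_param \<gamma> u = \<gamma> (u / l)" if u: "u \<in> {0..l}" for u
  proof -
    have "(SOME t. t \<in> {0..1} \<and> curve_length \<gamma> 0 t = ennreal u) = u / l"
    proof (rule some_equality)
      show "u / l \<in> {0..1} \<and> curve_length \<gamma> 0 (u / l) = ennreal u"
        using u l len[of "u / l"] by auto
      fix t assume t: "t \<in> {0..1} \<and> curve_length \<gamma> 0 t = ennreal u"
      then have "ennreal (l * t) = ennreal u" using len[of t] by auto
      then show "t = u / l" using t l u by (simp add: field_simps)
    qed
    then show ?thesis by (simp add: arc_length_param_def)
  qed
  moreover have "enn2real (curve_length \<gamma> 0 1) = l" using len[of 1] l by simp
  ultimately show "line_integral \<rho> \<gamma> = (\<integral>\<^sup>+u\<in>{0..l}. \<rho> (\<gamma> (u / l)) \<partial>lborel)"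
    unfolding line_integral_def by (intro nn_integral_cong) (auto simp: indicator_def)
qed

section \<open>Symmetries of Lebesgue measure\<close>

lemma borel_measurable_sgn_vector [measurable]:
  "(sgn :: 'a::euclidean_space \<Rightarrow> 'a) \<in> borel_measurable borel"
proof -
  have "(\<lambda>x::'a. x /\<^sub>R norm x) \<in> borel_measurable borel" by measurable
  then show ?thesis by (simp add: sgn_div_norm[abs_def])
qed

lemma nn_integral_lborel_scale:
  fixes f :: "'a::euclidean_space \<Rightarrow> ennreal"
  assumes [measurable]: "f \<in> borel_measurable borel" and c: "c \<noteq> 0"
  shows "(\<integral>\<^sup>+x. f x \<partial>lborel) = ennreal (\<bar>c\<bar> ^ DIM('a)) * (\<integral>\<^sup>+x. f (c *\<^sub>R x) \<partial>lborel)"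
  by (subst lborel_affine[OF c, of 0])
     (simp add: nn_integral_density nn_integral_distr nn_integral_cmult)

lemma nn_integral_lborel_translate:
  fixes f :: "'a::euclidean_space \<Rightarrow> ennreal"
  assumes [measurable]: "f \<in> borel_measurable borel"
  shows "(\<integral>\<^sup>+x. f (a + x) \<partial>lborel) = (\<integral>\<^sup>+x. f x \<partial>lborel)"
  by (subst (2) lborel_distr_plus[of a, symmetric]) (simp add: nn_integral_distr)

lemma nn_integral_real_translate:
  fixes f :: "real \<Rightarrow> ennreal"
  assumes "f \<in> borel_measurable borel"
  shows "(\<integral>\<^sup>+x. f (t + x) \<partial>lborel) = (\<integral>\<^sup>+x. f x \<partial>lborel)"
  using nn_integral_lborel_translate[OF assms] .

lemma nn_integral_real_reflect:
  fixes f :: "real \<Rightarrow> ennreal"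
  assumes "f \<in> borel_measurable borel"
  shows "(\<integral>\<^sup>+x. f (t - x) \<partial>lborel) = (\<integral>\<^sup>+x. f x \<partial>lborel)"
  using nn_integral_real_affine[OF assms, of "-1" t] by simp

text \<open>The averaging device behind the formulas for lines and for polar coordinates: a factor 1
  is written as the integral of a moving unit window, and Fubini with translation or dilation
  invariance transfers the window to the variable to be eliminated.\<close>

lemma nn_integral_unit_window:
  "(\<integral>\<^sup>+\<sigma>. indicator {0..<1::real} (x - \<sigma>) \<partial>lborel) = 1"
  "(\<integral>\<^sup>+\<sigma>. indicator {0..<1::real} (x + \<sigma>) \<partial>lborel) = 1"
  by (simp_all add: nn_integral_real_reflect nn_integral_real_translate)

subsection \<open>Integration over lines in a fixed direction\<close>

definition perp :: "'a::real_inner \<Rightarrow> 'a \<Rightarrow> 'a" where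
  "perp e w = w - (w \<bullet> e) *\<^sub>R e"

lemma perp_measurable [measurable]: "perp e \<in> borel_measurable (borel :: 'a::euclidean_space measure)"
  unfolding perp_def by measurable

text \<open>Lines parallel to \<open>e\<close> are indexed by the points of the slab
  \<open>0 \<le> w \<bullet> e < 1\<close>, which meets each of them in a segment of length one;
  this gives Fubini in an arbitrary direction.\<close>

lemma nn_integral_lines:
  fixes F :: "'a::euclidean_space \<Rightarrow> ennreal"
  assumes F[measurable]: "F \<in> borel_measurable borel" and e: "norm e = 1"
  shows "(\<integral>\<^sup>+p. F p \<partial>lborel) =
    (\<integral>\<^sup>+w. indicator {0..<1} (w \<bullet> e) * (\<integral>\<^sup>+\<sigma>. F (perp e w + \<sigma> *\<^sub>R e) \<partial>lborel) \<partial>lborel)"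
proof -
  have inner: "(\<integral>\<^sup>+\<sigma>. F (perp e w + \<sigma> *\<^sub>R e) \<partial>lborel) = (\<integral>\<^sup>+\<sigma>. F (w + \<sigma> *\<^sub>R e) \<partial>lborel)" for w
    using nn_integral_real_translate[of "\<lambda>\<sigma>. F (perp e w + \<sigma> *\<^sub>R e)" "w \<bullet> e"]
    by (simp add: perp_def algebra_simps)
  have ee: "e \<bullet> e = 1" using e by (simp add: norm_eq_1)
  have "(\<integral>\<^sup>+w. indicator {0..<1} (w \<bullet> e) * (\<integral>\<^sup>+\<sigma>. F (perp e w + \<sigma> *\<^sub>R e) \<partial>lborel) \<partial>lborel)
      = (\<integral>\<^sup>+w. (\<integral>\<^sup>+\<sigma>. indicator {0..<1} (w \<bullet> e) * F (w + \<sigma> *\<^sub>R e) \<partial>lborel) \<partial>lborel)"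
    unfolding inner by (simp add: nn_integral_cmult)
  also have "\<dots> = (\<integral>\<^sup>+\<sigma>. (\<integral>\<^sup>+w. indicator {0..<1} (w \<bullet> e) * F (w + \<sigma> *\<^sub>R e) \<partial>lborel) \<partial>lborel)"
    by (rule lborel_pair.Fubini') simp
  also have "\<dots> = (\<integral>\<^sup>+\<sigma>. (\<integral>\<^sup>+w. indicator {0..<1} (w \<bullet> e - \<sigma>) * F w \<partial>lborel) \<partial>lborel)"
  proof (rule nn_integral_cong)
    fix \<sigma> :: real
    show "(\<integral>\<^sup>+w. indicator {0..<1} (w \<bullet> e) * F (w + \<sigma> *\<^sub>R e) \<partial>lborel) =
        (\<integral>\<^sup>+w. indicator {0..<1} (w \<bullet> e - \<sigma>) * F w \<partial>lborel)"
      using nn_integral_lborel_translate[of "\<lambda>w. indicator {0..<1} (w \<bullet> e - \<sigma>) * F w" "\<sigma> *\<^sub>R e"] ee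
      by (simp add: algebra_simps inner_add_left)
  qed
  also have "\<dots> = (\<integral>\<^sup>+w. (\<integral>\<^sup>+\<sigma>. indicator {0..<1} (w \<bullet> e - \<sigma>) * F w \<partial>lborel) \<partial>lborel)"
    by (rule lborel_pair.Fubini') simp
  also have "\<dots> = (\<integral>\<^sup>+w. F w \<partial>lborel)"
    by (simp add: nn_integral_multc nn_integral_unit_window)
  finally show ?thesis ..
qed

subsection \<open>Integration over the sphere\<close>

text \<open>Integrals over the unit sphere are expressed by integrals over the shell between the radii
  1 and exp 1; the weight makes all shells of the same logarithmic thickness equivalent.\<close>

definition sphint :: "('a::euclidean_space \<Rightarrow> ennreal) \<Rightarrow> ennreal" where
  "sphint G = (\<integral>\<^sup>+q. ennreal (1 / norm q ^ DIM('a)) * (indicator {0..<1} (ln (norm q)) * G (sgn q)) \<partial>lborel)"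

text \<open>The weight turns Lebesgue measure into the dilation invariant measure, the product of
  \<open>d (ln (norm x))\<close> and surface measure.\<close>

lemma nn_integral_scale_invariant:
  fixes f :: "'a::euclidean_space \<Rightarrow> ennreal"
  assumes [measurable]: "f \<in> borel_measurable borel" and c: "c > 0"
  shows "(\<integral>\<^sup>+x. ennreal (1 / norm x ^ DIM('a)) * f x \<partial>lborel) =
    (\<integral>\<^sup>+x. ennreal (1 / norm x ^ DIM('a)) * f (c *\<^sub>R x) \<partial>lborel)"
proof -
  have "ennreal (c ^ DIM('a)) * (ennreal (1 / norm (c *\<^sub>R x) ^ DIM('a)) * f (c *\<^sub>R x)) =
      ennreal (1 / norm x ^ DIM('a)) * f (c *\<^sub>R x)" for x
    using c by (simp add: mult.assoc[symmetric] ennreal_mult[symmetric] power_mult_distrib)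
  then show ?thesis
    using c by (subst nn_integral_lborel_scale[of _ c]) (simp_all add: nn_integral_cmult[symmetric])
qed

lemma nn_integral_log_average:
  fixes K :: "real \<Rightarrow> 'a::euclidean_space \<Rightarrow> ennreal"
  assumes [measurable]: "(\<lambda>(\<sigma>, p). K \<sigma> p) \<in> borel_measurable (borel \<Otimes>\<^sub>M borel)"
  shows "(\<integral>\<^sup>+p. ennreal (1 / norm p ^ DIM('a)) * (\<integral>\<^sup>+\<sigma>. K \<sigma> p \<partial>lborel) \<partial>lborel) =
    (\<integral>\<^sup>+p. ennreal (1 / norm p ^ DIM('a)) * (\<integral>\<^sup>+\<sigma>. K \<sigma> (exp \<sigma> *\<^sub>R p) \<partial>lborel) \<partial>lborel)"
proof -
  have "(\<integral>\<^sup>+p. ennreal (1 / norm p ^ DIM('a)) * (\<integral>\<^sup>+\<sigma>. K \<sigma> p \<partial>lborel) \<partial>lborel) =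
    (\<integral>\<^sup>+p. (\<integral>\<^sup>+\<sigma>. ennreal (1 / norm p ^ DIM('a)) * K \<sigma> p \<partial>lborel) \<partial>lborel)"
    by (simp add: nn_integral_cmult)
  also have "\<dots> = (\<integral>\<^sup>+\<sigma>. (\<integral>\<^sup>+p. ennreal (1 / norm p ^ DIM('a)) * K \<sigma> p \<partial>lborel) \<partial>lborel)"
    by (rule lborel_pair.Fubini') simp
  also have "\<dots> = (\<integral>\<^sup>+\<sigma>. (\<integral>\<^sup>+p. ennreal (1 / norm p ^ DIM('a)) * K \<sigma> (exp \<sigma> *\<^sub>R p) \<partial>lborel) \<partial>lborel)"
    by (intro nn_integral_cong nn_integral_scale_invariant) auto
  also have "\<dots> = (\<integral>\<^sup>+p. (\<integral>\<^sup>+\<sigma>. ennreal (1 / norm p ^ DIM('a)) * K \<sigma> (exp \<sigma> *\<^sub>R p) \<partial>lborel) \<partial>lborel)"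
    by (rule lborel_pair.Fubini') simp
  also have "\<dots> = (\<integral>\<^sup>+p. ennreal (1 / norm p ^ DIM('a)) * (\<integral>\<^sup>+\<sigma>. K \<sigma> (exp \<sigma> *\<^sub>R p) \<partial>lborel) \<partial>lborel)"
    by (simp add: nn_integral_cmult)
  finally show ?thesis .
qed

lemma sgn_scaleR_exp: "sgn (exp \<sigma> *\<^sub>R p) = sgn (p :: 'a::real_normed_vector)"
  by (simp add: sgn_scaleR)

text \<open>A unit window in \<open>ln (norm p) - \<sigma>\<close> is inserted; dilation by
  \<open>exp \<sigma>\<close> moves it to the standard shell, and \<open>\<sigma>\<close> takes over
  as the logarithm of the radius.\<close>

lemma nn_integral_polar:
  fixes F :: "real \<Rightarrow> 'a::euclidean_space \<Rightarrow> ennreal"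
  assumes [measurable]: "(\<lambda>(\<xi>, q). F \<xi> q) \<in> borel_measurable (borel \<Otimes>\<^sub>M borel)"
  shows "(\<integral>\<^sup>+p. ennreal (1 / norm p ^ DIM('a)) * F (ln (norm p)) (sgn p) \<partial>lborel) =
    (\<integral>\<^sup>+\<xi>. sphint (F \<xi>) \<partial>lborel)"
proof -
  let ?w = "\<lambda>p::'a. ennreal (1 / norm p ^ DIM('a))"
  have "(\<integral>\<^sup>+p. ?w p * F (ln (norm p)) (sgn p) \<partial>lborel) =
    (\<integral>\<^sup>+p. ?w p * (\<integral>\<^sup>+\<sigma>. indicator {0..<1} (ln (norm p) - \<sigma>) * F (ln (norm p)) (sgn p) \<partial>lborel) \<partial>lborel)"
    by (simp add: nn_integral_multc nn_integral_unit_window)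
  also have "\<dots> = (\<integral>\<^sup>+p. ?w p * (\<integral>\<^sup>+\<sigma>. indicator {0..<1} (ln (norm (exp \<sigma> *\<^sub>R p)) - \<sigma>) *
      F (ln (norm (exp \<sigma> *\<^sub>R p))) (sgn (exp \<sigma> *\<^sub>R p)) \<partial>lborel) \<partial>lborel)"
    by (rule nn_integral_log_average) simp
  also have "\<dots> = (\<integral>\<^sup>+p. ?w p * (indicator {0..<1} (ln (norm p)) * (\<integral>\<^sup>+\<sigma>. F \<sigma> (sgn p) \<partial>lborel)) \<partial>lborel)"
  proof (rule nn_integral_cong)
    fix p :: 'a
    show "?w p * (\<integral>\<^sup>+\<sigma>. indicator {0..<1} (ln (norm (exp \<sigma> *\<^sub>R p)) - \<sigma>) *
      F (ln (norm (exp \<sigma> *\<^sub>R p))) (sgn (exp \<sigma> *\<^sub>R p)) \<partial>lborel) =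
      ?w p * (indicator {0..<1} (ln (norm p)) * (\<integral>\<^sup>+\<sigma>. F \<sigma> (sgn p) \<partial>lborel))"
    proof (cases "p = 0")
      case False
      then have "ln (norm (exp \<sigma> *\<^sub>R p)) = ln (norm p) + \<sigma>" for \<sigma> by (simp add: ln_mult)
      then show ?thesis
        using nn_integral_real_translate[of "\<lambda>\<sigma>. F \<sigma> (sgn p)" "ln (norm p)"]
        by (simp add: sgn_scaleR_exp nn_integral_cmult)
    qed (simp add: power_0_left)
  qed
  also have "\<dots> = (\<integral>\<^sup>+p. (\<integral>\<^sup>+\<sigma>. ?w p * (indicator {0..<1} (ln (norm p)) * F \<sigma> (sgn p)) \<partial>lborel) \<partial>lborel)"
    by (simp add: nn_integral_cmult mult.assoc[symmetric])
  also have "\<dots> = (\<integral>\<^sup>+\<sigma>. sphint (F \<sigma>) \<partial>lborel)"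
    unfolding sphint_def by (rule lborel_pair.Fubini') simp
  finally show ?thesis .
qed

text \<open>Averaging over dilations replaces the shell of the norm by that of any positively
  homogeneous function. With \<open>\<nu>\<close> the distance to an axis the shell becomes
  cylindrical, which suits integration over lines parallel to the axis.\<close>

lemma sphint_homogeneous_shell:
  fixes G :: "'a::euclidean_space \<Rightarrow> ennreal" and \<nu> :: "'a \<Rightarrow> real"
  assumes [measurable]: "G \<in> borel_measurable borel" "\<nu> \<in> borel_measurable borel"
    and hom: "\<And>c p. c > 0 \<Longrightarrow> \<nu> (c *\<^sub>R p) = c * \<nu> p" and pos: "AE p in lborel. \<nu> p > 0"
  shows "sphint G = (\<integral>\<^sup>+q. ennreal (1 / norm q ^ DIM('a)) *
      (indicator {0<..} (\<nu> q) * indicator {0..<1} (ln (\<nu> q)) * G (sgn q)) \<partial>lborel)"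
proof -
  let ?w = "\<lambda>p::'a. ennreal (1 / norm p ^ DIM('a))"
  have "(\<integral>\<^sup>+q. ?w q * (indicator {0<..} (\<nu> q) * indicator {0..<1} (ln (\<nu> q)) * G (sgn q)) \<partial>lborel) =
    (\<integral>\<^sup>+p. ?w p * (\<integral>\<^sup>+\<sigma>. indicator {0..<1} (ln (norm p) - \<sigma>) * (indicator {0<..} (\<nu> p) * indicator {0..<1} (ln (\<nu> p)) * G (sgn p)) \<partial>lborel) \<partial>lborel)"
    by (simp add: nn_integral_multc nn_integral_unit_window)
  also have "\<dots> = (\<integral>\<^sup>+p. ?w p * (\<integral>\<^sup>+\<sigma>. indicator {0..<1} (ln (norm (exp \<sigma> *\<^sub>R p)) - \<sigma>) *
      (indicator {0<..} (\<nu> (exp \<sigma> *\<^sub>R p)) * indicator {0..<1} (ln (\<nu> (exp \<sigma> *\<^sub>R p))) * G (sgn (exp \<sigma> *\<^sub>R p))) \<partial>lborel) \<partial>lborel)"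
    by (rule nn_integral_log_average) simp
  also have "\<dots> = sphint G"
    unfolding sphint_def
  proof (rule nn_integral_cong_AE, rule AE_mp[OF pos], rule AE_I2, rule impI)
    fix p :: 'a assume pos: "0 < \<nu> p"
    show "?w p * (\<integral>\<^sup>+\<sigma>. indicator {0..<1} (ln (norm (exp \<sigma> *\<^sub>R p)) - \<sigma>) *
      (indicator {0<..} (\<nu> (exp \<sigma> *\<^sub>R p)) * indicator {0..<1} (ln (\<nu> (exp \<sigma> *\<^sub>R p))) * G (sgn (exp \<sigma> *\<^sub>R p))) \<partial>lborel) =
      ?w p * (indicator {0..<1} (ln (norm p)) * G (sgn p))"
    proof (cases "p = 0")
      case False
      then have "ln (norm (exp \<sigma> *\<^sub>R p)) = ln (norm p) + \<sigma>" for \<sigma> by (simp add: ln_mult)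
      moreover have "ln (\<nu> (exp \<sigma> *\<^sub>R p)) = ln (\<nu> p) + \<sigma>" for \<sigma> using pos by (simp add: ln_mult hom)
      moreover have "(indicator {0<..} (\<nu> (exp \<sigma> *\<^sub>R p)) :: ennreal) = 1" for \<sigma> using pos by (simp add: hom)
      ultimately show ?thesis
        by (simp add: sgn_scaleR_exp nn_integral_cmult nn_integral_multc nn_integral_unit_window)
    qed (simp add: power_0_left)
  qed
  finally show ?thesis ..
qed

lemma AE_perp_nonzero:
  assumes "2 \<le> DIM('a::euclidean_space)"
  shows "AE p in lborel. perp e (p :: 'a) \<noteq> 0"
proof -
  have "dim (span {e}) \<le> 1" by (simp add: dim_le_card')
  then have "negligible (span {e})"
    using assms by (intro negligible_lowdim) auto
  then have "span {e} \<in> null_sets lebesgue" by (simp add: negligible_iff_null_sets)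
  then have "span {e} \<in> null_sets lborel"
    using null_sets_completion_iff[of "span {e}" lborel] by (simp add: borel_closed closed_span)
  moreover have "{p \<in> space lborel. \<not> perp e p \<noteq> 0} \<subseteq> span {e}"
    by (auto simp: perp_def span_singleton)
  ultimately show ?thesis by (rule AE_I')
qed

text \<open>The image of this density under \<open>sgn (perp e w)\<close> is the surface measure of
  the unit sphere orthogonal to \<open>e\<close>: the slab has thickness one, and
  \<open>dr / r\<close> has mass one between the radii 1 and \<open>exp 1\<close>.\<close>

definition perp_weight :: "'a::euclidean_space \<Rightarrow> 'a \<Rightarrow> ennreal" where
  "perp_weight e w = indicator {0..<1} (w \<bullet> e) * indicator {0<..} (norm (perp e w)) *
     indicator {0..<1} (ln (norm (perp e w))) * ennreal (1 / norm (perp e w) ^ (DIM('a) - 1))"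

lemma perp_weight_measurable [measurable]: "perp_weight e \<in> borel_measurable borel"
  unfolding perp_weight_def by measurable

lemma norm_perp_add_sq:
  assumes "norm e = 1"
  shows "norm (perp e w + \<sigma> *\<^sub>R e) ^ 2 = norm (perp e w) ^ 2 + \<sigma>\<^sup>2"
proof -
  have "e \<bullet> e = 1" using assms by (simp add: norm_eq_1)
  then have "perp e w \<bullet> e = 0" by (simp add: perp_def inner_diff_left)
  then show ?thesis using \<open>e \<bullet> e = 1\<close>
    by (simp add: power2_norm_eq_inner inner_add_left inner_add_right inner_commute power2_eq_square[of \<sigma>])
qed

text \<open>Great circles through \<open>e\<close>, parametrised by the cotangent \<open>s\<close> of the angle to \<open>e\<close>.\<close>

lemma sphint_great_circles:
  fixes G :: "'a::euclidean_space \<Rightarrow> ennreal"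
  assumes G[measurable]: "G \<in> borel_measurable borel" and e: "norm e = 1" and n: "2 \<le> DIM('a)"
  shows "sphint G = (\<integral>\<^sup>+w. perp_weight e w * (\<integral>\<^sup>+s. ennreal ((1 + s\<^sup>2) powr (- real DIM('a) / 2)) *
     G ((1 / sqrt (1 + s\<^sup>2)) *\<^sub>R (sgn (perp e w) + s *\<^sub>R e)) \<partial>lborel) \<partial>lborel)"
proof -
  let ?n = "DIM('a)"
  let ?H = "\<lambda>q::'a. ennreal (1 / norm q ^ ?n) *
      (indicator {0<..} (norm (perp e q)) * indicator {0..<1} (ln (norm (perp e q))) * G (sgn q))"
  have ee: "e \<bullet> e = 1" using e by (simp add: norm_eq_1)
  have "sphint G = (\<integral>\<^sup>+q. ?H q \<partial>lborel)"
  proof (rule sphint_homogeneous_shell)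
    show "AE p in lborel. 0 < norm (perp e p)" using AE_perp_nonzero[OF n, of e] by simp
    show "norm (perp e (c *\<^sub>R p)) = c * norm (perp e p)" if "c > 0" for c p
      using that by (simp add: perp_def scaleR_diff_right[symmetric] mult.commute del: scaleR_diff_right flip: scaleR_scaleR)
  qed auto
  also have "\<dots> = (\<integral>\<^sup>+w. indicator {0..<1} (w \<bullet> e) * (\<integral>\<^sup>+\<sigma>. ?H (perp e w + \<sigma> *\<^sub>R e) \<partial>lborel) \<partial>lborel)"
    by (rule nn_integral_lines[OF _ e]) simp
  also have "\<dots> = (\<integral>\<^sup>+w. perp_weight e w * (\<integral>\<^sup>+s. ennreal ((1 + s\<^sup>2) powr (- real ?n / 2)) *
     G ((1 / sqrt (1 + s\<^sup>2)) *\<^sub>R (sgn (perp e w) + s *\<^sub>R e)) \<partial>lborel) \<partial>lborel)"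
  proof (rule nn_integral_cong)
    fix w :: 'a
    let ?\<nu> = "norm (perp e w)"
    have perp_idem: "perp e (perp e w + \<sigma> *\<^sub>R e) = perp e w" for \<sigma>
      using ee by (simp add: perp_def inner_add_left inner_diff_left algebra_simps)
    show "indicator {0..<1} (w \<bullet> e) * (\<integral>\<^sup>+\<sigma>. ?H (perp e w + \<sigma> *\<^sub>R e) \<partial>lborel) =
      perp_weight e w * (\<integral>\<^sup>+s. ennreal ((1 + s\<^sup>2) powr (- real ?n / 2)) *
       G ((1 / sqrt (1 + s\<^sup>2)) *\<^sub>R (sgn (perp e w) + s *\<^sub>R e)) \<partial>lborel)"
    proof (cases "?\<nu> > 0")
      case True
      have pt: "norm (perp e w + (?\<nu> * s) *\<^sub>R e) = ?\<nu> * sqrt (1 + s\<^sup>2)" for s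
      proof -
        have "norm (perp e w + (?\<nu> * s) *\<^sub>R e) ^ 2 = (?\<nu> * sqrt (1 + s\<^sup>2))\<^sup>2"
          unfolding norm_perp_add_sq[OF e] by (simp add: power_mult_distrib algebra_simps)
        then show ?thesis by (rule power2_eq_imp_eq) auto
      qed
      have sg: "sgn (perp e w + (?\<nu> * s) *\<^sub>R e) = (1 / sqrt (1 + s\<^sup>2)) *\<^sub>R (sgn (perp e w) + s *\<^sub>R e)" for s
        unfolding sgn_div_norm pt using True by (simp add: scaleR_add_right field_simps)
      have wt: "1 / norm (perp e w + (?\<nu> * s) *\<^sub>R e) ^ ?n = (1 / ?\<nu> ^ ?n) * (1 + s\<^sup>2) powr (- real ?n / 2)" for s
      proof -
        have "sqrt (1 + s\<^sup>2) ^ ?n = (1 + s\<^sup>2) powr (real ?n / 2)"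
        proof -
          have "0 < 1 + s\<^sup>2" by (simp add: add_pos_nonneg)
          then show ?thesis by (simp add: powr_half_sqrt[symmetric] powr_power)
        qed
        then show ?thesis unfolding pt by (simp add: power_mult_distrib powr_minus divide_simps)
      qed
      have wt': "ennreal (1 / norm (perp e w + (?\<nu> * s) *\<^sub>R e) ^ ?n) =
          ennreal (1 / ?\<nu> ^ ?n) * ennreal ((1 + s\<^sup>2) powr (- real ?n / 2))" for s
        unfolding wt by (rule ennreal_mult) auto
      let ?g = "\<lambda>s. ennreal ((1 + s\<^sup>2) powr (- real ?n / 2)) *
       G ((1 / sqrt (1 + s\<^sup>2)) *\<^sub>R (sgn (perp e w) + s *\<^sub>R e))"
      \<comment> \<open>Substituting \<open>\<sigma> = ?\<nu> * s\<close> makes \<open>s\<close> the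
        cotangent of the angle to \<open>e\<close>; the factor \<open>?\<nu>\<close> it produces
        lowers the exponent in the weight to \<open>?n - 1\<close>.\<close>
      have "(\<integral>\<^sup>+\<sigma>. ?H (perp e w + \<sigma> *\<^sub>R e) \<partial>lborel) =
          ennreal ?\<nu> * (\<integral>\<^sup>+s. ?H (perp e w + (?\<nu> * s) *\<^sub>R e) \<partial>lborel)"
        using True nn_integral_real_affine[of "\<lambda>\<sigma>. ?H (perp e w + \<sigma> *\<^sub>R e)" ?\<nu> 0] by simp
      also have "\<dots> = ennreal ?\<nu> * (\<integral>\<^sup>+s. (ennreal (1 / ?\<nu> ^ ?n) * indicator {0..<1} (ln ?\<nu>)) * ?g s \<partial>lborel)"
        unfolding sg wt' perp_idem using True
        by (simp add: mult_ac)
      also have "\<dots> = ennreal ?\<nu> * (ennreal (1 / ?\<nu> ^ ?n) * indicator {0..<1} (ln ?\<nu>)) * (\<integral>\<^sup>+s. ?g s \<partial>lborel)"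
        by (subst nn_integral_cmult) (auto simp: mult_ac)
      also have "ennreal ?\<nu> * (ennreal (1 / ?\<nu> ^ ?n) * indicator {0..<1} (ln ?\<nu>)) =
          ennreal (1 / ?\<nu> ^ (?n - 1)) * indicator {0..<1} (ln ?\<nu>)"
      proof -
        have "?\<nu> * (1 / ?\<nu> ^ ?n) = 1 / ?\<nu> ^ (?n - 1)"
          using True n by (cases ?n) auto
        then show ?thesis using True by (simp add: mult.assoc[symmetric] ennreal_mult[symmetric])
      qed
      finally show ?thesis using True by (simp add: perp_weight_def mult_ac)
    next
      case False
      then show ?thesis unfolding perp_idem perp_weight_def by simp
    qed
  qed
  finally show ?thesis .
qed

lemma one_plus_square_neq_0 [simp]: "1 + s\<^sup>2 \<noteq> (0::real)"
  using zero_le_power2[of s] by linarith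

lemma one_plus_square_pos [simp]: "0 < 1 + (s::real)\<^sup>2"
  using zero_le_power2[of s] by linarith

lemma one_plus_square_not_neg [simp]: "\<not> 1 + (s::real)\<^sup>2 < 0"
  using zero_le_power2[of s] by linarith

lemma sphint_mono:
  fixes G H :: "'a::euclidean_space \<Rightarrow> ennreal"
  assumes "\<And>q. norm q = 1 \<Longrightarrow> G q \<le> H q"
  shows "sphint G \<le> sphint H"
  unfolding sphint_def
proof (rule nn_integral_mono)
  fix q :: 'a
  show "ennreal (1 / norm q ^ DIM('a)) * (indicator {0..<1} (ln (norm q)) * G (sgn q)) \<le>
    ennreal (1 / norm q ^ DIM('a)) * (indicator {0..<1} (ln (norm q)) * H (sgn q))"
    using assms[of "sgn q"] by (cases "q = 0") (auto simp: norm_sgn power_0_left intro!: mult_left_mono)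
qed

lemma sphint_add:
  fixes G H :: "'a::euclidean_space \<Rightarrow> ennreal"
  assumes [measurable]: "G \<in> borel_measurable borel" "H \<in> borel_measurable borel"
  shows "sphint (\<lambda>q. G q + H q) = sphint G + sphint H"
  unfolding sphint_def by (subst nn_integral_add[symmetric]) (auto simp: algebra_simps)

lemma sphint_cmult:
  fixes G :: "'a::euclidean_space \<Rightarrow> ennreal"
  assumes [measurable]: "G \<in> borel_measurable borel"
  shows "sphint (\<lambda>q. c * G q) = c * sphint G"
  unfolding sphint_def by (subst nn_integral_cmult[symmetric]) (auto simp: mult_ac)

lemma sphint_uminus:
  fixes G :: "'a::euclidean_space \<Rightarrow> ennreal"
  assumes [measurable]: "G \<in> borel_measurable borel"
  shows "sphint (\<lambda>q. G (- q)) = sphint G"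
  unfolding sphint_def
  by (subst (2) nn_integral_lborel_scale[of _ "-1"]) (auto simp: sgn_minus)

definition reflect :: "'a::real_inner \<Rightarrow> 'a \<Rightarrow> 'a" where
  "reflect \<nu> q = q - (2 * (q \<bullet> \<nu>)) *\<^sub>R \<nu>"

lemma reflect_measurable [measurable]: "reflect \<nu> \<in> borel_measurable (borel :: 'a::euclidean_space measure)"
  unfolding reflect_def by measurable

lemma norm_reflect:
  assumes "norm \<nu> = 1" shows "norm (reflect \<nu> q) = norm q"
proof -
  have "\<nu> \<bullet> \<nu> = 1" using assms by (simp add: norm_eq_1)
  then have "norm (reflect \<nu> q)^2 = norm q ^2"
    by (simp add: reflect_def power2_norm_eq_inner inner_diff_left inner_diff_right inner_commute algebra_simps)
  then show ?thesis by (rule power2_eq_imp_eq) auto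
qed

lemma reflect_scaleR: "reflect \<nu> (c *\<^sub>R q) = c *\<^sub>R reflect \<nu> q"
  by (simp add: reflect_def algebra_simps)

lemma reflect_inner: assumes "norm \<nu> = 1" shows "reflect \<nu> q \<bullet> \<nu> = - (q \<bullet> \<nu>)"
proof -
  have "\<nu> \<bullet> \<nu> = 1" using assms by (simp add: norm_eq_1)
  then show ?thesis by (simp add: reflect_def inner_diff_left)
qed

lemma nn_integral_reflect:
  fixes F :: "'a::euclidean_space \<Rightarrow> ennreal"
  assumes [measurable]: "F \<in> borel_measurable borel" and \<nu>: "norm \<nu> = 1"
  shows "(\<integral>\<^sup>+p. F (reflect \<nu> p) \<partial>lborel) = (\<integral>\<^sup>+p. F p \<partial>lborel)"
proof -
  have nn: "\<nu> \<bullet> \<nu> = 1" using \<nu> by (simp add: norm_eq_1)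
  have "reflect \<nu> (perp \<nu> w + \<sigma> *\<^sub>R \<nu>) = perp \<nu> w + (0 - \<sigma>) *\<^sub>R \<nu>" for w \<sigma>
    using nn by (simp add: reflect_def perp_def inner_add_left inner_diff_left algebra_simps flip: scaleR_2)
  then have "(\<integral>\<^sup>+\<sigma>. F (reflect \<nu> (perp \<nu> w + \<sigma> *\<^sub>R \<nu>)) \<partial>lborel) = (\<integral>\<^sup>+\<sigma>. F (perp \<nu> w + \<sigma> *\<^sub>R \<nu>) \<partial>lborel)" for w
    using nn_integral_real_reflect[of "\<lambda>\<sigma>. F (perp \<nu> w + \<sigma> *\<^sub>R \<nu>)" 0] by simp
  then show ?thesis
    by (subst (1 2) nn_integral_lines[OF _ \<nu>]) auto
qed

lemma sphint_reflect:
  fixes G :: "'a::euclidean_space \<Rightarrow> ennreal"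
  assumes [measurable]: "G \<in> borel_measurable borel" and \<nu>: "norm \<nu> = 1"
  shows "sphint (\<lambda>q. G (reflect \<nu> q)) = sphint G"
proof -
  have "sgn (reflect \<nu> q) = reflect \<nu> (sgn q)" for q
    by (simp add: sgn_div_norm norm_reflect[OF \<nu>] reflect_scaleR)
  then show ?thesis
    unfolding sphint_def
    using nn_integral_reflect[OF _ \<nu>, of "\<lambda>q. ennreal (1 / norm q ^ DIM('a)) * (indicator {0..<1} (ln (norm q)) * G (sgn q))"]
    by (simp add: norm_reflect[OF \<nu>])
qed

text \<open>For a function of the angle to \<open>e\<close> alone the inner integral is the same on
  all great circles through \<open>e\<close>, so the total mass of \<open>perp_weight\<close>
  factors out.\<close>

lemma sphint_axis:
  fixes e :: "'a::euclidean_space"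
  assumes [measurable]: "g \<in> borel_measurable borel" and e: "norm e = 1" and n: "2 \<le> DIM('a)"
  shows "sphint (\<lambda>q. g (q \<bullet> e)) = (\<integral>\<^sup>+w. perp_weight e w \<partial>lborel) *
    (\<integral>\<^sup>+s. ennreal ((1 + s\<^sup>2) powr (- real DIM('a) / 2)) * g (s / sqrt (1 + s\<^sup>2)) \<partial>lborel)"
proof -
  have ee: "e \<bullet> e = 1" using e by (simp add: norm_eq_1)
  have "sgn (perp e w) \<bullet> e = 0" for w
    using ee by (simp add: sgn_div_norm perp_def inner_diff_left)
  then have "(sgn (perp e w) + s *\<^sub>R e) \<bullet> e = s" for w s
    using ee by (simp add: inner_add_left)
  then show ?thesis
    by (subst sphint_great_circles[OF _ e n]) (simp_all add: nn_integral_multc)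
qed

lemma nn_integral_one_plus_square_finite:
  assumes a: "1/2 < a"
  shows "(\<integral>\<^sup>+s. ennreal ((1 + s\<^sup>2) powr (- a)) \<partial>lborel) < \<infinity>"
proof -
  let ?f = "\<lambda>s::real. ennreal ((1 + s\<^sup>2) powr (- a))"
  have "(\<integral>\<^sup>+s. ?f s * indicator {1..} s \<partial>lborel) \<le> (\<integral>\<^sup>+s. ennreal (s powr (- 2 * a)) * indicator {1..} s \<partial>lborel)"
  proof (rule nn_integral_mono)
    fix s :: real
    show "?f s * indicator {1..} s \<le> ennreal (s powr (- 2 * a)) * indicator {1..} s"
    proof (cases "1 \<le> s")
      case True
      have "(1 + s\<^sup>2) powr (-a) \<le> (s\<^sup>2) powr (-a)"
        using True a by (intro powr_mono2') auto
      also have "\<dots> = s powr (-2*a)" using True by (simp add: powr_powr flip: powr_numeral)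
      finally show ?thesis by (auto simp: indicator_def intro: ennreal_leI)
    qed auto
  qed
  also have "\<dots> = ennreal (0 - (-1 / (2*a - 1)) * 1 powr (1 - 2*a))"
  proof (rule nn_integral_FTC_atLeast[where F = "\<lambda>s. (-1 / (2*a - 1)) * s powr (1 - 2*a)"])
    show "DERIV (\<lambda>s. (-1 / (2*a - 1)) * s powr (1 - 2*a)) x :> x powr (- 2 * a)" if "1 \<le> x" for x
    proof (rule DERIV_cong[OF DERIV_cmult[OF has_real_derivative_powr]])
      show "0 < x" using that by simp
      have "-1 / (2*a - 1) * (1 - 2*a) = 1" using a by (simp add: field_simps)
      then show "-1 / (2*a - 1) * ((1 - 2*a) * x powr (1 - 2*a - 1)) = x powr (-2*a)"
        by (simp add: mult.assoc[symmetric])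
    qed
    have "((\<lambda>s. s powr (1 - 2*a)) \<longlongrightarrow> 0) at_top"
      using a by (intro tendsto_neg_powr filterlim_ident) auto
    then show "((\<lambda>s. (-1 / (2*a - 1)) * s powr (1 - 2*a)) \<longlongrightarrow> 0) at_top"
      using tendsto_mult_right_zero by blast
  qed auto
  finally have 1: "(\<integral>\<^sup>+s. ?f s * indicator {1..} s \<partial>lborel) < \<infinity>"
    by (auto intro: le_less_trans)
  have 2: "(\<integral>\<^sup>+s. ?f s * indicator {..-1} s \<partial>lborel) < \<infinity>"
    using 1 nn_integral_real_reflect[of "\<lambda>s. ?f s * indicator {1..} s" 0]
    by (simp add: indicator_def le_minus_iff)
  have "(\<integral>\<^sup>+s. ?f s * indicator {-1..1} s \<partial>lborel) \<le> (\<integral>\<^sup>+s. indicator {-1..1::real} s \<partial>lborel)"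
  proof (rule nn_integral_mono)
    fix s :: real
    have "(1 + s\<^sup>2) powr (-a) \<le> 1 powr (-a)" using a by (intro powr_mono2') auto
    then show "?f s * indicator {-1..1} s \<le> indicator {-1..1} s"
      by (auto simp: indicator_def)
  qed
  also have "\<dots> < \<infinity>" by simp
  finally have 3: "(\<integral>\<^sup>+s. ?f s * indicator {-1..1} s \<partial>lborel) < \<infinity>" .
  have "(\<integral>\<^sup>+s. ?f s \<partial>lborel) \<le> (\<integral>\<^sup>+s. ?f s * indicator {1..} s + (?f s * indicator {..-1} s + ?f s * indicator {-1..1} s) \<partial>lborel)"
    by (rule nn_integral_mono) (auto simp: indicator_def)
  also have "\<dots> = (\<integral>\<^sup>+s. ?f s * indicator {1..} s \<partial>lborel) + ((\<integral>\<^sup>+s. ?f s * indicator {..-1} s \<partial>lborel) + (\<integral>\<^sup>+s. ?f s * indicator {-1..1} s \<partial>lborel))"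
    by (subst nn_integral_add; simp)+
  finally show ?thesis using 1 2 3 by (auto intro: le_less_trans)
qed

lemma sphint_one_finite: "sphint (\<lambda>q::'a::euclidean_space. 1) < \<infinity>"
proof -
  have "sphint (\<lambda>q::'a. 1) \<le> (\<integral>\<^sup>+q. indicator (cball (0::'a) (exp 1)) q \<partial>lborel)"
    unfolding sphint_def
  proof (rule nn_integral_mono)
    fix q :: 'a
    show "ennreal (1 / norm q ^ DIM('a)) * (indicator {0..<1} (ln (norm q)) * 1) \<le> indicator (cball 0 (exp 1)) q"
    proof (cases "q \<noteq> 0 \<and> 0 \<le> ln (norm q) \<and> ln (norm q) < 1")
      case True
      then have "1 \<le> norm q" "norm q \<le> exp 1"
        by (auto simp: ln_ge_zero_iff) (metis exp_le_cancel_iff exp_ln less_imp_le zero_less_norm_iff)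
      moreover from this have "1 \<le> norm q ^ DIM('a)" by (intro one_le_power)
      ultimately show ?thesis by (auto simp: indicator_def divide_le_eq)
    qed (auto simp: indicator_def power_0_left)
  qed
  also have "\<dots> < \<infinity>" using emeasure_bounded_finite[of "cball (0::'a) (exp 1)"] by simp
  finally show ?thesis .
qed

lemma sphint_one_pos: "0 < sphint (\<lambda>q::'a::euclidean_space. 1)"
proof (rule ccontr)
  assume "\<not> ?thesis"
  then have 0: "sphint (\<lambda>q::'a. 1) = 0" by simp
  have "AE q::'a in lborel. ennreal (1 / norm q ^ DIM('a)) * (indicator {0..<1} (ln (norm q)) * 1) = 0"
    using 0 unfolding sphint_def by (subst (asm) nn_integral_0_iff_AE) auto
  then have "AE q::'a in lborel. q \<notin> ball 0 (exp 1) - cball 0 1"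
  proof (rule AE_mp, intro AE_I2 impI notI)
    fix q :: 'a
    assume *: "ennreal (1 / norm q ^ DIM('a)) * (indicator {0..<1} (ln (norm q)) * 1) = 0"
      and q: "q \<in> ball 0 (exp 1) - cball 0 1"
    then have "1 < norm q" "norm q < exp 1" by auto
    then have "0 \<le> ln (norm q)" "ln (norm q) < ln (exp 1)"
      by (simp, subst ln_less_cancel_iff) auto
    with * \<open>1 < norm q\<close> show False by (auto simp: indicator_def)
  qed
  then have "emeasure lborel (ball (0::'a) (exp 1) - cball 0 1) = 0"
    by (subst (asm) AE_iff_null_sets[symmetric]) auto
  moreover have "open (ball (0::'a) (exp 1) - cball 0 1)" by auto
  moreover have "ball (0::'a) (exp 1) - cball 0 1 \<noteq> {}"
  proof -
    obtain b :: 'a where b: "b \<in> Basis" using nonempty_Basis by blast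
    have "2 \<le> exp (1::real)" using exp_ge_add_one_self[of "1::real"] by simp
    then have "(3/2) *\<^sub>R b \<in> ball (0::'a) (exp 1) - cball 0 1" using b by auto
    then show ?thesis by blast
  qed
  ultimately show False
    using open_not_negligible[of "ball (0::'a) (exp 1) - cball 0 1"]
    by (auto simp: negligible_iff_null_sets null_sets_def)
qed

text \<open>Applied to the constant 1, \<open>sphint_axis\<close> expresses the total mass as the
  quotient of two positive finite numbers in which \<open>e\<close> does not occur.\<close>

lemma perp_weight_const:
  assumes n: "2 \<le> DIM('a::euclidean_space)"
  shows "\<exists>\<kappa>>0. \<forall>e::'a. norm e = 1 \<longrightarrow> (\<integral>\<^sup>+w. perp_weight e w \<partial>lborel) = ennreal \<kappa>"
proof -
  define J where "J = (\<integral>\<^sup>+s. ennreal ((1 + s\<^sup>2) powr (- real DIM('a) / 2)) \<partial>lborel)"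
  have "J < \<infinity>" unfolding J_def minus_divide_left[symmetric]
    using n by (intro nn_integral_one_plus_square_finite) auto
  have "J \<noteq> 0"
  proof
    assume "J = 0"
    then have "AE s in lborel. ennreal ((1 + s\<^sup>2) powr (- real DIM('a) / 2)) = 0"
      unfolding J_def by (subst (asm) nn_integral_0_iff_AE) auto
    moreover have "ennreal ((1 + s\<^sup>2) powr (- real DIM('a) / 2)) \<noteq> 0" for s :: real
      by (auto simp: ennreal_eq_0_iff not_le add_pos_nonneg intro!: powr_gt_zero[THEN iffD2])
    ultimately have "AE s in lborel. s \<notin> (UNIV :: real set)" by simp
    then have "(UNIV :: real set) \<in> null_sets lborel" by (subst (asm) AE_iff_null_sets[symmetric]) auto
    then show False by (simp add: null_sets_def)
  qed
  with \<open>J < \<infinity>\<close> obtain j where j: "J = ennreal j" "j > 0" by (cases J) auto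
  obtain t where t: "sphint (\<lambda>q::'a. 1) = ennreal t" "t > 0"
    using sphint_one_finite[where 'a='a] sphint_one_pos[where 'a='a] by (cases "sphint (\<lambda>q::'a. 1)") auto
  have "(\<integral>\<^sup>+w. perp_weight e w \<partial>lborel) = ennreal (t / j)" if e: "norm e = 1" for e :: 'a
  proof -
    have eq: "ennreal t = (\<integral>\<^sup>+w. perp_weight e w \<partial>lborel) * ennreal j"
      using sphint_axis[OF _ e n, of "\<lambda>_. 1"] unfolding j(1)[symmetric] J_def t(1)[symmetric] by simp
    then obtain k where k: "(\<integral>\<^sup>+w. perp_weight e w \<partial>lborel) = ennreal k" "0 \<le> k"
      using j by (cases "\<integral>\<^sup>+w. perp_weight e w \<partial>lborel") (auto simp: ennreal_top_mult)
    with eq j t show ?thesis by (simp add: ennreal_mult[symmetric] field_simps)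
  qed
  then show ?thesis using t j by (intro exI[of _ "t / j"]) auto
qed

section \<open>Change of variable between cotangent and cosine\<close>

text \<open>Exhaustion of the line by compact intervals; the range of \<open>g\<close> appears as
  the union of their images, since nothing is assumed about its limits.\<close>

lemma nn_integral_substitution_UNIV:
  fixes f :: "real \<Rightarrow> ennreal"
  assumes f[measurable]: "f \<in> borel_measurable borel"
    and deriv: "\<And>x. (g has_real_derivative g' x) (at x)"
    and cont: "continuous_on UNIV g'" and nonneg: "\<And>x. 0 \<le> g' x"
  shows "(\<integral>\<^sup>+x. f (g x) * ennreal (g' x) \<partial>lborel) =
    (\<integral>\<^sup>+y. f y * indicator (\<Union>N. {g (- real (Suc N))..g (real (Suc N))}) y \<partial>lborel)"
proof -
  have gc: "continuous_on UNIV g" using deriv by (meson DERIV_isCont continuous_at_imp_continuous_on)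
  have [measurable]: "g \<in> borel_measurable borel" "g' \<in> borel_measurable borel"
    using gc cont by (auto intro: borel_measurable_continuous_onI)
  have mono: "g x \<le> g y" if "x \<le> y" for x y
    using DERIV_nonneg_imp_nondecreasing[OF that] deriv nonneg by blast
  let ?A = "\<lambda>N. {- real (Suc N)..real (Suc N)}"
  let ?B = "\<lambda>N. {g (- real (Suc N))..g (real (Suc N))}"
  let ?M = "density lborel (\<lambda>x. f (g x) * ennreal (g' x))"
  let ?K = "density lborel f"
  have "emeasure ?M (?A N) = emeasure ?K (?B N)" for N
    using nn_integral_substitution_aux[of f "- real (Suc N)" "real (Suc N)" g g'] deriv nonneg
      continuous_on_subset[OF cont]
    by (simp add: emeasure_density)
  moreover have "(SUP N. emeasure ?M (?A N)) = emeasure ?M (\<Union>N. ?A N)"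
    by (rule SUP_emeasure_incseq) (auto simp: incseq_def)
  moreover have "(SUP N. emeasure ?K (?B N)) = emeasure ?K (\<Union>N. ?B N)"
  proof (rule SUP_emeasure_incseq)
    show "incseq ?B" unfolding incseq_def
    proof (intro allI impI)
      fix m n :: nat assume "m \<le> n"
      then show "?B m \<le> ?B n" using mono[of "- real (Suc n)" "- real (Suc m)"] mono[of "real (Suc m)" "real (Suc n)"] by auto
    qed
  qed auto
  moreover have "(\<Union>N. ?A N) = UNIV"
  proof -
    have "\<exists>N. x \<in> ?A N" for x :: real
    proof -
      obtain N :: nat where "\<bar>x\<bar> \<le> real N" using real_arch_simple by blast
      then show ?thesis by (intro exI[of _ N]) (auto simp: abs_le_iff)
    qed
    then show ?thesis by blast
  qed
  ultimately show ?thesis by (simp add: emeasure_density)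
qed

lemma has_derivative_cot_to_cos:
  "((\<lambda>s::real. s / sqrt (1 + s\<^sup>2)) has_real_derivative (1 + s\<^sup>2) powr (- 3/2)) (at s)"
proof -
  have pos: "0 < 1 + s\<^sup>2" by (simp add: add_pos_nonneg)
  have "((\<lambda>s::real. s / sqrt (1 + s\<^sup>2)) has_real_derivative
      (sqrt (1 + s\<^sup>2) - s * (s / sqrt (1 + s\<^sup>2))) / (1 + s\<^sup>2)) (at s)"
    using pos by (auto intro!: derivative_eq_intros simp: field_simps)
  moreover have "(sqrt (1 + s\<^sup>2) - s * (s / sqrt (1 + s\<^sup>2))) / (1 + s\<^sup>2) = (1 + s\<^sup>2) powr (- 3/2)"
  proof -
    have "sqrt (1 + s\<^sup>2) - s * (s / sqrt (1 + s\<^sup>2)) = 1 / sqrt (1 + s\<^sup>2)"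
      using pos by (simp add: field_simps power2_eq_square[symmetric])
    moreover have "(1 + s\<^sup>2) powr (- 3/2) = (1 + s\<^sup>2) powr (-1) * (1 + s\<^sup>2) powr (-1/2)"
      using powr_add[of "1 + s\<^sup>2" "-1" "-1/2"] by simp
    moreover have "\<dots> = (1 / (1 + s\<^sup>2)) * (1 / sqrt (1 + s\<^sup>2))"
    proof -
      have "y powr (-1) = 1 / y" "y powr (-1/2) = 1 / sqrt y" if "0 < y" for y :: real
        using that powr_minus_divide[of y 1] powr_minus_divide[of y "1/2"] powr_half_sqrt[of y] by auto
      then show ?thesis using pos by metis
    qed
    ultimately show ?thesis by simp
  qed
  ultimately show ?thesis by simp
qed

lemma one_minus_cos_sq: "1 - (s / sqrt (1 + s\<^sup>2))\<^sup>2 = 1 / (1 + s\<^sup>2)" for s :: real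
  by (simp add: power_divide add_pos_nonneg field_simps add_nonneg_eq_0_iff)

lemma Union_cot_to_cos:
  "(\<Union>N. {- real (Suc N) / sqrt (1 + (- real (Suc N))\<^sup>2)..real (Suc N) / sqrt (1 + (real (Suc N))\<^sup>2)}) = {-1<..<1}"
  (is "(\<Union>N. ?B N) = _")
proof -
  have lt: "real (Suc N) / sqrt (1 + (real (Suc N))\<^sup>2) < 1" for N
    by (simp add: real_less_rsqrt add_pos_nonneg)
  have "- real (Suc N) / sqrt (1 + (- real (Suc N))\<^sup>2) = - (real (Suc N) / sqrt (1 + (real (Suc N))\<^sup>2))" for N
    by (simp only: power2_minus minus_divide_left)
  then have "?B N \<subseteq> {-1<..<1}" for N using lt[of N] by (auto simp only: atLeastAtMost_iff greaterThanLessThan_iff)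
  moreover have "\<exists>N. y \<in> ?B N" if y: "y \<in> {-1<..<1}" for y
  proof -
    have mono: "s / sqrt (1 + s\<^sup>2) \<le> t / sqrt (1 + t\<^sup>2)" if "s \<le> t" for s t :: real
      using DERIV_nonneg_imp_nondecreasing[OF that, of "\<lambda>s. s / sqrt (1 + s\<^sup>2)"] has_derivative_cot_to_cos
      by (metis powr_ge_zero)
    have y2: "0 < 1 - y\<^sup>2" using y by (simp add: abs_square_less_1 abs_less_iff)
    define s where "s = y / sqrt (1 - y\<^sup>2)"
    have "1 + s\<^sup>2 = 1 / (1 - y\<^sup>2)" using y2 by (simp add: s_def power_divide field_simps)
    then have sy: "s / sqrt (1 + s\<^sup>2) = y" using y2 by (simp add: s_def real_sqrt_divide)
    obtain N :: nat where "\<bar>s\<bar> \<le> real N" using real_arch_simple by blast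
    then have "- real (Suc N) \<le> s" "s \<le> real (Suc N)" by (auto simp: abs_le_iff)
    then show ?thesis using mono[of "- real (Suc N)" s] mono[of s "real (Suc N)"] unfolding sy by (intro exI[of _ N]) auto
  qed
  ultimately show ?thesis by blast
qed

text \<open>For \<open>p = pe n\<close> the exponent \<open>p - 3/2\<close> is
  \<open>- n / (2 * (n - 1))\<close>. So the normalising constant of the spheroidal potential equals
  the constant \<open>I\<close> of the spherical cap inequality, which gives both bounds the same
  leading coefficient.\<close>

lemma nn_integral_cos_eq_cot:
  "(\<integral>\<^sup>+y. ennreal ((1 - y\<^sup>2) powr (- p)) * indicator {-1<..<1} y \<partial>lborel) =
   (\<integral>\<^sup>+s. ennreal ((1 + s\<^sup>2) powr (p - 3/2)) \<partial>lborel)"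
proof -
  have "(\<integral>\<^sup>+s. ennreal ((1 - (s / sqrt (1 + s\<^sup>2))\<^sup>2) powr (- p)) * ennreal ((1 + s\<^sup>2) powr (- 3/2)) \<partial>lborel) =
    (\<integral>\<^sup>+y. ennreal ((1 - y\<^sup>2) powr (- p)) * indicator {-1<..<1} y \<partial>lborel)"
    by (subst nn_integral_substitution_UNIV[OF _ has_derivative_cot_to_cos])
       (auto intro!: continuous_intros simp: Union_cot_to_cos[simplified] add_nonneg_eq_0_iff)
  moreover have "ennreal ((1 - (s / sqrt (1 + s\<^sup>2))\<^sup>2) powr (- p)) * ennreal ((1 + s\<^sup>2) powr (- 3/2)) =
     ennreal ((1 + s\<^sup>2) powr (p - 3/2))" for s :: real
  proof -
    have "(1 / (1 + s\<^sup>2)) powr (- p) = (1 + s\<^sup>2) powr p"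
      by (simp add: powr_divide powr_minus_divide add_nonneg_nonneg)
    then show ?thesis unfolding one_minus_cos_sq
      by (simp add: ennreal_mult[symmetric] powr_add[symmetric])
  qed
  ultimately show ?thesis by simp
qed

section \<open>Great circle arcs bent at a mirror\<close>

definition great_circle :: "'a::real_inner \<Rightarrow> 'a \<Rightarrow> real \<Rightarrow> 'a" where
  "great_circle a v x = cos x *\<^sub>R a + sin x *\<^sub>R v"

lemma great_circle_chord:
  assumes "norm a = 1" "norm v = 1" "a \<bullet> v = 0"
  shows "norm (great_circle a v x - great_circle a v y) = 2 * \<bar>sin ((x - y) / 2)\<bar>"
proof -
  have o: "a \<bullet> a = 1" "v \<bullet> v = 1" "v \<bullet> a = 0" using assms by (auto simp: norm_eq_1 inner_commute)
  have "norm (great_circle a v x - great_circle a v y)^2 =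
     (cos x - cos y)\<^sup>2 + (sin x - sin y)\<^sup>2"
    unfolding power2_norm_eq_inner great_circle_def using o assms(3)
    by (simp add: inner_diff_left inner_diff_right
        inner_add_left inner_add_right power2_eq_square algebra_simps)
  also have "\<dots> = 2 - 2 * cos (x - y)"
    using sin_cos_squared_add[of x] sin_cos_squared_add[of y]
    by (simp add: cos_diff power2_eq_square algebra_simps)
  also have "\<dots> = (2 * \<bar>sin ((x - y) / 2)\<bar>)\<^sup>2"
  proof -
    have "2 * ((x - y) / 2) = x - y" by simp
    then have "cos (x - y) = 1 - 2 * (sin ((x - y) / 2))\<^sup>2"
      using cos_double_sin[of "(x - y) / 2"] by metis
    then show ?thesis by (simp add: power_mult_distrib)
  qed
  finally show ?thesis by (rule power2_eq_imp_eq) auto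
qed

lemma norm_great_circle:
  assumes "norm a = 1" "norm v = 1" "a \<bullet> v = 0"
  shows "norm (great_circle a v x) = 1"
proof -
  have o: "a \<bullet> a = 1" "v \<bullet> v = 1" "v \<bullet> a = 0" using assms by (auto simp: norm_eq_1 inner_commute)
  have "norm (great_circle a v x)^2 = (cos x)\<^sup>2 + (sin x)\<^sup>2"
    unfolding power2_norm_eq_inner great_circle_def using o assms(3)
    by (simp add: inner_add_left inner_add_right power2_eq_square algebra_simps)
  then show ?thesis using abs_square_eq_1[of "norm (great_circle a v x)"] by (simp add: add.commute)
qed

lemma sin_ge_near_0:
  assumes "0 < \<epsilon>"
  obtains \<delta> where "\<delta> > 0" "\<And>z. 0 \<le> z \<Longrightarrow> z < \<delta> \<Longrightarrow> (1 - \<epsilon>) * z \<le> sin (z::real)"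
proof -
  have "((\<lambda>h. (sin (0 + h) - sin 0) / h) \<longlongrightarrow> cos (0::real)) (at 0)"
    using DERIV_sin[of "0::real"] by (simp only: DERIV_def)
  then have "\<forall>\<^sub>F h in at (0::real). dist (sin h / h) 1 < \<epsilon>"
    using assms by (simp add: tendsto_iff)
  then obtain \<delta> where \<delta>: "\<delta> > 0" "\<forall>h\<in>(UNIV::real set). h \<noteq> 0 \<and> dist h 0 < \<delta> \<longrightarrow> dist (sin h / h) 1 < \<epsilon>"
    unfolding eventually_at by blast
  have "(1 - \<epsilon>) * z \<le> sin z" if "0 \<le> z" "z < \<delta>" for z
  proof (cases "z = 0")
    case False
    then have "1 - \<epsilon> < sin z / z" using bspec[OF \<delta>(2) UNIV_I, of z] that by (auto simp: dist_real_def abs_less_iff)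
    then show ?thesis using False that by (simp add: field_simps)
  qed auto
  with \<delta>(1) show thesis by (rule that)
qed

text \<open>\<open>l\<close> is meant to be the angle at which the great circle meets the mirror
  orthogonal to \<open>\<nu>\<close>; the halves then fit together, and the mirror image, run
  backwards, ends at the mirror image of \<open>a\<close>.\<close>

definition bent_arc :: "'a::real_inner \<Rightarrow> real \<Rightarrow> 'a \<Rightarrow> 'a \<Rightarrow> 'a \<Rightarrow> real \<Rightarrow> real \<Rightarrow> 'a" where
  "bent_arc m t \<nu> a v l u = m + t *\<^sub>R (if u \<le> 1/2 then great_circle a v (2 * l * u)
      else reflect \<nu> (great_circle a v (2 * l * (1 - u))))"

lemma reflect_diff: "reflect \<nu> (p - q) = reflect \<nu> p - reflect \<nu> q"
  by (simp add: reflect_def inner_diff_left algebra_simps)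

text \<open>The sine formula for chords applies within each half, and the reflection is an isometry,
  so both halves have the speed \<open>2 * l * t\<close>. Across the corner only the upper estimate
  occurs, through the midpoint.\<close>

lemma bent_arc_curve_length:
  fixes a v \<nu> m :: "'a::real_inner"
  assumes o: "norm a = 1" "norm v = 1" "a \<bullet> v = 0" and \<nu>: "norm \<nu> = 1"
    and t: "0 < t" and l: "0 < l" and eq: "great_circle a v l \<bullet> \<nu> = 0" and u: "u \<in> {0..1}"
  shows "curve_length (bent_arc m t \<nu> a v l) 0 u = ennreal (2 * l * t * u)"
proof (rule curve_length_const_speed[OF _ _ _ u])
  let ?\<gamma> = "bent_arc m t \<nu> a v l"
  have fixl: "reflect \<nu> (great_circle a v l) = great_circle a v l"
    using eq by (simp add: reflect_def)
  have left: "norm (?\<gamma> y - ?\<gamma> x) = t * (2 * \<bar>sin (l * (y - x))\<bar>)" if "x \<le> 1/2" "y \<le> 1/2" for x y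
  proof -
    have "?\<gamma> y - ?\<gamma> x = t *\<^sub>R (great_circle a v (2 * l * y) - great_circle a v (2 * l * x))"
      using that by (simp add: bent_arc_def algebra_simps)
    then have "norm (?\<gamma> y - ?\<gamma> x) = t * (2 * \<bar>sin ((2 * l * y - 2 * l * x) / 2)\<bar>)"
      using t by (simp only: norm_scaleR great_circle_chord[OF o] abs_of_pos)
    also have "(2 * l * y - 2 * l * x) / 2 = l * (y - x)" by (simp add: field_simps)
    finally show ?thesis .
  qed
  have right_eq: "?\<gamma> x = m + t *\<^sub>R reflect \<nu> (great_circle a v (2 * l * (1 - x)))" if "1/2 \<le> x" for x
  proof (cases "x = 1/2")
    case True
    show ?thesis unfolding True using fixl by (simp add: bent_arc_def)
  qed (use that in \<open>auto simp: bent_arc_def\<close>)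
  have right: "norm (?\<gamma> y - ?\<gamma> x) = t * (2 * \<bar>sin (l * (y - x))\<bar>)" if "1/2 \<le> x" "1/2 \<le> y" for x y
  proof -
    have "?\<gamma> y - ?\<gamma> x = t *\<^sub>R reflect \<nu> (great_circle a v (2 * l * (1 - y)) - great_circle a v (2 * l * (1 - x)))"
      unfolding right_eq[OF that(1)] right_eq[OF that(2)] by (simp add: reflect_diff algebra_simps)
    then have "norm (?\<gamma> y - ?\<gamma> x) = t * (2 * \<bar>sin ((2 * l * (1 - y) - 2 * l * (1 - x)) / 2)\<bar>)"
      using t by (simp only: norm_scaleR norm_reflect[OF \<nu>] great_circle_chord[OF o] abs_of_pos)
    also have "(2 * l * (1 - y) - 2 * l * (1 - x)) / 2 = - (l * (y - x))" by (simp add: field_simps)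
    finally show ?thesis by simp
  qed
  have sin_le: "t * (2 * \<bar>sin (l * (y - x))\<bar>) \<le> 2 * l * t * \<bar>y - x\<bar>" for x y
    using abs_sin_x_le_abs_x[of "l * (y - x)"] t l by (simp add: abs_mult mult.commute mult.left_commute)
  show "0 \<le> 2 * l * t" using l t by simp
  show "norm (?\<gamma> y - ?\<gamma> x) \<le> 2 * l * t * \<bar>y - x\<bar>" if "x \<in> {0..1}" "y \<in> {0..1}" for x y
  proof -
    have cross: "norm (?\<gamma> y - ?\<gamma> x) \<le> 2 * l * t * (y - x)" if "x \<le> 1/2" "1/2 \<le> y" for x y
    proof -
      have "norm (?\<gamma> y - ?\<gamma> x) \<le> norm (?\<gamma> y - ?\<gamma> (1/2)) + norm (?\<gamma> (1/2) - ?\<gamma> x)"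
        using norm_triangle_ineq[of "?\<gamma> y - ?\<gamma> (1/2)" "?\<gamma> (1/2) - ?\<gamma> x"] by simp
      also have "\<dots> \<le> 2 * l * t * \<bar>y - 1/2\<bar> + 2 * l * t * \<bar>1/2 - x\<bar>"
        using left[OF that(1) order_refl] right[OF order_refl that(2)] sin_le by (intro add_mono) metis+
      also have "\<dots> = 2 * l * t * (y - x)" using that by (simp add: algebra_simps)
      finally show ?thesis .
    qed
    consider "x \<le> 1/2" "y \<le> 1/2" | "1/2 \<le> x" "1/2 \<le> y" | "x \<le> 1/2" "1/2 \<le> y" | "y \<le> 1/2" "1/2 \<le> x" by linarith
    then show ?thesis
    proof cases
      case 1 then show ?thesis using left sin_le by simp
    next
      case 2 then show ?thesis using right sin_le by simp
    next
      case 3 then show ?thesis using cross[of x y] by simp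
    next
      case 4 then show ?thesis using cross[of y x] by (simp add: norm_minus_commute abs_minus_commute)
    qed
  qed
  show "\<exists>\<delta>>0. \<forall>x y. 0 \<le> x \<longrightarrow> x \<le> y \<longrightarrow> y \<le> 1 \<longrightarrow> y - x < \<delta> \<longrightarrow> (y \<le> 1/2 \<or> 1/2 \<le> x) \<longrightarrow>
      (2 * l * t - \<epsilon>) * (y - x) \<le> norm (?\<gamma> y - ?\<gamma> x)" if "0 < \<epsilon>" for \<epsilon>
  proof -
    obtain \<delta> where \<delta>: "\<delta> > 0" "\<And>z. 0 \<le> z \<Longrightarrow> z < \<delta> \<Longrightarrow> (1 - \<epsilon> / (2 * l * t)) * z \<le> sin z"
      using sin_ge_near_0[of "\<epsilon> / (2 * l * t)"] \<open>0 < \<epsilon>\<close> l t by auto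
    have "(2 * l * t - \<epsilon>) * (y - x) \<le> norm (?\<gamma> y - ?\<gamma> x)"
      if "0 \<le> x" "x \<le> y" "y \<le> 1" "y - x < \<delta> / l" "y \<le> 1/2 \<or> 1/2 \<le> x" for x y
    proof -
      have "(1 - \<epsilon> / (2 * l * t)) * (l * (y - x)) \<le> sin (l * (y - x))"
        using that l by (intro \<delta>(2)) (auto simp: field_simps)
      also have "\<dots> \<le> \<bar>sin (l * (y - x))\<bar>" by simp
      finally have "(2 * t) * ((1 - \<epsilon> / (2 * l * t)) * (l * (y - x))) \<le> (2 * t) * \<bar>sin (l * (y - x))\<bar>"
        using t by (intro mult_left_mono) auto
      moreover have "(2 * t) * ((1 - \<epsilon> / (2 * l * t)) * (l * (y - x))) = (2 * l * t - \<epsilon>) * (y - x)"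
        using l t by (simp add: field_simps)
      moreover have "norm (?\<gamma> y - ?\<gamma> x) = (2 * t) * \<bar>sin (l * (y - x))\<bar>"
        using left[of x y] right[of x y] that by auto
      ultimately show ?thesis by simp
    qed
    then show ?thesis using \<delta>(1) l by (intro exI[of _ "\<delta> / l"]) auto
  qed
qed

lemma bent_arc_line_integral:
  fixes a v \<nu> m :: "'a::euclidean_space"
  assumes o: "norm a = 1" "norm v = 1" "a \<bullet> v = 0" and \<nu>: "norm \<nu> = 1"
    and t: "0 < t" and l: "0 < l" and eq: "great_circle a v l \<bullet> \<nu> = 0"
    and \<rho>[measurable]: "\<rho> \<in> borel_measurable borel"
  shows "rectifiable (bent_arc m t \<nu> a v l)"
    "line_integral \<rho> (bent_arc m t \<nu> a v l) = ennreal t *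
      (\<integral>\<^sup>+x\<in>{0..l}. \<rho> (m + t *\<^sub>R great_circle a v x) + \<rho> (m + t *\<^sub>R reflect \<nu> (great_circle a v x)) \<partial>lborel)"
proof -
  let ?\<gamma> = "bent_arc m t \<nu> a v l"
  have lt: "0 < 2 * l * t" using l t by simp
  have len: "curve_length ?\<gamma> 0 u = ennreal (2 * l * t * u)" if "u \<in> {0..1}" for u
    by (rule bent_arc_curve_length[OF o \<nu> t l eq that])
  show "rectifiable ?\<gamma>" by (rule line_integral_const_speed(1)[OF lt len])
  have [measurable]: "great_circle a v \<in> borel_measurable borel"
    unfolding great_circle_def by measurable
  let ?f = "\<lambda>x. \<rho> (m + t *\<^sub>R great_circle a v x)"
  let ?g = "\<lambda>x. \<rho> (m + t *\<^sub>R reflect \<nu> (great_circle a v x))"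
  have [measurable]: "?\<gamma> \<in> borel_measurable borel"
    unfolding bent_arc_def by measurable
  have "line_integral \<rho> ?\<gamma> = (\<integral>\<^sup>+u. \<rho> (?\<gamma> (u / (2 * l * t))) * indicator {0..2 * l * t} u \<partial>lborel)"
    by (rule line_integral_const_speed(2)[OF lt len])
  also have "\<dots> = ennreal t * (\<integral>\<^sup>+x. \<rho> (?\<gamma> (x / (2 * l))) * indicator {0..2 * l} x \<partial>lborel)"
    using t nn_integral_real_affine[of "\<lambda>u. \<rho> (?\<gamma> (u / (2 * l * t))) * indicator {0..2 * l * t} u" t 0]
    by (simp add: indicator_def zero_le_mult_iff mult.commute)
  also have "(\<integral>\<^sup>+x. \<rho> (?\<gamma> (x / (2 * l))) * indicator {0..2 * l} x \<partial>lborel) =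
    (\<integral>\<^sup>+x. ?f x * indicator {0..l} x + ?g (2 * l - x) * indicator {l<..2*l} x \<partial>lborel)"
  proof (rule nn_integral_cong)
    fix x
    have "2 * l * (x / (2 * l)) = x" "2 * l * (1 - x / (2 * l)) = 2 * l - x" "x / (2 * l) \<le> 1/2 \<longleftrightarrow> x \<le> l"
      using l by (auto simp: field_simps)
    then show "\<rho> (?\<gamma> (x / (2 * l))) * indicator {0..2 * l} x = ?f x * indicator {0..l} x + ?g (2 * l - x) * indicator {l<..2*l} x"
      using l by (simp add: indicator_def bent_arc_def)
  qed
  also have "\<dots> = (\<integral>\<^sup>+x. ?f x * indicator {0..l} x \<partial>lborel) + (\<integral>\<^sup>+x. ?g (2 * l - x) * indicator {l<..2*l} x \<partial>lborel)"
    by (rule nn_integral_add) auto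
  also have "(\<integral>\<^sup>+x. ?g (2 * l - x) * indicator {l<..2*l} x \<partial>lborel) = (\<integral>\<^sup>+x. ?g x * indicator {0..<l} x \<partial>lborel)"
    using nn_integral_real_reflect[of "\<lambda>x. ?g x * indicator {0..<l} x" "2 * l"]
    by (simp add: indicator_def conj_commute)
  also have "\<dots> = (\<integral>\<^sup>+x. ?g x * indicator {0..l} x \<partial>lborel)"
    by (rule nn_integral_cong_AE, rule AE_mp[OF AE_lborel_singleton[of l]]) (auto simp: indicator_def)
  also have "(\<integral>\<^sup>+x. ?f x * indicator {0..l} x \<partial>lborel) + (\<integral>\<^sup>+x. ?g x * indicator {0..l} x \<partial>lborel) =
    (\<integral>\<^sup>+x. (?f x + ?g x) * indicator {0..l} x \<partial>lborel)"
    by (subst nn_integral_add[symmetric]) (auto simp: algebra_simps)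
  finally show "line_integral \<rho> ?\<gamma> = ennreal t * (\<integral>\<^sup>+x\<in>{0..l}. ?f x + ?g x \<partial>lborel)" .
qed

lemma bent_arc_path:
  fixes a v \<nu> m :: "'a::euclidean_space"
  assumes o: "norm a = 1" "norm v = 1" "a \<bullet> v = 0" and \<nu>: "norm \<nu> = 1"
    and t: "0 < t" and l: "0 < l" and eq: "great_circle a v l \<bullet> \<nu> = 0"
  shows "path (bent_arc m t \<nu> a v l)" "path_image (bent_arc m t \<nu> a v l) \<subseteq> sphere m t"
    "bent_arc m t \<nu> a v l 0 = m + t *\<^sub>R a" "bent_arc m t \<nu> a v l 1 = m + t *\<^sub>R reflect \<nu> a"
proof -
  have fixl: "reflect \<nu> (great_circle a v l) = great_circle a v l"
    using eq by (simp add: reflect_def)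
  show "path (bent_arc m t \<nu> a v l)"
    unfolding path_def bent_arc_def
  proof (intro continuous_intros continuous_on_cases_le)
    show "great_circle a v (2 * l * u) = reflect \<nu> (great_circle a v (2 * l * (1 - u)))"
      if "u \<in> {0..1}" "u = 1/2" for u using fixl unfolding that(2) by simp
  qed (auto simp: great_circle_def reflect_def intro!: continuous_intros)
  show "path_image (bent_arc m t \<nu> a v l) \<subseteq> sphere m t"
    using t by (auto simp: path_image_def bent_arc_def dist_norm norm_great_circle[OF o] norm_reflect[OF \<nu>])
  show "bent_arc m t \<nu> a v l 0 = m + t *\<^sub>R a" "bent_arc m t \<nu> a v l 1 = m + t *\<^sub>R reflect \<nu> a"
    by (auto simp: bent_arc_def great_circle_def)
qed

section \<open>The spherical cap inequality\<close>

lemma ennreal_young: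
  fixes x :: ennreal and y \<tau> :: real
  assumes n: "2 \<le> n" and "0 \<le> y" "0 < \<tau>"
  shows "x * ennreal y \<le> ennreal (\<tau> ^ n / real n) * x ^ n +
    ennreal ((real n - 1) / real n * \<tau> powr (- (real n / (real n - 1))) * y powr (real n / (real n - 1)))"
proof (cases x)
  case (real r)
  let ?q = "real n / (real n - 1)"
  have q: "1 < ?q" "1 / real n + 1 / ?q = 1" using n by (auto simp: field_simps)
  have "r * y = (\<tau> * r) * (y / \<tau>)" using assms by simp
  also have "\<dots> \<le> (\<tau> * r) powr real n / real n + (y / \<tau>) powr ?q / ?q"
    using assms real q by (intro Youngs_inequality) auto
  also have "(\<tau> * r) powr real n = \<tau> ^ n * r ^ n"
    using assms real by (cases "r = 0") (auto simp: powr_realpow power_mult_distrib)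
  also have "(y / \<tau>) powr ?q / ?q = (real n - 1) / real n * \<tau> powr (- ?q) * y powr ?q"
    using assms by (simp add: powr_divide powr_minus_divide mult_ac)
  finally have le: "r * y \<le> \<tau> ^ n / real n * r ^ n + (real n - 1) / real n * \<tau> powr (- ?q) * y powr ?q"
    by (simp add: mult.commute)
  have nn: "0 \<le> \<tau> ^ n / real n * r ^ n" "0 \<le> (real n - 1) / real n * \<tau> powr (- ?q) * y powr ?q"
    using assms real by auto
  have "x * ennreal y = ennreal (r * y)" using real assms by (simp add: ennreal_mult)
  also have "\<dots> \<le> ennreal (\<tau> ^ n / real n * r ^ n + (real n - 1) / real n * \<tau> powr (- ?q) * y powr ?q)"
    using le by (rule ennreal_leI)
  also have "\<dots> = ennreal (\<tau> ^ n / real n * r ^ n) + ennreal ((real n - 1) / real n * \<tau> powr (- ?q) * y powr ?q)"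
    using nn by (rule ennreal_plus)
  also have "ennreal (\<tau> ^ n / real n * r ^ n) = ennreal (\<tau> ^ n / real n) * x ^ n"
    using real assms by (subst ennreal_mult) (auto simp: ennreal_power)
  finally show ?thesis .
next
  case top
  have "ennreal (\<tau> ^ n / real n) * x ^ n = top"
    using assms top n by (simp add: power_eq_top_ennreal ennreal_mult_eq_top_iff)
  then show ?thesis by simp
qed

lemma convex_on_power_nonneg: "convex_on {0..} (\<lambda>x::real. x ^ n)"
  by (cases "even n") (auto intro: convex_power_odd convex_on_subset[OF convex_power_even])

lemma ennreal_power_add_le:
  fixes x y :: ennreal
  shows "(x + y) ^ n \<le> 2 ^ (n - 1) * (x ^ n + y ^ n)"
proof (cases "n = 0")
  case False
  show ?thesis
  proof (cases "x = top \<or> y = top")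
    case True
    with False show ?thesis by (auto simp: ennreal_mult_eq_top_iff power_eq_top_ennreal)
  next
    case xy: False
    then obtain r t where rt: "x = ennreal r" "y = ennreal t" "0 \<le> r" "0 \<le> t"
      by (metis ennreal_cases)
    have "((1/2) * r + (1/2) * t) ^ n \<le> (1/2) * r ^ n + (1/2) * t ^ n"
    proof -
      have "convex_on {0..} (\<lambda>x::real. x ^ n)" by (rule convex_on_power_nonneg)
      from convex_onD[OF this, of "1/2" r t] show ?thesis using rt by simp
    qed
    then have "(r + t) ^ n / 2 ^ n \<le> (r ^ n + t ^ n) / 2"
      by (simp add: power_divide add_divide_distrib[symmetric])
    then have "(r + t) ^ n \<le> 2 ^ n * ((r ^ n + t ^ n) / 2)" by (simp add: field_simps)
    also have "\<dots> = 2 ^ (n - 1) * (r ^ n + t ^ n)" using False by (cases n) auto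
    finally have "ennreal ((r + t) ^ n) \<le> ennreal (2 ^ (n - 1) * (r ^ n + t ^ n))" by (rule ennreal_leI)
    moreover have "ennreal (2 ^ (n - 1)) = 2 ^ (n - 1)"
      by (metis ennreal_numeral ennreal_power zero_le_numeral)
    ultimately show ?thesis
      using rt by (simp add: ennreal_power[symmetric] ennreal_mult ennreal_plus flip: ennreal_power)
  qed
qed simp

lemma great_circle_as_cot:
  "great_circle a v (pi/2 - arctan s) = (1 / sqrt (1 + s\<^sup>2)) *\<^sub>R (v + s *\<^sub>R a)"
  by (simp add: great_circle_def cos_diff sin_diff cos_arctan sin_arctan algebra_simps)

lemma Union_arctan: "(\<Union>N. {arctan (- real (Suc N))..arctan (real (Suc N))}) = {-(pi/2)<..<pi/2}"
proof -
  have "\<exists>N. y \<in> {arctan (- real (Suc N))..arctan (real (Suc N))}" if y: "y \<in> {-(pi/2)<..<pi/2}" for y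
  proof -
    obtain N :: nat where "\<bar>tan y\<bar> \<le> real N" using real_arch_simple by blast
    then have "- real (Suc N) \<le> tan y" "tan y \<le> real (Suc N)" by (auto simp: abs_le_iff)
    then have "arctan (- real (Suc N)) \<le> arctan (tan y)" "arctan (tan y) \<le> arctan (real (Suc N))"
      by (auto simp only: arctan_le_iff)
    moreover have "arctan (tan y) = y" using y by (intro arctan_tan) auto
    ultimately show ?thesis by (intro exI[of _ N]) auto
  qed
  moreover have "{arctan (- real (Suc N))..arctan (real (Suc N))} \<subseteq> {-(pi/2)<..<pi/2}" for N
    using arctan_lbound[of "- real (Suc N)"] arctan_ubound[of "real (Suc N)"] by auto
  ultimately show ?thesis by blast
qed

lemma nn_integral_great_circle:
  fixes H :: "'a::euclidean_space \<Rightarrow> ennreal"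
  assumes [measurable]: "H \<in> borel_measurable borel"
  shows "(\<integral>\<^sup>+x\<in>{0..pi/2 - arctan s0}. H (great_circle a v x) \<partial>lborel) =
    (\<integral>\<^sup>+s. indicator {s0<..} s * (H ((1 / sqrt (1 + s\<^sup>2)) *\<^sub>R (v + s *\<^sub>R a)) * ennreal (1 / (1 + s\<^sup>2))) \<partial>lborel)"
proof -
  have [measurable]: "great_circle a v \<in> borel_measurable borel"
    unfolding great_circle_def by measurable
  have "(\<integral>\<^sup>+x\<in>{0..pi/2 - arctan s0}. H (great_circle a v x) \<partial>lborel) =
    (\<integral>\<^sup>+y. H (great_circle a v (pi/2 - y)) * indicator {arctan s0..pi/2} y \<partial>lborel)"
    using nn_integral_real_reflect[of "\<lambda>x. H (great_circle a v x) * indicator {0..pi/2 - arctan s0} x" "pi/2"]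
    by (simp add: indicator_def conj_commute)
  also have "\<dots> = (\<integral>\<^sup>+y. (H (great_circle a v (pi/2 - y)) * indicator {arctan s0<..} y) * indicator {-(pi/2)<..<pi/2} y \<partial>lborel)"
  proof (rule nn_integral_cong_AE)
    show "AE y in lborel. H (great_circle a v (pi/2 - y)) * indicator {arctan s0..pi/2} y =
      (H (great_circle a v (pi/2 - y)) * indicator {arctan s0<..} y) * indicator {-(pi/2)<..<pi/2} y"
      using AE_lborel_singleton[of "arctan s0"] AE_lborel_singleton[of "pi/2"]
      by eventually_elim (use arctan_lbound[of s0] in \<open>auto simp: indicator_def\<close>)
  qed
  also have "\<dots> = (\<integral>\<^sup>+s. (H (great_circle a v (pi/2 - arctan s)) * indicator {arctan s0<..} (arctan s)) * ennreal (1 / (1 + s\<^sup>2)) \<partial>lborel)"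
    unfolding Union_arctan[symmetric]
  proof (rule nn_integral_substitution_UNIV[symmetric])
    show "(arctan has_real_derivative 1 / (1 + s\<^sup>2)) (at s)" for s
      using DERIV_arctan[of s] by (simp add: divide_inverse)
    show "continuous_on UNIV (\<lambda>s::real. 1 / (1 + s\<^sup>2))" by (intro continuous_intros) auto
  qed auto
  finally show ?thesis
    by (simp add: great_circle_as_cot indicator_def mult_ac arctan_less_iff)
qed

text \<open>The spherical cap inequality with its sharp constant. Any two points of a sphere are joined
  by great circle arcs from the first one to the equator of points equidistant to both, followed by
  the reflected arcs. The directions opposite to each other contribute arcs which together make up
  half a great circle, so the average over all directions does not depend on the two points.\<close>

lemma sphere_slice_bound:
  fixes \<rho> :: "'a::euclidean_space \<Rightarrow> ennreal" and a b m :: 'a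
  assumes n: "2 \<le> DIM('a)" and \<rho>[measurable]: "\<rho> \<in> borel_measurable borel"
    and t: "0 < t" and ab: "norm a = 1" "norm b = 1" "a \<noteq> b"
    and adm: "\<And>\<gamma>. path \<gamma> \<Longrightarrow> \<gamma> 0 = m + t *\<^sub>R a \<Longrightarrow> \<gamma> 1 = m + t *\<^sub>R b \<Longrightarrow>
      path_image \<gamma> \<subseteq> sphere m t \<Longrightarrow> rectifiable \<gamma> \<Longrightarrow> 1 \<le> line_integral \<rho> \<gamma>"
    and \<kappa>: "0 < \<kappa>" "\<And>e::'a. norm e = 1 \<Longrightarrow> (\<integral>\<^sup>+w. perp_weight e w \<partial>lborel) = ennreal \<kappa>"
    and I: "0 < I" "(\<integral>\<^sup>+s. ennreal ((1 + s\<^sup>2) powr (- (real DIM('a) / (2 * (real DIM('a) - 1))))) \<partial>lborel) = ennreal I"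
  shows "ennreal (\<kappa> / (I ^ (DIM('a) - 1) * t ^ DIM('a))) \<le> sphint (\<lambda>q. \<rho> (m + t *\<^sub>R q) ^ DIM('a))"
proof -
  define n where "n = DIM('a)"
  have n2: "2 \<le> n" using n by (simp add: n_def)
  \<comment> \<open>Normal of the mirror that exchanges \<open>a\<close> and
    \<open>b\<close>.\<close>
  define \<nu> where "\<nu> = (1 / norm (a - b)) *\<^sub>R (a - b)"
  have nab: "norm (a - b) > 0" using ab by simp
  have \<nu>: "norm \<nu> = 1" using nab by (simp add: \<nu>_def)
  have aa: "a \<bullet> a = 1" "b \<bullet> b = 1" using ab by (auto simp: norm_eq_1)
  have nab2: "norm (a - b) ^ 2 = 2 * (1 - a \<bullet> b)"
    using aa by (simp add: power2_norm_eq_inner inner_diff_left inner_diff_right inner_commute)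
  have a\<nu>: "a \<bullet> \<nu> = norm (a - b) / 2"
  proof -
    have "a \<bullet> \<nu> = (1 - a \<bullet> b) / norm (a - b)" using aa by (simp add: \<nu>_def inner_diff_right)
    also have "1 - a \<bullet> b = norm (a - b) ^ 2 / 2" using nab2 by simp
    finally show ?thesis using nab by (simp add: power2_eq_square)
  qed
  have a\<nu>pos: "0 < a \<bullet> \<nu>" using nab unfolding a\<nu> by simp
  have refl: "reflect \<nu> a = b" using nab unfolding reflect_def a\<nu> by (simp add: \<nu>_def)
  define h where "h = (\<lambda>q. \<rho> (m + t *\<^sub>R q))"
  have [measurable]: "h \<in> borel_measurable borel" unfolding h_def by measurable
  define k where "k = (\<lambda>q. h q + h (reflect \<nu> q))"
  have [measurable]: "k \<in> borel_measurable borel" unfolding k_def by measurable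
  have arcs: "ennreal (1 / t) \<le> (\<integral>\<^sup>+s. indicator {0<..} (((1 / sqrt (1 + s\<^sup>2)) *\<^sub>R (v + s *\<^sub>R a)) \<bullet> \<nu>) *
      (k ((1 / sqrt (1 + s\<^sup>2)) *\<^sub>R (v + s *\<^sub>R a)) * ennreal (1 / (1 + s\<^sup>2))) \<partial>lborel)"
    if v: "norm v = 1" "a \<bullet> v = 0" for v
  proof -
    \<comment> \<open>Cotangent of the angle at which the great circle from \<open>a\<close> through
      \<open>v\<close> crosses the mirror; larger \<open>s\<close> belong to the side of
      \<open>a\<close>.\<close>
    define s0 where "s0 = - (v \<bullet> \<nu>) / (a \<bullet> \<nu>)"
    define l where "l = pi/2 - arctan s0"
    have l: "0 < l" using arctan_ubound[of s0] by (simp add: l_def)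
    have eq: "great_circle a v l \<bullet> \<nu> = 0"
      unfolding l_def great_circle_as_cot using a\<nu>pos by (simp add: s0_def inner_add_left inner_diff_left)
    have side: "indicator {s0<..} s = (indicator {0<..} (((1 / sqrt (1 + s\<^sup>2)) *\<^sub>R (v + s *\<^sub>R a)) \<bullet> \<nu>) :: ennreal)" for s
    proof -
      have "s0 < s \<longleftrightarrow> 0 < (v + s *\<^sub>R a) \<bullet> \<nu>"
        unfolding s0_def pos_divide_less_eq[OF a\<nu>pos] by (auto simp: inner_add_left)
      also have "\<dots> \<longleftrightarrow> 0 < ((1 / sqrt (1 + s\<^sup>2)) *\<^sub>R (v + s *\<^sub>R a)) \<bullet> \<nu>"
        by (simp add: zero_less_divide_iff add_pos_nonneg)
      finally show ?thesis by (simp add: indicator_def)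
    qed
    have "1 \<le> line_integral \<rho> (bent_arc m t \<nu> a v l)"
      using bent_arc_path[OF ab(1) v \<nu> t l eq, of m] bent_arc_line_integral(1)[OF ab(1) v \<nu> t l eq \<rho>, of m] refl
      by (intro adm) auto
    also have "\<dots> = ennreal t * (\<integral>\<^sup>+x\<in>{0..l}. k (great_circle a v x) \<partial>lborel)"
      unfolding bent_arc_line_integral(2)[OF ab(1) v \<nu> t l eq \<rho>] by (simp add: k_def h_def)
    finally have "ennreal (1 / t) * 1 \<le> ennreal (1 / t) * (ennreal t * (\<integral>\<^sup>+x\<in>{0..l}. k (great_circle a v x) \<partial>lborel))"
      by (rule mult_left_mono) simp
    also have "\<dots> = (\<integral>\<^sup>+x\<in>{0..l}. k (great_circle a v x) \<partial>lborel)"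
      using t by (simp add: mult.assoc[symmetric] ennreal_mult[symmetric])
    finally show ?thesis
      unfolding l_def nn_integral_great_circle[OF \<open>k \<in> borel_measurable borel\<close>] side by simp
  qed
  \<comment> \<open>On great circles through \<open>a\<close> the surface measure has the density
    sin^(n-2) against arc length; the power in \<open>G\<close> cancels it, so that the estimate for
    single arcs can be integrated over all directions \<open>v\<close>.\<close>
  define G where "G = (\<lambda>q. indicator {0<..} (q \<bullet> \<nu>) * (k q * ennreal ((1 - (q \<bullet> a)\<^sup>2) powr (- ((real n - 2) / 2)))))"
  have [measurable]: "G \<in> borel_measurable borel" unfolding G_def by measurable
  have step1: "ennreal \<kappa> * ennreal (1 / t) \<le> sphint G"
  proof -
    have "ennreal \<kappa> * ennreal (1 / t) = (\<integral>\<^sup>+w. perp_weight a w * ennreal (1 / t) \<partial>lborel)"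
      using \<kappa>(2)[OF ab(1)] by (subst nn_integral_multc) auto
    also have "\<dots> \<le> (\<integral>\<^sup>+w. perp_weight a w * (\<integral>\<^sup>+s. ennreal ((1 + s\<^sup>2) powr (- real DIM('a) / 2)) *
       G ((1 / sqrt (1 + s\<^sup>2)) *\<^sub>R (sgn (perp a w) + s *\<^sub>R a)) \<partial>lborel) \<partial>lborel)"
    proof (rule nn_integral_mono)
      fix w :: 'a
      show "perp_weight a w * ennreal (1 / t) \<le> perp_weight a w * (\<integral>\<^sup>+s. ennreal ((1 + s\<^sup>2) powr (- real DIM('a) / 2)) *
       G ((1 / sqrt (1 + s\<^sup>2)) *\<^sub>R (sgn (perp a w) + s *\<^sub>R a)) \<partial>lborel)"
      proof (cases "perp a w = 0")
        case True
        then show ?thesis by (simp add: perp_weight_def)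
      next
        case False
        let ?v = "sgn (perp a w)"
        have v: "norm ?v = 1" "a \<bullet> ?v = 0"
          using False aa by (auto simp: norm_sgn sgn_div_norm perp_def inner_diff_right inner_commute)
        have "ennreal ((1 + s\<^sup>2) powr (- real DIM('a) / 2)) * G ((1 / sqrt (1 + s\<^sup>2)) *\<^sub>R (?v + s *\<^sub>R a)) =
           indicator {0<..} (((1 / sqrt (1 + s\<^sup>2)) *\<^sub>R (?v + s *\<^sub>R a)) \<bullet> \<nu>) *
            (k ((1 / sqrt (1 + s\<^sup>2)) *\<^sub>R (?v + s *\<^sub>R a)) * ennreal (1 / (1 + s\<^sup>2)))" for s
        proof -
          have qa: "((1 / sqrt (1 + s\<^sup>2)) *\<^sub>R (?v + s *\<^sub>R a)) \<bullet> a = s / sqrt (1 + s\<^sup>2)"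
            using v aa by (simp add: inner_add_left inner_add_right inner_commute)
          have "(1 / (1 + s\<^sup>2)) powr (- ((real n - 2) / 2)) = (1 + s\<^sup>2) powr ((real n - 2) / 2)"
            by (simp add: powr_divide powr_minus_divide add_nonneg_nonneg)
          then have "(1 + s\<^sup>2) powr (- real DIM('a) / 2) * (1 / (1 + s\<^sup>2)) powr (- ((real n - 2) / 2)) =
              (1 + s\<^sup>2) powr (- real n / 2 + (real n - 2) / 2)"
            unfolding powr_add n_def by simp
          also have "- real n / 2 + (real n - 2) / 2 = -1" by (simp add: field_simps)
          also have "(1 + s\<^sup>2) powr (-1) = 1 / (1 + s\<^sup>2)"
            using powr_minus_divide[of "1 + s\<^sup>2" 1] by (simp add: add_nonneg_nonneg)
          finally have E: "ennreal ((1 + s\<^sup>2) powr (- real DIM('a) / 2)) * ennreal ((1 / (1 + s\<^sup>2)) powr (- ((real n - 2) / 2))) = ennreal (1 / (1 + s\<^sup>2))"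
            by (subst ennreal_mult[symmetric]) auto
          show ?thesis
            unfolding G_def qa one_minus_cos_sq E[symmetric] by (simp only: mult_ac)
        qed
        then show ?thesis using arcs[OF v] by (intro mult_left_mono) auto
      qed
    qed
    also have "\<dots> = sphint G"
      by (rule sphint_great_circles[OF _ ab(1) n, symmetric]) measurable
    finally show ?thesis .
  qed
  \<comment> \<open>The weight of \<open>G\<close> raised to the conjugate exponent
    \<open>n / (n - 1)\<close>.\<close>
  define W where "W = (\<lambda>q. ennreal ((1 - (q \<bullet> a)\<^sup>2) powr (- (real n * (real n - 2) / (2 * (real n - 1))))))"
  have [measurable]: "W \<in> borel_measurable borel" unfolding W_def by measurable
  \<comment> \<open>The weight is even, so a half sphere carries at most half of its integral
    wherever the mirror lies; here the dependence on the two points disappears.\<close>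
  have step2: "2 * sphint (\<lambda>q. indicator {0<..} (q \<bullet> \<nu>) * W q) \<le> ennreal (\<kappa> * I)"
  proof -
    have "sphint (\<lambda>q. indicator {0<..} (q \<bullet> \<nu>) * W q) = sphint (\<lambda>q. indicator {..<0} (q \<bullet> \<nu>) * W q)"
      using sphint_uminus[of "\<lambda>q. indicator {..<0} (q \<bullet> \<nu>) * W q"]
      by (simp add: W_def indicator_def)
    then have "2 * sphint (\<lambda>q. indicator {0<..} (q \<bullet> \<nu>) * W q) =
        sphint (\<lambda>q. indicator {0<..} (q \<bullet> \<nu>) * W q + indicator {..<0} (q \<bullet> \<nu>) * W q)"
      by (subst sphint_add) (auto simp: mult_2)
    also have "\<dots> \<le> sphint W"
      by (rule sphint_mono) (auto simp: indicator_def)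
    also have "\<dots> = ennreal \<kappa> * (\<integral>\<^sup>+s. ennreal ((1 + s\<^sup>2) powr (- real DIM('a) / 2)) *
        ennreal ((1 - (s / sqrt (1 + s\<^sup>2))\<^sup>2) powr (- (real n * (real n - 2) / (2 * (real n - 1))))) \<partial>lborel)"
      using sphint_axis[OF _ ab(1) n, of "\<lambda>c. ennreal ((1 - c\<^sup>2) powr (- (real n * (real n - 2) / (2 * (real n - 1)))))"]
        \<kappa>(2)[OF ab(1)] by (simp add: W_def)
    also have "(\<integral>\<^sup>+s. ennreal ((1 + s\<^sup>2) powr (- real DIM('a) / 2)) *
        ennreal ((1 - (s / sqrt (1 + s\<^sup>2))\<^sup>2) powr (- (real n * (real n - 2) / (2 * (real n - 1))))) \<partial>lborel) = ennreal I"
    proof -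
      have "ennreal ((1 + s\<^sup>2) powr (- real DIM('a) / 2)) *
        ennreal ((1 - (s / sqrt (1 + s\<^sup>2))\<^sup>2) powr (- (real n * (real n - 2) / (2 * (real n - 1))))) =
        ennreal ((1 + s\<^sup>2) powr (- (real DIM('a) / (2 * (real DIM('a) - 1)))))" for s
      proof -
        have "(1 / (1 + s\<^sup>2)) powr (- (real n * (real n - 2) / (2 * (real n - 1)))) = (1 + s\<^sup>2) powr (real n * (real n - 2) / (2 * (real n - 1)))"
          by (simp add: powr_divide powr_minus_divide add_nonneg_nonneg)
        then have "(1 + s\<^sup>2) powr (- real n / 2) * (1 / (1 + s\<^sup>2)) powr (- (real n * (real n - 2) / (2 * (real n - 1)))) =
          (1 + s\<^sup>2) powr (- real n / 2 + real n * (real n - 2) / (2 * (real n - 1)))"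
          unfolding powr_add by simp
        also have "- real n / 2 + real n * (real n - 2) / (2 * (real n - 1)) = - (real n / (2 * (real n - 1)))"
          using n2 by (simp add: field_simps)
        finally show ?thesis unfolding one_minus_cos_sq n_def[symmetric]
          by (subst ennreal_mult[symmetric]) auto
      qed
      then show ?thesis using I(2) by simp
    qed
    finally show ?thesis using \<kappa>(1) I(1) by (simp add: ennreal_mult)
  qed
  define X where "X = sphint (\<lambda>q. h q ^ n)"
  \<comment> \<open>Convexity splits the sum \<open>k\<close> at the price of
    \<open>2 ^ (n - 1)\<close>, and the reflected term supplies the integral over the other half
    sphere.\<close>
  have step3: "sphint (\<lambda>q. indicator {0<..} (q \<bullet> \<nu>) * k q ^ n) \<le> 2 ^ (n - 1) * X"
  proof -
    have "sphint (\<lambda>q. indicator {0<..} (q \<bullet> \<nu>) * k q ^ n) \<le>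
      sphint (\<lambda>q. 2 ^ (n - 1) * (indicator {0<..} (q \<bullet> \<nu>) * h q ^ n + indicator {0<..} (q \<bullet> \<nu>) * h (reflect \<nu> q) ^ n))"
      using ennreal_power_add_le by (intro sphint_mono) (auto simp: indicator_def k_def)
    also have "\<dots> = 2 ^ (n - 1) * (sphint (\<lambda>q. indicator {0<..} (q \<bullet> \<nu>) * h q ^ n) + sphint (\<lambda>q. indicator {0<..} (q \<bullet> \<nu>) * h (reflect \<nu> q) ^ n))"
      by (subst sphint_cmult, measurable, subst sphint_add) auto
    also have "sphint (\<lambda>q. indicator {0<..} (q \<bullet> \<nu>) * h (reflect \<nu> q) ^ n) = sphint (\<lambda>q. indicator {..<0} (q \<bullet> \<nu>) * h q ^ n)"
      using sphint_reflect[OF _ \<nu>, of "\<lambda>q. indicator {..<0} (q \<bullet> \<nu>) * h q ^ n"]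
      by (simp add: reflect_inner[OF \<nu>] indicator_def)
    also have "sphint (\<lambda>q. indicator {0<..} (q \<bullet> \<nu>) * h q ^ n) + sphint (\<lambda>q. indicator {..<0} (q \<bullet> \<nu>) * h q ^ n) =
      sphint (\<lambda>q. indicator {0<..} (q \<bullet> \<nu>) * h q ^ n + indicator {..<0} (q \<bullet> \<nu>) * h q ^ n)"
      by (subst sphint_add) auto
    also have "\<dots> \<le> X" unfolding X_def by (rule sphint_mono) (auto simp: indicator_def)
    finally show ?thesis by (simp add: mult_left_mono)
  qed
  \<comment> \<open>With this scale the second term of Young's inequality is exactly the fraction
    \<open>(n - 1) / n\<close> of the left side \<open>\<kappa> / t\<close>, and the powers of 2
    cancel.\<close>
  define \<tau> where "\<tau> = (I * t / 2) powr ((real n - 1) / real n)"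
  have It: "0 < I * t / 2" using I t by simp
  have \<tau>: "0 < \<tau>" using It I t by (simp add: \<tau>_def)
  have \<tau>n: "\<tau> ^ n = (I * t / 2) ^ (n - 1)"
  proof -
    have "\<tau> ^ n = (I * t / 2) powr (real (n - 1))"
      using powr_realpow[OF \<tau>, of n, symmetric] n2 unfolding \<tau>_def powr_powr by (simp add: of_nat_diff)
    then show ?thesis using powr_realpow[OF It] by simp
  qed
  have \<tau>q: "\<tau> powr (- (real n / (real n - 1))) = 2 / (I * t)"
  proof -
    have "\<tau> powr (- (real n / (real n - 1))) = (I * t / 2) powr (- 1)"
      unfolding \<tau>_def powr_powr using n2 by (simp add: field_simps)
    also have "\<dots> = 2 / (I * t)" using It I t powr_minus_divide[of "I * t / 2" 1] by simp
    finally show ?thesis .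
  qed
  define B where "B = (real n - 1) / real n * (2 / (I * t))"
  have B0: "0 \<le> B" using n2 I t by (simp add: B_def)
  have "ennreal (\<kappa> / t) \<le> sphint G" using step1 \<kappa> t by (simp add: ennreal_mult[symmetric])
  also have "\<dots> \<le> sphint (\<lambda>q. ennreal (\<tau> ^ n / real n) * (indicator {0<..} (q \<bullet> \<nu>) * k q ^ n) +
      ennreal B * (indicator {0<..} (q \<bullet> \<nu>) * W q))"
  proof (rule sphint_mono)
    fix q :: 'a
    have P: "((1 - (q \<bullet> a)\<^sup>2) powr (- ((real n - 2) / 2))) powr (real n / (real n - 1)) =
        (1 - (q \<bullet> a)\<^sup>2) powr (- (real n * (real n - 2) / (2 * (real n - 1))))"
      by (simp add: powr_powr mult.commute)
    have "k q * ennreal ((1 - (q \<bullet> a)\<^sup>2) powr (- ((real n - 2) / 2))) \<le>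
        ennreal (\<tau> ^ n / real n) * k q ^ n + ennreal B * W q"
      using ennreal_young[OF n2 _ \<tau>, of "(1 - (q \<bullet> a)\<^sup>2) powr (- ((real n - 2) / 2))" "k q"]
      unfolding \<tau>q P B_def[symmetric] W_def ennreal_mult[OF B0 powr_ge_zero] by simp
    then show "G q \<le> ennreal (\<tau> ^ n / real n) * (indicator {0<..} (q \<bullet> \<nu>) * k q ^ n) +
      ennreal B * (indicator {0<..} (q \<bullet> \<nu>) * W q)"
      by (auto simp: G_def indicator_def)
  qed
  also have "\<dots> = ennreal (\<tau> ^ n / real n) * sphint (\<lambda>q. indicator {0<..} (q \<bullet> \<nu>) * k q ^ n) +
      ennreal B * sphint (\<lambda>q. indicator {0<..} (q \<bullet> \<nu>) * W q)"
    by (simp add: sphint_add sphint_cmult)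
  also have "\<dots> \<le> ennreal (\<tau> ^ n / real n) * (2 ^ (n - 1) * X) + ennreal (B / 2) * ennreal (\<kappa> * I)"
  proof (intro add_mono mult_left_mono step3)
    have "ennreal B * sphint (\<lambda>q. indicator {0<..} (q \<bullet> \<nu>) * W q) =
        ennreal (B / 2) * (2 * sphint (\<lambda>q. indicator {0<..} (q \<bullet> \<nu>) * W q))"
    proof -
      have "ennreal B = ennreal (B / 2) * 2"
        using B0 by (metis ennreal_mult ennreal_numeral divide_nonneg_pos nonzero_eq_divide_eq zero_le_numeral zero_less_numeral zero_neq_numeral)
      then show ?thesis by (simp add: mult.assoc)
    qed
    then show "ennreal B * sphint (\<lambda>q. indicator {0<..} (q \<bullet> \<nu>) * W q) \<le> ennreal (B / 2) * ennreal (\<kappa> * I)"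
      using step2 by (simp add: mult_left_mono)
  qed auto
  finally have main: "ennreal (\<kappa> / t) \<le> ennreal (\<tau> ^ n / real n) * (2 ^ (n - 1) * X) + ennreal (B / 2) * ennreal (\<kappa> * I)" .
  have goal: "ennreal (\<kappa> / (I ^ (n - 1) * t ^ n)) \<le> X"
  proof (cases X)
    case (real x)
    have e2: "(2::ennreal) ^ (n - 1) = ennreal (2 ^ (n - 1))" by (metis ennreal_numeral ennreal_power zero_le_numeral)
    have "ennreal (\<kappa> / t) \<le> ennreal (\<tau> ^ n / real n * (2 ^ (n - 1) * x) + B / 2 * (\<kappa> * I))"
    proof -
      have "ennreal (A * (P * z) + C * Y) = ennreal A * (ennreal P * ennreal z) + ennreal C * ennreal Y"
        if "0 \<le> A" "0 \<le> P" "0 \<le> z" "0 \<le> C" "0 \<le> Y" for A P z C Y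
        using that by (simp add: ennreal_mult ennreal_plus)
      from this[of "\<tau> ^ n / real n" "2 ^ (n - 1)" x "B / 2" "\<kappa> * I"] show ?thesis
        using main real \<tau> B0 \<kappa> I unfolding e2 by simp
    qed
    then have "\<kappa> / t \<le> \<tau> ^ n / real n * (2 ^ (n - 1) * x) + B / 2 * (\<kappa> * I)"
      using \<tau> B0 \<kappa> I real by (subst (asm) ennreal_le_iff) auto
    moreover have "B / 2 * (\<kappa> * I) = (real n - 1) / real n * (\<kappa> / t)"
    proof -
      have "B / 2 * (\<kappa> * I) = (real n - 1) / real n * ((2 / (I * t)) / 2 * (\<kappa> * I))"
        unfolding B_def by (simp only: divide_inverse mult_ac)
      also have "(2 / (I * t)) / 2 * (\<kappa> * I) = \<kappa> / t" using I(1) t by simp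
      finally show ?thesis .
    qed
    moreover have "\<tau> ^ n / real n * (2 ^ (n - 1) * x) = (I * t) ^ (n - 1) * x / real n"
      unfolding \<tau>n by (simp add: power_divide)
    ultimately have "\<kappa> / t \<le> (I * t) ^ (n - 1) * x / real n + (real n - 1) / real n * (\<kappa> / t)" by metis
    moreover have "(real n - 1) / real n * (\<kappa> / t) = \<kappa> / t - \<kappa> / t / real n"
      using n2 t by (simp add: field_simps)
    ultimately have "\<kappa> / t / real n \<le> (I * t) ^ (n - 1) * x / real n" by linarith
    then have "\<kappa> / t \<le> (I * t) ^ (n - 1) * x" using n2 by (subst (asm) divide_le_cancel) simp
    moreover have "t ^ n = t ^ (n - 1) * t" using n2 by (cases n) auto
    ultimately have "\<kappa> / (I ^ (n - 1) * t ^ n) \<le> x"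
      using I t by (simp add: power_mult_distrib field_simps)
    then show ?thesis using real by (simp add: ennreal_leI)
  qed simp
  then show ?thesis by (simp add: X_def h_def n_def)
qed

section \<open>Lower bounds for the modulus and for \<open>lambda_mod\<close>\<close>

lemma nn_integral_power_ge_log:
  fixes \<rho> :: "'a::euclidean_space \<Rightarrow> ennreal" and m :: 'a
  assumes \<rho>[measurable]: "\<rho> \<in> borel_measurable borel" and r: "0 < r1" "r1 < r2" and C: "0 \<le> C"
    and slice: "\<And>t. r1 < t \<Longrightarrow> t < r2 \<Longrightarrow> ennreal (C / t ^ DIM('a)) \<le> sphint (\<lambda>q. \<rho> (m + t *\<^sub>R q) ^ DIM('a))"
  shows "ennreal (C * ln (r2 / r1)) \<le> (\<integral>\<^sup>+p. \<rho> p ^ DIM('a) \<partial>lborel)"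
proof -
  let ?n = "DIM('a)"
  have "ennreal (C * ln (r2 / r1)) = (\<integral>\<^sup>+\<xi>. ennreal C * indicator {ln r1<..<ln r2} \<xi> \<partial>lborel)"
    using r C by (simp add: nn_integral_cmult ennreal_mult ln_div)
  also have "\<dots> \<le> (\<integral>\<^sup>+\<xi>. sphint (\<lambda>q. ennreal (exp \<xi> ^ ?n) * \<rho> (m + exp \<xi> *\<^sub>R q) ^ ?n) \<partial>lborel)"
  proof (rule nn_integral_mono)
    fix \<xi> :: real
    have "ennreal C \<le> sphint (\<lambda>q. ennreal (exp \<xi> ^ ?n) * \<rho> (m + exp \<xi> *\<^sub>R q) ^ ?n)" if "ln r1 < \<xi>" "\<xi> < ln r2"
    proof -
      have "r1 < exp \<xi>" "exp \<xi> < r2" using that r by (metis exp_less_cancel_iff exp_ln order_less_trans)+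
      then have "ennreal (exp \<xi> ^ ?n) * ennreal (C / exp \<xi> ^ ?n) \<le> ennreal (exp \<xi> ^ ?n) * sphint (\<lambda>q. \<rho> (m + exp \<xi> *\<^sub>R q) ^ ?n)"
        by (intro mult_left_mono slice) auto
      then show ?thesis using C by (simp add: ennreal_mult[symmetric] sphint_cmult)
    qed
    then show "ennreal C * indicator {ln r1<..<ln r2} \<xi> \<le> sphint (\<lambda>q. ennreal (exp \<xi> ^ ?n) * \<rho> (m + exp \<xi> *\<^sub>R q) ^ ?n)"
      by (auto simp: indicator_def)
  qed
  also have "\<dots> = (\<integral>\<^sup>+p. ennreal (1 / norm p ^ ?n) * (ennreal (exp (ln (norm p)) ^ ?n) * \<rho> (m + exp (ln (norm p)) *\<^sub>R sgn p) ^ ?n) \<partial>lborel)"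
    by (rule nn_integral_polar[symmetric]) measurable
  also have "\<dots> = (\<integral>\<^sup>+p. \<rho> (m + p) ^ ?n \<partial>lborel)"
  proof (rule nn_integral_cong_AE)
    show "AE p in lborel. ennreal (1 / norm p ^ ?n) * (ennreal (exp (ln (norm p)) ^ ?n) * \<rho> (m + exp (ln (norm p)) *\<^sub>R sgn p) ^ ?n) = \<rho> (m + p) ^ ?n"
      using AE_lborel_singleton[of "0::'a"]
    proof eventually_elim
      case (elim p)
      then have "exp (ln (norm p)) = norm p" "norm p *\<^sub>R sgn p = p" by (auto simp: sgn_div_norm)
      moreover have "ennreal (1 / norm p ^ ?n) * ennreal (norm p ^ ?n) = 1"
        using elim by (simp add: ennreal_mult[symmetric])
      ultimately show ?case by (simp add: mult.assoc[symmetric])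
    qed
  qed
  also have "\<dots> = (\<integral>\<^sup>+p. \<rho> p ^ ?n \<partial>lborel)"
    by (rule nn_integral_lborel_translate) measurable
  finally show ?thesis .
qed

lemma line_integral_const: "line_integral \<rho> (\<lambda>_. c) = 0" "rectifiable (\<lambda>_. c)"
proof -
  have "curve_length (\<lambda>_. c) 0 1 = 0" unfolding curve_length_def by (simp add: SUP_constant bot_ennreal)
  moreover have "(\<integral>\<^sup>+u\<in>{0..0::real}. f u \<partial>lborel) = (\<integral>\<^sup>+u. 0 \<partial>(lborel :: real measure))" for f
  proof (rule nn_integral_cong_AE)
    show "AE u in lborel. f u * indicator {0..0::real} u = 0"
      using AE_lborel_singleton[of "0::real"] by eventually_elim (auto simp: indicator_def)
  qed
  ultimately show "line_integral \<rho> (\<lambda>_. c) = 0" "rectifiable (\<lambda>_. c)"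
    by (auto simp: line_integral_def rectifiable_def)
qed

lemma modulus_ge_log:
  fixes E F D :: "(real ^ 'n) set" and m :: "real ^ 'n"
  assumes n: "2 \<le> CARD('n)" and r: "0 < r1" "r1 < r2"
    and E: "\<And>t. r1 < t \<Longrightarrow> t < r2 \<Longrightarrow> E \<inter> sphere m t \<noteq> {}"
    and F: "\<And>t. r1 < t \<Longrightarrow> t < r2 \<Longrightarrow> F \<inter> sphere m t \<noteq> {}"
    and D: "\<And>t. r1 < t \<Longrightarrow> t < r2 \<Longrightarrow> sphere m t \<subseteq> D"
    and \<kappa>: "0 < \<kappa>" "\<And>e::real^'n. norm e = 1 \<Longrightarrow> (\<integral>\<^sup>+w. perp_weight e w \<partial>lborel) = ennreal \<kappa>"
    and I: "0 < I" "(\<integral>\<^sup>+s. ennreal ((1 + s\<^sup>2) powr (- (real CARD('n) / (2 * (real CARD('n) - 1))))) \<partial>lborel) = ennreal I"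
  shows "ennreal (\<kappa> / I ^ (CARD('n) - 1) * ln (r2 / r1)) \<le> modulus (joining_curves E F D)"
  unfolding modulus_def
proof (rule INF_greatest)
  fix \<rho> :: "real ^ 'n \<Rightarrow> ennreal" assume "\<rho> \<in> {\<rho>. admissible (joining_curves E F D) \<rho>}"
  then have \<rho>: "\<rho> \<in> borel_measurable borel"
    and adm: "\<And>\<gamma>. \<gamma> \<in> joining_curves E F D \<Longrightarrow> rectifiable \<gamma> \<Longrightarrow> 1 \<le> line_integral \<rho> \<gamma>"
    by (auto simp: admissible_def)
  have dim: "DIM(real ^ 'n) = CARD('n)" by simp
  have "ennreal (\<kappa> / I ^ (CARD('n) - 1) * ln (r2 / r1)) \<le> (\<integral>\<^sup>+p. \<rho> p ^ DIM(real ^ 'n) \<partial>lborel)"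
  proof (rule nn_integral_power_ge_log[OF \<rho> r])
    show "0 \<le> \<kappa> / I ^ (CARD('n) - 1)" using \<kappa> I by simp
    fix t assume t: "r1 < t" "t < r2"
    have t0: "0 < t" using t r by simp
    obtain x y where xy: "x \<in> E" "x \<in> sphere m t" "y \<in> F" "y \<in> sphere m t"
      using E[OF t] F[OF t] by blast
    define a b where "a = (1 / t) *\<^sub>R (x - m)" and "b = (1 / t) *\<^sub>R (y - m)"
    have ab: "norm a = 1" "norm b = 1" "m + t *\<^sub>R a = x" "m + t *\<^sub>R b = y"
      using xy t0 by (auto simp: a_def b_def dist_norm norm_minus_commute)
    \<comment> \<open>A common point of \<open>E\<close> and \<open>F\<close> would give a constant
      curve, which is rectifiable with line integral 0 and contradicts the admissibility of
      \<open>\<rho>\<close>.\<close>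
    have "a \<noteq> b"
    proof
      assume "a = b"
      then have "x = y" using ab by metis
      then have "(\<lambda>_. x) \<in> joining_curves E F D"
        using xy D[OF t] by (auto simp: joining_curves_def pathstart_def pathfinish_def path_def)
      from adm[OF this] show False by (simp add: line_integral_const)
    qed
    have "ennreal (\<kappa> / (I ^ (DIM(real ^ 'n) - 1) * t ^ DIM(real ^ 'n))) \<le> sphint (\<lambda>q. \<rho> (m + t *\<^sub>R q) ^ DIM(real ^ 'n))"
    proof (rule sphere_slice_bound[OF _ \<rho> t0 ab(1,2) \<open>a \<noteq> b\<close> _ \<kappa> I(1)])
      fix \<gamma> assume g: "path \<gamma>" "\<gamma> 0 = m + t *\<^sub>R a" "\<gamma> 1 = m + t *\<^sub>R b" "path_image \<gamma> \<subseteq> sphere m t" "rectifiable \<gamma>"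
      have "\<gamma> ` {0<..<1} \<subseteq> D"
        using g(4) D[OF t] image_mono[of "{0<..<1}" "{0..1}" \<gamma>]
        unfolding path_image_def by (meson greaterThanLessThan_subseteq_atLeastAtMost_iff order_refl order_trans)
      then have "\<gamma> \<in> joining_curves E F D"
        using g xy ab by (auto simp: joining_curves_def pathstart_def pathfinish_def)
      then show "1 \<le> line_integral \<rho> \<gamma>" using g by (intro adm)
    qed (use n I in auto)
    then show "ennreal (\<kappa> / I ^ (CARD('n) - 1) / t ^ DIM(real ^ 'n)) \<le> sphint (\<lambda>q. \<rho> (m + t *\<^sub>R q) ^ DIM(real ^ 'n))"
      by (simp add: field_simps)
  qed
  then show "ennreal (\<kappa> / I ^ (CARD('n) - 1) * ln (r2 / r1)) \<le> (\<integral>\<^sup>+p. \<rho> p ^ CARD('n) \<partial>lborel)" by simp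
qed

text \<open>The complement of \<open>K\<close> in the extended space is open because
  \<open>K\<close> is compact, and it contains the extended boundary because \<open>K\<close> lies
  in the open set \<open>D\<close>.\<close>

lemma tends_to_boundary_leaves_compact:
  fixes D :: "'a::euclidean_space set"
  assumes "tends_to_boundary \<gamma> D" "open D" "compact K" "K \<subseteq> D"
  shows "\<forall>\<^sub>F t in at_left 1. \<gamma> t \<notin> K"
proof -
  let ?U = "- (Some ` K) :: 'a option set"
  have "closedin euclidean K" "compactin euclidean K" using assms by (auto simp: compact_imp_closed)
  then have "openin extended_space (insert None (Some ` (topspace euclidean - K)))"
    unfolding openin_Alexandroff_compactification by blast
  moreover have "insert None (Some ` (topspace euclidean - K)) = ?U"
  proof (rule set_eqI)
    fix z :: "'a option"
    show "z \<in> insert None (Some ` (topspace euclidean - K)) \<longleftrightarrow> z \<in> ?U" by (cases z) auto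
  qed
  ultimately have U: "openin extended_space ?U" by simp
  have "openin extended_space (Some ` D)"
    unfolding openin_Alexandroff_compactification using assms(2) by auto
  then have "Some ` D \<subseteq> extended_space interior_of (Some ` D)" by (simp add: interior_of_openin)
  then have "extended_boundary D \<subseteq> - (Some ` D)"
    by (auto simp: extended_boundary_def frontier_of_def)
  then have "extended_boundary D \<subseteq> ?U" using assms(4) by auto
  with assms(1) U have "\<forall>\<^sub>F t in at_left 1. Some (\<gamma> t) \<in> ?U" unfolding tends_to_boundary_def by blast
  then show ?thesis by eventually_elim auto
qed

lemma curve_to_boundary_meets_sphere:
  fixes D :: "'a::euclidean_space set"
  assumes C: "C \<in> curves_to_boundary D z" and "open D" "cball m t \<subseteq> D" "dist m z < t"
  shows "C \<inter> sphere m t \<noteq> {}"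
proof -
  obtain \<gamma> where \<gamma>: "C = \<gamma> ` {0..<1}" "continuous_on {0..<1} \<gamma>" "\<gamma> 0 = z" "tends_to_boundary \<gamma> D"
    using C by (auto simp: curves_to_boundary_def)
  have "\<forall>\<^sub>F s in at_left 1. \<gamma> s \<notin> cball m t"
    using tends_to_boundary_leaves_compact[OF \<gamma>(4) assms(2) compact_cball assms(3)] .
  moreover have "\<forall>\<^sub>F s in at_left (1::real). s \<in> {0<..<1}"
    using eventually_at_left_real[of 0 1] by simp
  ultimately have "\<forall>\<^sub>F s in at_left (1::real). s \<in> {0<..<1} \<and> \<gamma> s \<notin> cball m t" by eventually_elim auto
  then obtain s where s: "0 < s" "s < 1" "\<gamma> s \<notin> cball m t"
    using eventually_happens[of _ "at_left (1::real)"] by (auto simp: trivial_limit_at_left_real)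
  have "continuous_on {0..s} (\<lambda>x. dist m (\<gamma> x))"
    using s by (intro continuous_intros continuous_on_subset[OF \<gamma>(2)]) auto
  then obtain x where "0 \<le> x" "x \<le> s" "dist m (\<gamma> x) = t"
    using IVT'[of "\<lambda>x. dist m (\<gamma> x)" 0 t s] s assms(4) \<gamma>(3) by auto
  then have "\<gamma> x \<in> C \<inter> sphere m t" using \<gamma>(1) s by auto
  then show ?thesis by blast
qed

text \<open>A sphere about the midpoint meets both curves as soon as its radius exceeds half the
  distance of the points, and its ball stays in \<open>D\<close> below the radius
  \<open>d - dist x y / 2\<close>; the quotient of these two radii is the argument of the
  logarithm.\<close>

lemma lambda_mod_ge_log:
  fixes D :: "(real ^ 'n) set" and x y :: "real ^ 'n"
  assumes n: "2 \<le> CARD('n)" and D: "open D" "ball x d \<subseteq> D" and xy: "x \<noteq> y" "dist x y < d"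
    and \<kappa>: "0 < \<kappa>" "\<And>e::real^'n. norm e = 1 \<Longrightarrow> (\<integral>\<^sup>+w. perp_weight e w \<partial>lborel) = ennreal \<kappa>"
    and I: "0 < I" "(\<integral>\<^sup>+s. ennreal ((1 + s\<^sup>2) powr (- (real CARD('n) / (2 * (real CARD('n) - 1))))) \<partial>lborel) = ennreal I"
  shows "ennreal (\<kappa> / I ^ (CARD('n) - 1) * ln (2 * d / dist x y - 1)) \<le> lambda_mod D x y"
  unfolding lambda_mod_def
proof (rule INF_greatest, clarify)
  fix Cx Cy assume C: "Cx \<in> curves_to_boundary D x" "Cy \<in> curves_to_boundary D y"
  define r where "r = dist x y"
  define m where "m = midpoint x y"
  have r: "0 < r" "r < d" using xy by (auto simp: r_def)
  have mx: "dist m x = r / 2" "dist m y = r / 2" by (auto simp: m_def r_def dist_midpoint)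
  have sub: "cball m t \<subseteq> D" if "t < d - r / 2" for t
  proof
    fix p assume "p \<in> cball m t"
    then have "dist x p < d" using dist_triangle[of x p m] mx that by (auto simp: dist_commute)
    then show "p \<in> D" using D(2) by auto
  qed
  have "ennreal (\<kappa> / I ^ (CARD('n) - 1) * ln ((d - r/2) / (r/2))) \<le> modulus (joining_curves Cx Cy D)"
  proof (rule modulus_ge_log[OF n _ _ _ _ _ \<kappa> I])
    show "Cx \<inter> sphere m t \<noteq> {}" "Cy \<inter> sphere m t \<noteq> {}" "sphere m t \<subseteq> D" if "r / 2 < t" "t < d - r / 2" for t
      using curve_to_boundary_meets_sphere[OF C(1) D(1) sub[OF that(2)]]
        curve_to_boundary_meets_sphere[OF C(2) D(1) sub[OF that(2)]] sub[OF that(2)] that mx by auto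
  qed (use r in auto)
  moreover have "(d - r/2) / (r/2) = 2 * d / dist x y - 1" using r by (simp add: r_def[symmetric] field_simps)
  ultimately show "ennreal (\<kappa> / I ^ (CARD('n) - 1) * ln (2 * d / dist x y - 1)) \<le> modulus (joining_curves Cx Cy D)" by simp
qed

subsection \<open>Spheroidal coordinates\<close>

text \<open>For \<open>p\<close> at distance \<open>T\<close> from \<open>0\<close> and angle \<open>arccos c\<close> to a unit vector \<open>e\<close>, the number
  \<open>cc T c\<close> is the difference of the distances of \<open>p\<close> to \<open>0\<close> and to \<open>e\<close>, that is, the cosine of the
  angular coordinate of the prolate spheroidal system with foci \<open>0\<close> and \<open>e\<close>.\<close>

definition dd :: "real \<Rightarrow> real \<Rightarrow> real" where
  "dd T c = sqrt (T\<^sup>2 + 1 - 2 * T * c)"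

definition cc :: "real \<Rightarrow> real \<Rightarrow> real" where
  "cc T c = T - dd T c"

lemma dd_sq:
  assumes "\<bar>c\<bar> \<le> 1"
  shows "(dd T c)\<^sup>2 = T\<^sup>2 + 1 - 2 * T * c" "(dd T c)\<^sup>2 = (T - c)\<^sup>2 + (1 - c\<^sup>2)"
proof -
  have "c\<^sup>2 \<le> 1" using assms by (simp add: abs_square_le_1)
  moreover have e: "T\<^sup>2 + 1 - 2 * T * c = (T - c)\<^sup>2 + (1 - c\<^sup>2)" by (simp add: power2_eq_square algebra_simps)
  ultimately have "0 \<le> T\<^sup>2 + 1 - 2 * T * c" unfolding e by simp
  then show "(dd T c)\<^sup>2 = T\<^sup>2 + 1 - 2 * T * c" by (simp add: dd_def)
  with e show "(dd T c)\<^sup>2 = (T - c)\<^sup>2 + (1 - c\<^sup>2)" by simp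
qed

lemma dd_nonneg: "\<bar>c\<bar> \<le> 1 \<Longrightarrow> 0 \<le> dd T c"
  using dd_sq[of c T] by (metis dd_def real_sqrt_ge_zero zero_le_power2)

lemma dd_ge:
  assumes "\<bar>c\<bar> \<le> 1"
  shows "T - c \<le> dd T c" "sqrt (1 - c\<^sup>2) \<le> dd T c"
proof -
  have c2: "c\<^sup>2 \<le> 1" using assms by (simp add: abs_square_le_1)
  show "T - c \<le> dd T c" using dd_sq(2)[OF assms, of T] dd_nonneg[OF assms, of T] c2
    by - (rule power2_le_imp_le, auto)
  show "sqrt (1 - c\<^sup>2) \<le> dd T c" using dd_sq(2)[OF assms, of T] dd_nonneg[OF assms, of T] c2
    by - (rule power2_le_imp_le, auto)
qed

lemma dd_bounds:
  assumes "\<bar>c\<bar> \<le> 1" "0 < T"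
  shows "\<bar>T - 1\<bar> \<le> dd T c" "dd T c \<le> T + 1"
proof -
  have "T * c \<le> T" using assms by (simp add: mult_left_le abs_le_iff)
  then have "\<bar>T - 1\<bar>\<^sup>2 \<le> (dd T c)\<^sup>2" unfolding dd_sq(1)[OF assms(1)] by (simp add: power2_eq_square algebra_simps)
  then show "\<bar>T - 1\<bar> \<le> dd T c" using dd_nonneg[OF assms(1)] by (rule power2_le_imp_le)
  have "- T \<le> T * c" using assms mult_left_mono[of "-1" c T] by (simp add: abs_le_iff)
  then have "(dd T c)\<^sup>2 \<le> (T + 1)\<^sup>2" unfolding dd_sq(1)[OF assms(1)] by (simp add: power2_eq_square algebra_simps)
  then show "dd T c \<le> T + 1" using assms by - (rule power2_le_imp_le, auto)
qed

lemma cc_bounds: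
  assumes "\<bar>c\<bar> \<le> 1" "0 < T"
  shows "-1 \<le> cc T c" "cc T c \<le> 1" "dd T c = T - cc T c"
  using dd_bounds[OF assms] by (auto simp: cc_def)

lemma one_minus_cc_sq:
  assumes "\<bar>c\<bar> \<le> 1"
  shows "1 - (cc T c)\<^sup>2 = 2 * T * (c - cc T c)"
  using dd_sq(1)[OF assms, of T] by (simp add: cc_def power2_eq_square algebra_simps)

text \<open>Seen from far away the two foci merge and the coordinate becomes the cosine of the
  angle. The rate follows from \<open>one_minus_cc_sq\<close>; it limits the mismatch of the two
  potentials where they are glued.\<close>

lemma cc_le:
  assumes "\<bar>c\<bar> \<le> 1" "0 < T"
  shows "cc T c \<le> c" "c - cc T c \<le> 1 / (2 * T)"
proof -
  show "cc T c \<le> c" using dd_ge(1)[OF assms(1), of T] by (simp add: cc_def)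
  have "2 * T * (c - cc T c) \<le> 1" using one_minus_cc_sq[OF assms(1), of T] by (metis diff_ge_0_iff_ge diff_left_mono diff_zero zero_le_power2)
  then show "c - cc T c \<le> 1 / (2 * T)" using assms by (simp add: field_simps)
qed

text \<open>With \<open>D\<close> for \<open>dd T c\<close>, \<open>1 - c^2\<close> factors as
  \<open>(D - (T - c)) * (D + (T - c))\<close>, and the second factor is at most
  \<open>2 * D\<close>. It serves twice: to bring the energy into a form that can be integrated, and
  to bound the quadratic effect of the rotation.\<close>

lemma schwarz_pick:
  assumes "\<bar>c\<bar> \<le> 1" "0 < T"
  shows "T * (1 - c\<^sup>2) \<le> (1 - (cc T c)\<^sup>2) * dd T c"
proof -
  let ?D = "dd T c" let ?A = "T - c"
  have A: "?A \<le> ?D" by (rule dd_ge[OF assms(1)])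
  have "1 - c\<^sup>2 = (?D - ?A) * (?D + ?A)"
    using dd_sq(2)[OF assms(1), of T] by (simp add: power2_eq_square algebra_simps)
  also have "\<dots> \<le> (?D - ?A) * (2 * ?D)" using A by (intro mult_left_mono) auto
  finally have "T * (1 - c\<^sup>2) \<le> T * ((?D - ?A) * (2 * ?D))" using assms by (intro mult_left_mono) auto
  also have "\<dots> = (1 - (cc T c)\<^sup>2) * ?D"
    unfolding one_minus_cc_sq[OF assms(1)] by (simp add: cc_def algebra_simps)
  finally show ?thesis .
qed

text \<open>Divided by the square of \<open>dd T c\<close>, the left side is \<open>T^2\<close>
  times the squared gradient of the coordinate, angular part plus radial part.\<close>

lemma grad_identity:
  assumes "\<bar>c\<bar> \<le> 1"
  shows "T\<^sup>2 * (1 - c\<^sup>2) + ((1 - (cc T c)\<^sup>2) / 2)\<^sup>2 = T * dd T c * (1 - (cc T c)\<^sup>2)"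
proof -
  let ?D = "dd T c" let ?A = "T - c"
  have s: "1 - c\<^sup>2 = (?D - ?A) * (?D + ?A)"
    using dd_sq(2)[OF assms(1), of T] by (simp add: power2_eq_square algebra_simps)
  have C: "1 - (cc T c)\<^sup>2 = 2 * T * (?D - ?A)"
    using one_minus_cc_sq[OF assms, of T] by (simp add: cc_def algebra_simps)
  have "2 * T * (?D - ?A) / 2 = T * (?D - ?A)" by simp
  then show ?thesis unfolding s C by (simp only:) (simp add: power2_eq_square algebra_simps)
qed

text \<open>\<open>2 * T - cc T c\<close> is \<open>T + dd T c\<close>, the sum of the distances to
  the foci and hence the other spheroidal coordinate; the last identity is the formula for the
  distance to the axis in terms of both coordinates.\<close>

lemma cc_strict:
  assumes "\<bar>c\<bar> < 1" "0 < T"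
  shows "-1 < cc T c" "cc T c < 1" "0 < dd T c" "1 < 2 * T - cc T c"
    "1 - c\<^sup>2 = (1 - (cc T c)\<^sup>2) * ((2 * T - cc T c)\<^sup>2 - 1) / (4 * T\<^sup>2)"
proof -
  have c: "\<bar>c\<bar> \<le> 1" using assms by simp
  have c2: "c\<^sup>2 < 1" using assms(1) by (simp add: abs_square_less_1)
  have "0 < (dd T c)\<^sup>2" using dd_sq(2)[OF c, of T] c2 by (simp add: add_nonneg_pos)
  then show D: "0 < dd T c" using dd_nonneg[OF c, of T] by (simp add: zero_less_power2)
  let ?C = "cc T c"
  have cC: "c = ?C + (1 - ?C\<^sup>2) / (2 * T)"
    using one_minus_cc_sq[OF c, of T] assms(2) by (simp add: field_simps)
  have "0 < T * (1 - c\<^sup>2)" using c2 assms by simp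
  then have "0 < (1 - ?C\<^sup>2) * dd T c" using schwarz_pick[OF c assms(2)] by linarith
  then have C2: "?C\<^sup>2 < 1" using D by (simp add: zero_less_mult_iff)
  then show C: "-1 < ?C" "?C < 1" by (auto simp: abs_square_less_1 abs_less_iff)
  have m: "1 - c = (1 - ?C) * (2 * T - 1 - ?C) / (2 * T)"
    by (subst cC) (use assms in \<open>simp add: field_simps power2_eq_square\<close>)
  have p: "1 + c = (1 + ?C) * (2 * T + 1 - ?C) / (2 * T)"
    by (subst cC) (use assms in \<open>simp add: field_simps power2_eq_square\<close>)
  have "0 < (1 - ?C) * (2 * T - 1 - ?C) / (2 * T)" unfolding m[symmetric] using assms by simp
  then show "1 < 2 * T - ?C" using C assms by (simp add: zero_less_divide_iff zero_less_mult_iff)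
  have "1 - c\<^sup>2 = (1 - c) * (1 + c)" by (simp add: power2_eq_square algebra_simps)
  also have "\<dots> = (1 - ?C\<^sup>2) * ((2 * T - ?C)\<^sup>2 - 1) / (4 * T\<^sup>2)"
    unfolding m p by (simp add: power2_eq_square field_simps)
  finally show "1 - c\<^sup>2 = (1 - ?C\<^sup>2) * ((2 * T - ?C)\<^sup>2 - 1) / (4 * T\<^sup>2)" .
qed

lemma cc_end: "0 < T \<Longrightarrow> cc T (-1) = -1" "1 \<le> T \<Longrightarrow> cc T 1 = 1"
proof -
  show "cc T (-1) = -1" if "0 < T"
  proof -
    have "T\<^sup>2 + 1 - 2 * T * (-1) = (T + 1)\<^sup>2" by (simp add: power2_eq_square algebra_simps)
    then show ?thesis using that by (simp add: cc_def dd_def)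
  qed
  show "cc T 1 = 1" if "1 \<le> T"
  proof -
    have "T\<^sup>2 + 1 - 2 * T * 1 = (T - 1)\<^sup>2" by (simp add: power2_eq_square algebra_simps)
    then show ?thesis using that by (simp add: cc_def dd_def)
  qed
qed

subsection \<open>The energy of the spheroidal potential\<close>

text \<open>The potential with values 1 and 0 on the rays is a function of \<open>cc\<close> with derivative proportional to
  \<open>(1 - y\<^sup>2) powr (- pe n)\<close>; \<open>Rf\<close> is \<open>T\<close> times the norm of its gradient.\<close>

definition pe :: "nat \<Rightarrow> real" where
  "pe n = (2 * real n - 3) / (2 * (real n - 1))"

definition Rf :: "nat \<Rightarrow> real \<Rightarrow> real \<Rightarrow> real \<Rightarrow> real" where
  "Rf n I T c = (1 / I) * (1 - (cc T c)\<^sup>2) powr (1/2 - pe n) * sqrt (T / dd T c)"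

text \<open>The energy on the sphere of radius \<open>T\<close> per unit of \<open>ln T\<close>,
  with the constant \<open>\<kappa>\<close> split off; \<open>s\<close> is the cotangent of the
  angle to the axis.\<close>

definition slice_energy :: "nat \<Rightarrow> real \<Rightarrow> real \<Rightarrow> ennreal" where
  "slice_energy n I T = (\<integral>\<^sup>+s. ennreal ((1 + s\<^sup>2) powr (- real n / 2)) * ennreal (Rf n I T (s / sqrt (1 + s\<^sup>2)) ^ n) \<partial>lborel)"

lemma measurable_2d [measurable]:
  "(\<lambda>(T, c). dd T c) \<in> borel_measurable (borel \<Otimes>\<^sub>M borel)"
  "(\<lambda>(T, c). cc T c) \<in> borel_measurable (borel \<Otimes>\<^sub>M borel)"
  "(\<lambda>(T, c). Rf n I T c) \<in> borel_measurable (borel \<Otimes>\<^sub>M borel)"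
  unfolding dd_def cc_def Rf_def by measurable

lemma Rf_nonneg: "0 < I \<Longrightarrow> 0 < T \<Longrightarrow> \<bar>c\<bar> \<le> 1 \<Longrightarrow> 0 \<le> Rf n I T c"
  unfolding Rf_def using dd_nonneg by auto

lemma abs_cot_to_cos: "\<bar>s / sqrt (1 + s\<^sup>2)\<bar> < 1"
proof -
  have "\<bar>s\<bar> < sqrt (1 + s\<^sup>2)" by (rule real_less_rsqrt) simp
  then show ?thesis by (simp add: abs_divide)
qed

lemma DERIV_cc_slice:
  assumes T: "0 < T"
  shows "((\<lambda>s. cc T (s / sqrt (1 + s\<^sup>2))) has_real_derivative
     T / dd T (s / sqrt (1 + s\<^sup>2)) * (1 + s\<^sup>2) powr (- 3/2)) (at s)"
proof -
  let ?c = "s / sqrt (1 + s\<^sup>2)"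
  have D: "0 < dd T ?c" using cc_strict(3)[OF abs_cot_to_cos T] .
  then have pos: "0 < T\<^sup>2 + 1 - 2 * T * ?c" by (simp add: dd_def)
  have "((\<lambda>c. cc T c) has_real_derivative T / dd T ?c) (at ?c)"
    unfolding cc_def dd_def using pos
    by (auto intro!: derivative_eq_intros simp: field_simps)
  from DERIV_chain2[OF this has_derivative_cot_to_cos] show ?thesis .
qed

text \<open>The substitution \<open>y = cc T c\<close> replaces the angle by the spheroidal
  coordinate. One factor \<open>X\<close> is kept for it and the remaining power
  \<open>(n - 2) / 2\<close> is estimated by \<open>schwarz_pick\<close>; then \<open>T\<close>
  occurs only in the quotient with the root, whose integral in \<open>ln T\<close> is
  elementary.\<close>

lemma slice_energy_le:
  assumes n: "2 \<le> n" and I: "0 < I" and T: "0 < T"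
  shows "slice_energy n I T \<le> ennreal (1 / I ^ n) * (\<integral>\<^sup>+y. ennreal ((1 - y\<^sup>2) powr (- pe n)) * indicator {-1<..<1} y *
     (indicator {1<..} (2 * T - y) * ennreal (2 * T / sqrt ((2 * T - y)\<^sup>2 - 1))) \<partial>lborel)"
proof -
  let ?f = "\<lambda>y. ennreal ((1 - y\<^sup>2) powr (- pe n)) * indicator {-1<..<1} y *
     (indicator {1<..} (2 * T - y) * ennreal (2 * T / sqrt ((2 * T - y)\<^sup>2 - 1)))"
  let ?c = "\<lambda>s. s / sqrt (1 + s\<^sup>2)"
  let ?g = "\<lambda>s. cc T (?c s)"
  let ?g' = "\<lambda>s. T / dd T (?c s) * (1 + s\<^sup>2) powr (- 3/2)"
  have key: "ennreal ((1 + s\<^sup>2) powr (- real n / 2)) * ennreal (Rf n I T (?c s) ^ n) \<le>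
     ennreal (1 / I ^ n) * (?f (?g s) * ennreal (?g' s))" for s
  proof -
    define c where "c = ?c s"
    have c: "\<bar>c\<bar> < 1" unfolding c_def by (rule abs_cot_to_cos)
    define C where "C = cc T c"
    define D where "D = dd T c"
    note st = cc_strict[OF c T, folded C_def D_def]
    have s2: "1 + s\<^sup>2 = 1 / (1 - c\<^sup>2)" using one_minus_cos_sq[of s] by (simp add: c_def)
    have c2: "0 < 1 - c\<^sup>2" using c by (simp add: abs_square_less_1)
    have C2: "0 < 1 - C\<^sup>2" using st(1,2) by (simp add: abs_square_less_1 abs_less_iff)
    define X where "X = (1 - c\<^sup>2) * (T / D)"
    have X: "0 < X" using c2 T st(3) by (simp add: X_def)
    have XY: "X \<le> 1 - C\<^sup>2"
      using schwarz_pick[of c T] c T st(3) by (simp add: X_def C_def[symmetric] D_def[symmetric] field_simps)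
    have root: "2 * T / sqrt ((2 * T - C)\<^sup>2 - 1) = sqrt ((1 - C\<^sup>2) / (1 - c\<^sup>2))"
    proof -
      have q: "0 < (2 * T - C)\<^sup>2 - 1" using st(4) by (simp add: power2_eq_square) (metis less_1_mult)
      have e: "(1 - C\<^sup>2) / (1 - c\<^sup>2) = (2 * T)\<^sup>2 / ((2 * T - C)\<^sup>2 - 1)"
        using C2 q T unfolding st(5) by (simp add: power2_eq_square)
      have r2: "sqrt ((2 * T)\<^sup>2) = 2 * T" using T by (intro real_sqrt_unique) auto
      show ?thesis unfolding e real_sqrt_divide r2 ..
    qed
    have pm: "(1 + s\<^sup>2) powr a = (1 - c\<^sup>2) powr (- a)" for a
      unfolding s2 using c2 by (simp add: powr_divide powr_minus_divide)
    have L: "(1 + s\<^sup>2) powr (- real n / 2) * Rf n I T c ^ n = (1 / I ^ n) * (X powr (real n / 2) * (1 - C\<^sup>2) powr (real n * (1/2 - pe n)))"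
    proof -
      have "sqrt (T / D) ^ n = (T / D) powr (real n / 2)"
        using T st(3) by (simp add: powr_half_sqrt[symmetric] powr_power)
      moreover have "((1 - C\<^sup>2) powr (1/2 - pe n)) ^ n = (1 - C\<^sup>2) powr (real n * (1/2 - pe n))"
        using C2 by (simp add: powr_power mult.commute)
      moreover have "X powr (real n / 2) = (1 - c\<^sup>2) powr (real n / 2) * (T / D) powr (real n / 2)"
        unfolding X_def by (rule powr_mult)
      ultimately show ?thesis
        unfolding Rf_def C_def[symmetric] D_def[symmetric] pm by (simp add: power_mult_distrib power_divide)
    qed
    have R: "(1 - C\<^sup>2) powr (- pe n) * (2 * T / sqrt ((2 * T - C)\<^sup>2 - 1)) * (T / D * (1 + s\<^sup>2) powr (- 3/2)) = X * (1 - C\<^sup>2) powr (1/2 - pe n)"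
    proof -
      have "(1 - c\<^sup>2) powr (3/2) = (1 - c\<^sup>2) * sqrt (1 - c\<^sup>2)"
        using c2 powr_add[of "1 - c\<^sup>2" 1 "1/2"] by (simp add: powr_half_sqrt)
      moreover have "(1 - C\<^sup>2) powr (1/2 - pe n) = sqrt (1 - C\<^sup>2) * (1 - C\<^sup>2) powr (- pe n)"
        using C2 powr_add[of "1 - C\<^sup>2" "1/2" "- pe n"] by (simp add: powr_half_sqrt)
      moreover have "sqrt ((1 - C\<^sup>2) / (1 - c\<^sup>2)) * sqrt (1 - c\<^sup>2) = sqrt (1 - C\<^sup>2)"
        using c2 by (simp add: real_sqrt_divide)
      ultimately show ?thesis
        unfolding root pm by (simp add: X_def mult_ac)
    qed
    have "X powr (real n / 2) * (1 - C\<^sup>2) powr (real n * (1/2 - pe n)) \<le> X * (1 - C\<^sup>2) powr (1/2 - pe n)"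
    proof -
      have "X powr (real n / 2) = X * X powr ((real n - 2) / 2)"
        using X powr_add[of X 1 "(real n - 2) / 2"] by (simp add: diff_divide_distrib)
      also have "\<dots> \<le> X * (1 - C\<^sup>2) powr ((real n - 2) / 2)"
        using X XY n by (intro mult_left_mono powr_mono2) auto
      finally have "X powr (real n / 2) * (1 - C\<^sup>2) powr (real n * (1/2 - pe n)) \<le>
         X * (1 - C\<^sup>2) powr ((real n - 2) / 2) * (1 - C\<^sup>2) powr (real n * (1/2 - pe n))"
        by (intro mult_right_mono) auto
      also have "\<dots> = X * (1 - C\<^sup>2) powr ((real n - 2) / 2 + real n * (1/2 - pe n))"
        by (simp add: powr_add)
      also have "(real n - 2) / 2 + real n * (1/2 - pe n) = 1/2 - pe n"
        using n by (simp add: pe_def field_simps)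
      finally show ?thesis .
    qed
    then have "(1 + s\<^sup>2) powr (- real n / 2) * Rf n I T c ^ n \<le>
       (1 / I ^ n) * ((1 - C\<^sup>2) powr (- pe n) * (2 * T / sqrt ((2 * T - C)\<^sup>2 - 1)) * (T / D * (1 + s\<^sup>2) powr (- 3/2)))"
      unfolding L R using I by (intro mult_left_mono) auto
    then have "ennreal ((1 + s\<^sup>2) powr (- real n / 2) * Rf n I T c ^ n) \<le>
       ennreal ((1 / I ^ n) * ((1 - C\<^sup>2) powr (- pe n) * (2 * T / sqrt ((2 * T - C)\<^sup>2 - 1)) * (T / D * (1 + s\<^sup>2) powr (- 3/2))))"
      by (rule ennreal_leI)
    moreover have "ennreal ((1 / I ^ n) * ((1 - C\<^sup>2) powr (- pe n) * (2 * T / sqrt ((2 * T - C)\<^sup>2 - 1)) * (T / D * (1 + s\<^sup>2) powr (- 3/2)))) =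
      ennreal (1 / I ^ n) * (?f C * ennreal (T / D * (1 + s\<^sup>2) powr (- 3/2)))"
    proof -
      have nn: "0 \<le> 1 / I ^ n" "0 \<le> (1 - C\<^sup>2) powr (- pe n)" "0 \<le> 2 * T / sqrt ((2 * T - C)\<^sup>2 - 1)" "0 \<le> T / D * (1 + s\<^sup>2) powr (- 3/2)"
        using I T st(3) unfolding root using C2 c2 by auto
      have f: "?f C = ennreal ((1 - C\<^sup>2) powr (- pe n)) * ennreal (2 * T / sqrt ((2 * T - C)\<^sup>2 - 1))"
        using st by simp
      show ?thesis unfolding f using nn by (simp only: ennreal_mult mult_nonneg_nonneg)
    qed
    moreover have "ennreal ((1 + s\<^sup>2) powr (- real n / 2) * Rf n I T c ^ n) =
       ennreal ((1 + s\<^sup>2) powr (- real n / 2)) * ennreal (Rf n I T c ^ n)"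
      using Rf_nonneg[OF I T, of c n] c by (intro ennreal_mult) auto
    ultimately show ?thesis by (simp only: c_def C_def D_def)
  qed
  have "slice_energy n I T \<le> (\<integral>\<^sup>+s. ennreal (1 / I ^ n) * (?f (?g s) * ennreal (?g' s)) \<partial>lborel)"
    unfolding slice_energy_def by (rule nn_integral_mono) (rule key)
  also have "\<dots> = ennreal (1 / I ^ n) * (\<integral>\<^sup>+s. ?f (?g s) * ennreal (?g' s) \<partial>lborel)"
    by (rule nn_integral_cmult) measurable
  also have "(\<integral>\<^sup>+s. ?f (?g s) * ennreal (?g' s) \<partial>lborel) =
     (\<integral>\<^sup>+y. ?f y * indicator (\<Union>N. {?g (- real (Suc N))..?g (real (Suc N))}) y \<partial>lborel)"
  proof (rule nn_integral_substitution_UNIV)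
    have D: "0 < dd T (?c s)" for s using cc_strict(3)[OF abs_cot_to_cos T] .
    show "(?g has_real_derivative ?g' s) (at s)" for s by (rule DERIV_cc_slice[OF T])
    show "0 \<le> ?g' s" for s using D[of s] T by simp
    have "continuous_on UNIV (\<lambda>s. dd T (?c s))"
      unfolding dd_def by (intro continuous_intros) auto
    then show "continuous_on UNIV ?g'"
      using D by (intro continuous_intros) (auto simp: less_imp_neq[symmetric] intro: less_imp_neq[THEN not_sym])
  qed measurable
  also have "\<dots> \<le> (\<integral>\<^sup>+y. ?f y \<partial>lborel)"
    by (rule nn_integral_mono) (auto simp: indicator_def)
  finally show ?thesis by (simp add: mult_left_mono)
qed

text \<open>The antiderivative is \<open>arcosh (2 * exp \<xi> - y)\<close>, which vanishes where
  the indicator sets in; the integrand is singular there, so the interval is exhausted from the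
  right. Bounding \<open>arcosh w\<close> by \<open>ln (2 * w)\<close> produces the factor 4 which,
  squared, becomes the 16 of the upper bound.\<close>

lemma root_quotient_integral:
  fixes X y :: real
  assumes y: "-1 < y" "y < 1"
  shows "(\<integral>\<^sup>+\<xi>. indicator {..X} \<xi> * (indicator {1<..} (2 * exp \<xi> - y) * ennreal (2 * exp \<xi> / sqrt ((2 * exp \<xi> - y)\<^sup>2 - 1))) \<partial>lborel)
     \<le> ennreal (ln (4 * exp X + 2))"
proof -
  define \<xi>0 where "\<xi>0 = ln ((1 + y) / 2)"
  have w: "1 < 2 * exp \<xi> - y \<longleftrightarrow> \<xi>0 < \<xi>" for \<xi>
  proof -
    have "1 < 2 * exp \<xi> - y \<longleftrightarrow> exp \<xi>0 < exp \<xi>" using y by (auto simp: \<xi>0_def)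
    then show ?thesis by simp
  qed
  let ?f = "\<lambda>\<xi>. 2 * exp \<xi> / sqrt ((2 * exp \<xi> - y)\<^sup>2 - 1)"
  let ?g = "\<lambda>\<xi>. indicator {..X} \<xi> * (indicator {1<..} (2 * exp \<xi> - y) * ennreal (?f \<xi>))"
  let ?M = "density lborel ?g"
  let ?A = "\<lambda>N. {\<xi>0 + 1 / real (Suc N)..X}"
  have "emeasure ?M (?A N) \<le> ennreal (ln (4 * exp X + 2))" for N
  proof (cases "\<xi>0 + 1 / real (Suc N) \<le> X")
    case True
    define a where "a = \<xi>0 + 1 / real (Suc N)"
    have a: "\<xi>0 < a" "a \<le> X" using True by (auto simp: a_def)
    have gt: "1 < 2 * exp \<xi> - y" if "a \<le> \<xi>" for \<xi> using w[of \<xi>] a that by simp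
    have "emeasure ?M (?A N) = (\<integral>\<^sup>+\<xi>. ?g \<xi> * indicator {a..X} \<xi> \<partial>lborel)"
      by (simp add: emeasure_density a_def)
    also have "\<dots> = (\<integral>\<^sup>+\<xi>. ennreal (?f \<xi>) * indicator {a..X} \<xi> \<partial>lborel)"
      by (intro nn_integral_cong) (use gt in \<open>auto simp: indicator_def\<close>)
    also have "\<dots> = ennreal (arcosh (2 * exp X - y) - arcosh (2 * exp a - y))"
    proof (rule nn_integral_FTC_Icc)
      fix \<xi> assume "\<xi> \<in> {a..X}"
      then have \<xi>: "a \<le> \<xi>" "\<xi> \<le> X" by auto
      have "((\<lambda>\<xi>. arcosh (2 * exp \<xi> - y)) has_real_derivative 1 / sqrt ((2 * exp \<xi> - y)\<^sup>2 - 1) * (2 * exp \<xi>)) (at \<xi>)"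
        by (rule DERIV_chain2[of arcosh, OF arcosh_real_has_field_derivative])
           (use gt[OF \<xi>(1)] in \<open>auto intro!: derivative_eq_intros\<close>)
      then show "((\<lambda>\<xi>. arcosh (2 * exp \<xi> - y)) has_real_derivative ?f \<xi>) (at \<xi>)"
        by simp
      have "1 \<le> (2 * exp \<xi> - y)\<^sup>2" using gt[OF \<xi>(1)] by (intro one_le_power) auto
      then show "0 \<le> ?f \<xi>" by simp
    qed (use a in auto)
    also have "\<dots> \<le> ennreal (ln (4 * exp X + 2))"
    proof (rule ennreal_leI)
      let ?w = "2 * exp X - y"
      have w1: "1 < ?w" using gt[OF a(2)] .
      have "0 \<le> arcosh (2 * exp a - y)" using gt[of a] by (intro arcosh_nonneg_real) auto
      moreover have "arcosh ?w \<le> ln (4 * exp X + 2)"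
      proof -
        have "sqrt (?w\<^sup>2 - 1) \<le> ?w" using w1 by (intro real_le_lsqrt) auto
        then have "?w + sqrt (?w\<^sup>2 - 1) \<le> 4 * exp X + 2" using y by linarith
        moreover have "0 < ?w + sqrt (?w\<^sup>2 - 1)" using w1 by (intro add_pos_nonneg) (auto intro: one_le_power)
        ultimately show ?thesis using w1 by (subst arcosh_real_def) auto
      qed
      ultimately show "arcosh ?w - arcosh (2 * exp a - y) \<le> ln (4 * exp X + 2)" by linarith
    qed
    finally show ?thesis .
  qed (simp add: emeasure_density)
  moreover have "(SUP N. emeasure ?M (?A N)) = emeasure ?M (\<Union>N. ?A N)"
  proof (rule SUP_emeasure_incseq)
    show "incseq ?A" unfolding incseq_def
    proof (intro allI impI)
      fix m n :: nat assume "m \<le> n"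
      then have "1 / real (Suc n) \<le> 1 / real (Suc m)" by (simp add: frac_le)
      then show "?A m \<le> ?A n" by auto
    qed
  qed auto
  moreover have "(\<Union>N. ?A N) = {\<xi>0<..X}"
  proof -
    have "\<xi>0 < x" if "\<xi>0 + 1 / real (Suc N) \<le> x" for N x
      using that by (rule less_le_trans[rotated]) simp
    moreover have "\<exists>N. \<xi>0 + 1 / real (Suc N) \<le> x" if "\<xi>0 < x" for x
    proof -
      obtain N where "inverse (real (Suc N)) < x - \<xi>0" using reals_Archimedean[of "x - \<xi>0"] \<open>\<xi>0 < x\<close> by auto
      then show ?thesis by (intro exI[of _ N]) (simp add: divide_inverse)
    qed
    ultimately show ?thesis by auto
  qed
  ultimately have "emeasure ?M {\<xi>0<..X} \<le> ennreal (ln (4 * exp X + 2))"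
    by (metis (no_types, lifting) SUP_least)
  moreover have "emeasure ?M {\<xi>0<..X} = (\<integral>\<^sup>+\<xi>. ?g \<xi> \<partial>lborel)"
  proof -
    have "?g \<xi> * indicator {\<xi>0<..X} \<xi> = ?g \<xi>" for \<xi>
      using w[of \<xi>] by (auto simp: indicator_def)
    then show ?thesis by (simp add: emeasure_density)
  qed
  ultimately show ?thesis by simp
qed

lemma slice_energy_measurable [measurable]: "slice_energy n I \<in> borel_measurable borel"
  unfolding slice_energy_def by measurable

context
  fixes n :: nat and I :: real
  assumes n: "2 \<le> n" and I: "0 < I"
    and hI: "(\<integral>\<^sup>+y. ennreal ((1 - y\<^sup>2) powr (- pe n)) * indicator {-1<..<1} y \<partial>lborel) = ennreal I"
begin

lemma I_power_cancel: "ennreal (1 / I ^ n) * ennreal I = ennreal (1 / I ^ (n - 1))"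
proof -
  have "1 / I ^ n * I = 1 / I ^ (n - 1)" using n I by (cases n) auto
  then show ?thesis using I by (simp add: ennreal_mult[symmetric])
qed

text \<open>A crude bound, meant for the thin shell in which the two potentials are glued.\<close>

lemma slice_energy_large:
  assumes T: "2 \<le> T"
  shows "slice_energy n I T \<le> ennreal (3/2 * (1 / I ^ (n - 1)))"
proof -
  have "slice_energy n I T \<le> ennreal (1 / I ^ n) * (\<integral>\<^sup>+y. ennreal ((1 - y\<^sup>2) powr (- pe n)) * indicator {-1<..<1} y *
     (indicator {1<..} (2 * T - y) * ennreal (2 * T / sqrt ((2 * T - y)\<^sup>2 - 1))) \<partial>lborel)"
    using T by (intro slice_energy_le[OF n I]) auto
  also have "\<dots> \<le> ennreal (1 / I ^ n) * (\<integral>\<^sup>+y. ennreal ((1 - y\<^sup>2) powr (- pe n)) * indicator {-1<..<1} y * ennreal (3/2) \<partial>lborel)"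
  proof (rule mult_left_mono, rule nn_integral_mono)
    fix y :: real
    have "2 * T / sqrt ((2 * T - y)\<^sup>2 - 1) \<le> 3/2" if y: "-1 < y" "y < 1"
    proof -
      have "(2 * T - 1)\<^sup>2 \<le> (2 * T - y)\<^sup>2" using T y by (intro power_mono) auto
      then have "4 * T * (T - 1) \<le> (2 * T - y)\<^sup>2 - 1" by (simp add: power2_eq_square algebra_simps)
      moreover have "4 * T * (T / 2) \<le> 4 * T * (T - 1)" using T by (intro mult_left_mono) auto
      ultimately have "2 * T\<^sup>2 \<le> (2 * T - y)\<^sup>2 - 1" by (simp add: power2_eq_square)
      moreover have "(4/3 * T)\<^sup>2 \<le> 2 * T\<^sup>2" by (simp add: power_mult_distrib power_divide)
      ultimately have "(4/3 * T)\<^sup>2 \<le> (2 * T - y)\<^sup>2 - 1" by linarith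
      then have "4/3 * T \<le> sqrt ((2 * T - y)\<^sup>2 - 1)" by (rule real_le_rsqrt)
      moreover from this T have "0 < sqrt ((2 * T - y)\<^sup>2 - 1)" by linarith
      ultimately show ?thesis by (subst pos_divide_le_eq) auto
    qed
    then show "ennreal ((1 - y\<^sup>2) powr (- pe n)) * indicator {-1<..<1} y *
     (indicator {1<..} (2 * T - y) * ennreal (2 * T / sqrt ((2 * T - y)\<^sup>2 - 1))) \<le>
      ennreal ((1 - y\<^sup>2) powr (- pe n)) * indicator {-1<..<1} y * ennreal (3/2)"
      by (auto simp: indicator_def intro!: mult_left_mono ennreal_leI)
  qed auto
  also have "\<dots> = ennreal (1 / I ^ n) * (ennreal I * ennreal (3/2))"
    by (subst nn_integral_multc) (auto simp: hI)
  also have "\<dots> = ennreal (3/2 * (1 / I ^ (n - 1)))"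
    unfolding mult.assoc[symmetric] I_power_cancel using I by (subst ennreal_mult[symmetric]) (auto simp: mult.commute)
  finally show ?thesis .
qed

text \<open>For every level \<open>y\<close> the integral over the radii has the same bound, so the
  levels contribute only their total mass \<open>I\<close>, which cancels one of the
  \<open>n\<close> factors.\<close>

lemma slice_energy_integral:
  "(\<integral>\<^sup>+\<xi>. indicator {..X} \<xi> * slice_energy n I (exp \<xi>) \<partial>lborel) \<le> ennreal (1 / I ^ (n - 1) * ln (4 * exp X + 2))"
proof -
  let ?h = "\<lambda>y. ennreal ((1 - y\<^sup>2) powr (- pe n)) * indicator {-1<..<1::real} y"
  let ?q = "\<lambda>\<xi> y. indicator {1<..} (2 * exp \<xi> - y) * ennreal (2 * exp \<xi> / sqrt ((2 * exp \<xi> - y)\<^sup>2 - 1))"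
  have "(\<integral>\<^sup>+\<xi>. indicator {..X} \<xi> * slice_energy n I (exp \<xi>) \<partial>lborel) \<le>
    (\<integral>\<^sup>+\<xi>. indicator {..X} \<xi> * (ennreal (1 / I ^ n) * (\<integral>\<^sup>+y. ?h y * ?q \<xi> y \<partial>lborel)) \<partial>lborel)"
    by (intro nn_integral_mono mult_left_mono slice_energy_le[OF n I]) auto
  also have "\<dots> = (\<integral>\<^sup>+\<xi>. (\<integral>\<^sup>+y. ennreal (1 / I ^ n) * (?h y * (indicator {..X} \<xi> * ?q \<xi> y)) \<partial>lborel) \<partial>lborel)"
  proof (rule nn_integral_cong)
    fix \<xi> :: real
    have "(\<integral>\<^sup>+y. ennreal (1 / I ^ n) * (?h y * (indicator {..X} \<xi> * ?q \<xi> y)) \<partial>lborel) =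
        (\<integral>\<^sup>+y. (indicator {..X} \<xi> * ennreal (1 / I ^ n)) * (?h y * ?q \<xi> y) \<partial>lborel)"
      by (simp only: mult_ac)
    also have "\<dots> = (indicator {..X} \<xi> * ennreal (1 / I ^ n)) * (\<integral>\<^sup>+y. ?h y * ?q \<xi> y \<partial>lborel)"
      by (rule nn_integral_cmult) measurable
    finally show "indicator {..X} \<xi> * (ennreal (1 / I ^ n) * (\<integral>\<^sup>+y. ?h y * ?q \<xi> y \<partial>lborel)) =
        (\<integral>\<^sup>+y. ennreal (1 / I ^ n) * (?h y * (indicator {..X} \<xi> * ?q \<xi> y)) \<partial>lborel)"
      by (simp only: mult.assoc)
  qed
  also have "\<dots> = (\<integral>\<^sup>+y. (\<integral>\<^sup>+\<xi>. ennreal (1 / I ^ n) * (?h y * (indicator {..X} \<xi> * ?q \<xi> y)) \<partial>lborel) \<partial>lborel)"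
    by (rule lborel_pair.Fubini') measurable
  also have "\<dots> = (\<integral>\<^sup>+y. ennreal (1 / I ^ n) * (?h y * (\<integral>\<^sup>+\<xi>. indicator {..X} \<xi> * ?q \<xi> y \<partial>lborel)) \<partial>lborel)"
    by (simp add: nn_integral_cmult)
  also have "\<dots> \<le> (\<integral>\<^sup>+y. ennreal (1 / I ^ n) * (?h y * ennreal (ln (4 * exp X + 2))) \<partial>lborel)"
  proof (rule nn_integral_mono, rule mult_left_mono)
    fix y :: real
    show "?h y * (\<integral>\<^sup>+\<xi>. indicator {..X} \<xi> * ?q \<xi> y \<partial>lborel) \<le> ?h y * ennreal (ln (4 * exp X + 2))"
      using root_quotient_integral[of y X] by (auto simp: indicator_def intro!: mult_left_mono)
  qed auto
  also have "\<dots> = ennreal (1 / I ^ n) * ((\<integral>\<^sup>+y. ?h y \<partial>lborel) * ennreal (ln (4 * exp X + 2)))"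
    by (simp add: nn_integral_cmult nn_integral_multc)
  also have "\<dots> = ennreal (1 / I ^ (n - 1) * ln (4 * exp X + 2))"
    unfolding hI mult.assoc[symmetric] I_power_cancel using I by (subst ennreal_mult) (auto intro: ln_ge_zero simp: add_increasing)
  finally show ?thesis .
qed

definition Upot :: "real \<Rightarrow> real" where
  "Upot y = (1 / I) * integral {y..1} (\<lambda>v. (1 - v\<^sup>2) powr (- pe n))"

lemma h_integrable: "(\<lambda>v. (1 - v\<^sup>2) powr (- pe n)) integrable_on {-1..1}"
  "integral {-1..1} (\<lambda>v. (1 - v\<^sup>2) powr (- pe n)) = I"
proof -
  let ?h = "\<lambda>v::real. (1 - v\<^sup>2) powr (- pe n)"
  have eq: "ennreal (?h y) * indicator {-1<..<1} y = ennreal (indicator {-1..1} y * ?h y)" for y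
  proof (cases "y \<in> {-1<..<1}")
    case False
    then show ?thesis by (cases "y = -1 \<or> y = 1") (auto simp: indicator_def)
  qed (auto simp: indicator_def)
  have nn: "(\<integral>\<^sup>+y. ennreal (indicator {-1..1} y * ?h y) \<partial>lborel) = ennreal I" using hI unfolding eq .
  have int: "integrable lborel (\<lambda>y. indicator {-1..1} y * ?h y)"
    by (rule integrableI_nonneg) (use nn in auto)
  then have si: "set_integrable lborel {-1..1} ?h" by (simp add: set_integrable_def)
  have "(LINT y|lborel. indicator {-1..1} y * ?h y) = I"
    using nn I by (subst integral_eq_nn_integral) auto
  then show "?h integrable_on {-1..1}" "integral {-1..1} ?h = I"
    using set_borel_integral_eq_integral[OF si] by (auto simp: set_lebesgue_integral_def)
qed

lemma Upot_ends: "Upot (-1) = 1" "Upot 1 = 0"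
  using I by (auto simp: Upot_def h_integrable)

lemma Upot_continuous: "continuous_on {-1..1} Upot"
  unfolding Upot_def by (intro continuous_intros indefinite_integral_continuous_1' h_integrable)

lemma Upot_mono:
  assumes "-1 \<le> y" "y \<le> y'" "y' \<le> 1"
  shows "Upot y' \<le> Upot y"
  unfolding Upot_def using I assms
  by (intro mult_left_mono integral_subset_le)
     (auto intro: integrable_on_subinterval[OF h_integrable(1)])

lemma Upot_range: "-1 \<le> y \<Longrightarrow> y \<le> 1 \<Longrightarrow> 0 \<le> Upot y \<and> Upot y \<le> 1"
  using Upot_mono[of "-1" y] Upot_mono[of y 1] Upot_ends by auto

lemma Upot_deriv:
  assumes y: "-1 < y" "y < 1"
  shows "(Upot has_real_derivative - (1 / I) * (1 - y\<^sup>2) powr (- pe n)) (at y)"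
proof -
  let ?h = "\<lambda>v::real. (1 - v\<^sup>2) powr (- pe n)"
  have y2: "y\<^sup>2 < 1" using y by (simp add: abs_square_less_1 abs_less_iff)
  have "((\<lambda>u. integral {-1..u} ?h) has_vector_derivative ?h y) (at y within {-1..1} - {})"
  proof (rule integral_has_vector_derivative_continuous_at[OF h_integrable(1)])
    have "isCont ?h y"
    proof (rule DERIV_isCont[OF DERIV_chain2[OF has_real_derivative_powr]])
      show "0 < 1 - y\<^sup>2" using y2 by simp
      show "((\<lambda>v. 1 - v\<^sup>2) has_real_derivative - 2 * y) (at y)" by (auto intro!: derivative_eq_intros)
    qed
    then show "continuous (at y within {-1..1} - {}) ?h" by (rule continuous_at_imp_continuous_at_within)
  qed (use y in auto)
  moreover have "at y within {-1..1} = at y"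
    using y by (intro at_within_interior) (auto simp: interior_atLeastAtMost_real)
  ultimately have "((\<lambda>u. integral {-1..u} ?h) has_real_derivative ?h y) (at y)"
    unfolding Diff_empty has_real_derivative_iff_has_vector_derivative by (simp only:)
  then have d: "((\<lambda>u. (1 / I) * (I - integral {-1..u} ?h)) has_real_derivative (1 / I) * (0 - ?h y)) (at y)"
    by (rule DERIV_cmult[OF DERIV_diff[OF DERIV_const]])
  have "\<forall>\<^sub>F u in nhds y. Upot u = (1 / I) * (I - integral {-1..u} ?h)"
  proof -
    have "\<forall>\<^sub>F u in nhds y. u \<in> {-1<..<1}" using y by (intro eventually_nhds_in_open) auto
    then show ?thesis
    proof eventually_elim
      case (elim u)
      then have "integral {-1..u} ?h + integral {u..1} ?h = I"
        using Henstock_Kurzweil_Integration.integral_combine[of "-1" u 1 ?h] h_integrable by auto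
      then show ?case by (simp add: Upot_def)
    qed
  qed
  then show ?thesis using d by (subst DERIV_cong_ev[OF refl _ refl]) auto
qed

lemma Upot_unif:
  assumes "0 < \<delta>"
  obtains \<omega> where "\<omega> > 0" "\<And>y y'. y \<in> {-1..1} \<Longrightarrow> y' \<in> {-1..1} \<Longrightarrow> \<bar>y - y'\<bar> < \<omega> \<Longrightarrow> \<bar>Upot y - Upot y'\<bar> < \<delta>"
proof -
  have "uniformly_continuous_on {-1..1} Upot"
    by (rule compact_uniformly_continuous[OF Upot_continuous]) simp
  then show thesis using that assms unfolding uniformly_continuous_on_def dist_real_def by metis
qed

end

text \<open>Convexity with weights \<open>1 - \<theta>\<close> and \<open>\<theta>\<close>: for
  small \<open>\<theta>\<close> the coefficient of \<open>A ^ n\<close> is close to 1, and a small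
  \<open>B\<close> pays for the large coefficient of \<open>B ^ n\<close>.\<close>

lemma power_add_le_convex:
  fixes A B \<theta> :: real
  assumes "0 \<le> A" "0 \<le> B" "0 < \<theta>" "\<theta> < 1" "1 \<le> n"
  shows "(A + B) ^ n \<le> A ^ n / (1 - \<theta>) ^ (n - 1) + B ^ n / \<theta> ^ (n - 1)"
proof -
  have "((1 - \<theta>) * (A / (1 - \<theta>)) + \<theta> * (B / \<theta>)) ^ n \<le> (1 - \<theta>) * (A / (1 - \<theta>)) ^ n + \<theta> * (B / \<theta>) ^ n"
    using convex_onD[OF convex_on_power_nonneg[of n], of \<theta> "A / (1 - \<theta>)" "B / \<theta>"] assms by simp
  moreover have "z * (A / z) ^ n = A ^ n / z ^ (n - 1)" if "0 < z" for z A :: real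
    using assms(5) that by (cases n) (auto simp: power_divide)
  ultimately show ?thesis using assms by simp
qed

subsection \<open>Pointwise slopes\<close>

text \<open>A bound for the local Lipschitz constant in place of a gradient: it survives maxima,
  which need not be differentiable, and has the form which \<open>line_integral_ge_one\<close> asks
  for.\<close>

definition slope_le :: "('a::real_normed_vector \<Rightarrow> real) \<Rightarrow> 'a \<Rightarrow> real \<Rightarrow> bool" where
  "slope_le u z g \<longleftrightarrow> (\<forall>\<eta>>0. \<forall>\<^sub>F q in nhds z. \<bar>u q - u z\<bar> \<le> (g + \<eta>) * norm (q - z))"

lemma slope_le_deriv:
  assumes "(u has_derivative f') (at z)" "\<And>h. \<bar>f' h\<bar> \<le> g * norm h"
  shows "slope_le u z g"
  unfolding slope_le_def
proof (intro allI impI)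
  fix \<eta> :: real assume "0 < \<eta>"
  then obtain d where d: "d > 0" "\<And>q. norm (q - z) < d \<Longrightarrow> norm (u q - u z - f' (q - z)) \<le> \<eta> * norm (q - z)"
    using assms(1) unfolding has_derivative_at_alt by blast
  have "\<bar>u q - u z\<bar> \<le> (g + \<eta>) * norm (q - z)" if "dist q z < d" for q
    using d(2)[of q] assms(2)[of "q - z"] that by (auto simp: dist_norm algebra_simps)
  then show "\<forall>\<^sub>F q in nhds z. \<bar>u q - u z\<bar> \<le> (g + \<eta>) * norm (q - z)"
    unfolding eventually_nhds_metric using d(1) by blast
qed

lemma slope_le_mono: "slope_le u z g \<Longrightarrow> g \<le> g' \<Longrightarrow> slope_le u z g'"
  unfolding slope_le_def
proof (intro allI impI)
  fix \<eta> :: real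
  assume *: "\<forall>\<eta>>0. \<forall>\<^sub>F q in nhds z. \<bar>u q - u z\<bar> \<le> (g + \<eta>) * norm (q - z)" "g \<le> g'" "0 < \<eta>"
  then have "\<forall>\<^sub>F q in nhds z. \<bar>u q - u z\<bar> \<le> (g + \<eta>) * norm (q - z)" by blast
  then show "\<forall>\<^sub>F q in nhds z. \<bar>u q - u z\<bar> \<le> (g' + \<eta>) * norm (q - z)"
  proof eventually_elim
    case (elim q)
    have "(g + \<eta>) * norm (q - z) \<le> (g' + \<eta>) * norm (q - z)" using *(2) by (intro mult_right_mono) auto
    with elim show ?case by linarith
  qed
qed

lemma slope_le_cong:
  assumes "\<forall>\<^sub>F q in nhds z. u q = v q" "slope_le v z g"
  shows "slope_le u z g"
  unfolding slope_le_def
proof (intro allI impI)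
  fix \<eta> :: real assume "0 < \<eta>"
  then have ev: "\<forall>\<^sub>F q in nhds z. \<bar>v q - v z\<bar> \<le> (g + \<eta>) * norm (q - z)" using assms(2) by (simp add: slope_le_def)
  have uz: "u z = v z" using assms(1) by (rule eventually_nhds_x_imp_x)
  show "\<forall>\<^sub>F q in nhds z. \<bar>u q - u z\<bar> \<le> (g + \<eta>) * norm (q - z)"
    using ev assms(1) by eventually_elim (simp add: uz)
qed

lemma slope_le_max:
  assumes "slope_le u z g" "slope_le v z g"
  shows "slope_le (\<lambda>q. max (u q) (v q)) z g"
  unfolding slope_le_def
proof (intro allI impI)
  fix \<eta> :: real assume "0 < \<eta>"
  then have "\<forall>\<^sub>F q in nhds z. \<bar>u q - u z\<bar> \<le> (g + \<eta>) * norm (q - z)" "\<forall>\<^sub>F q in nhds z. \<bar>v q - v z\<bar> \<le> (g + \<eta>) * norm (q - z)"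
    using assms by (auto simp: slope_le_def)
  then show "\<forall>\<^sub>F q in nhds z. \<bar>max (u q) (v q) - max (u z) (v z)\<bar> \<le> (g + \<eta>) * norm (q - z)"
    by eventually_elim linarith
qed

lemma slope_le_diff:
  assumes "slope_le u z g" "slope_le v z k"
  shows "slope_le (\<lambda>q. u q - v q) z (g + k)"
  unfolding slope_le_def
proof (intro allI impI)
  fix \<eta> :: real assume "0 < \<eta>"
  then have "\<forall>\<^sub>F q in nhds z. \<bar>u q - u z\<bar> \<le> (g + \<eta>/2) * norm (q - z)" "\<forall>\<^sub>F q in nhds z. \<bar>v q - v z\<bar> \<le> (k + \<eta>/2) * norm (q - z)"
    using assms unfolding slope_le_def by (meson half_gt_zero)+
  then show "\<forall>\<^sub>F q in nhds z. \<bar>(u q - v q) - (u z - v z)\<bar> \<le> (g + k + \<eta>) * norm (q - z)"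
  proof eventually_elim
    case (elim q)
    have "(g + k + \<eta>) * norm (q - z) = (g + \<eta>/2) * norm (q - z) + (k + \<eta>/2) * norm (q - z)"
      by (simp add: field_simps)
    with elim show ?case by linarith
  qed
qed

subsection \<open>A slowly rotating axis\<close>

text \<open>With \<open>\<tau> = ln (norm z)\<close> the axis turns by the angle
  \<open>\<epsilon>\<close> per unit of logarithmic radius, so the points lying on the axis of their
  own radius form a logarithmic spiral. \<open>rot_axis'\<close> completes the frame in the plane of
  rotation.\<close>

definition rot_axis :: "'a::real_inner \<Rightarrow> 'a \<Rightarrow> real \<Rightarrow> real \<Rightarrow> 'a" where
  "rot_axis e0 e1 \<epsilon> \<tau> = cos (\<epsilon> * \<tau>) *\<^sub>R e0 + sin (\<epsilon> * \<tau>) *\<^sub>R e1"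

definition rot_axis' :: "'a::real_inner \<Rightarrow> 'a \<Rightarrow> real \<Rightarrow> real \<Rightarrow> 'a" where
  "rot_axis' e0 e1 \<epsilon> \<tau> = - sin (\<epsilon> * \<tau>) *\<^sub>R e0 + cos (\<epsilon> * \<tau>) *\<^sub>R e1"

definition co :: "'a::real_inner \<Rightarrow> 'a \<Rightarrow> real \<Rightarrow> 'a \<Rightarrow> real" where
  "co e0 e1 \<epsilon> z = (z \<bullet> rot_axis e0 e1 \<epsilon> (ln (norm z))) / norm z"

lemma rot_axis_orthonormal:
  assumes "norm e0 = 1" "norm e1 = 1" "e0 \<bullet> e1 = 0"
  shows "rot_axis e0 e1 \<epsilon> \<tau> \<bullet> rot_axis e0 e1 \<epsilon> \<tau> = 1" "rot_axis' e0 e1 \<epsilon> \<tau> \<bullet> rot_axis' e0 e1 \<epsilon> \<tau> = 1"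
    "rot_axis e0 e1 \<epsilon> \<tau> \<bullet> rot_axis' e0 e1 \<epsilon> \<tau> = 0" "norm (rot_axis e0 e1 \<epsilon> \<tau>) = 1"
proof -
  have o: "e0 \<bullet> e0 = 1" "e1 \<bullet> e1 = 1" "e1 \<bullet> e0 = 0" using assms by (auto simp: norm_eq_1 inner_commute)
  show a: "rot_axis e0 e1 \<epsilon> \<tau> \<bullet> rot_axis e0 e1 \<epsilon> \<tau> = 1"
    using o assms(3) sin_cos_squared_add2[of "\<epsilon> * \<tau>"]
    by (simp add: rot_axis_def inner_add_left inner_add_right power2_eq_square algebra_simps)
  show "rot_axis' e0 e1 \<epsilon> \<tau> \<bullet> rot_axis' e0 e1 \<epsilon> \<tau> = 1"
    using o assms(3) sin_cos_squared_add2[of "\<epsilon> * \<tau>"]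
    by (simp add: rot_axis'_def inner_add_left inner_add_right inner_diff_left inner_diff_right power2_eq_square algebra_simps)
  show "rot_axis e0 e1 \<epsilon> \<tau> \<bullet> rot_axis' e0 e1 \<epsilon> \<tau> = 0"
    using o assms(3) by (simp add: rot_axis_def rot_axis'_def inner_add_left inner_add_right inner_diff_left inner_diff_right algebra_simps)
  show "norm (rot_axis e0 e1 \<epsilon> \<tau>) = 1" using a by (simp add: norm_eq_1)
qed

lemma abs_co_le:
  assumes "norm e0 = 1" "norm e1 = 1" "e0 \<bullet> e1 = 0"
  shows "\<bar>co e0 e1 \<epsilon> z\<bar> \<le> 1"
proof (cases "z = 0")
  case False
  have "\<bar>z \<bullet> rot_axis e0 e1 \<epsilon> (ln (norm z))\<bar> \<le> norm z"
    using Cauchy_Schwarz_ineq2[of z "rot_axis e0 e1 \<epsilon> (ln (norm z))"] rot_axis_orthonormal(4)[OF assms] by simp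
  then show ?thesis using False by (simp add: co_def abs_divide divide_le_eq)
qed (simp add: co_def)

lemma norm_has_derivative:
  fixes z :: "'a::real_inner"
  assumes "z \<noteq> 0"
  shows "(norm has_derivative (\<lambda>h. (z \<bullet> h) / norm z)) (at z)"
  using has_derivative_norm[OF assms] by (simp add: sgn_div_norm inverse_eq_divide mult.commute inner_commute)

lemma co_has_derivative:
  fixes z e0 e1 :: "'a::real_inner" and \<epsilon> :: real
  assumes z: "z \<noteq> 0"
  defines "E \<equiv> rot_axis e0 e1 \<epsilon> (ln (norm z))" and "E' \<equiv> rot_axis' e0 e1 \<epsilon> (ln (norm z))"
  shows "(co e0 e1 \<epsilon> has_derivative (\<lambda>h. (E \<bullet> h - co e0 e1 \<epsilon> z * (z \<bullet> h) / norm z +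
      \<epsilon> * (z \<bullet> E' / norm z) * ((z \<bullet> h) / norm z)) / norm z)) (at z)"
proof -
  let ?t = "norm z"
  have t: "?t > 0" using z by simp
  note N = norm_has_derivative[OF z]
  have L: "((\<lambda>z. ln (norm z)) has_derivative (\<lambda>h. 1 / ?t * ((z \<bullet> h) / ?t))) (at z)"
    using DERIV_compose_FDERIV[OF DERIV_ln_divide[OF t] N] by (simp add: mult.commute)
  have L': "((\<lambda>z. \<epsilon> * ln (norm z)) has_derivative (\<lambda>h. \<epsilon> * (1 / ?t * ((z \<bullet> h) / ?t)))) (at z)"
    by (rule has_derivative_mult_right[OF L])
  have C: "((\<lambda>z. cos (\<epsilon> * ln (norm z))) has_derivative (\<lambda>h. \<epsilon> * (1 / ?t * ((z \<bullet> h) / ?t)) * - sin (\<epsilon> * ln ?t))) (at z)"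
    by (rule DERIV_compose_FDERIV[OF DERIV_cos L'])
  have S: "((\<lambda>z. sin (\<epsilon> * ln (norm z))) has_derivative (\<lambda>h. \<epsilon> * (1 / ?t * ((z \<bullet> h) / ?t)) * cos (\<epsilon> * ln ?t))) (at z)"
    by (rule DERIV_compose_FDERIV[OF DERIV_sin L'])
  have I: "((\<lambda>z. z \<bullet> e) has_derivative (\<lambda>h. h \<bullet> e)) (at z)" for e
    by (rule bounded_linear_imp_has_derivative) (rule bounded_linear_inner_left)
  have P0: "((\<lambda>z. cos (\<epsilon> * ln (norm z)) * (z \<bullet> e0)) has_derivative
      (\<lambda>h. cos (\<epsilon> * ln ?t) * (h \<bullet> e0) + \<epsilon> * (1 / ?t * ((z \<bullet> h) / ?t)) * - sin (\<epsilon> * ln ?t) * (z \<bullet> e0))) (at z)"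
    by (rule has_derivative_mult[OF C I])
  have P1: "((\<lambda>z. sin (\<epsilon> * ln (norm z)) * (z \<bullet> e1)) has_derivative
      (\<lambda>h. sin (\<epsilon> * ln ?t) * (h \<bullet> e1) + \<epsilon> * (1 / ?t * ((z \<bullet> h) / ?t)) * cos (\<epsilon> * ln ?t) * (z \<bullet> e1))) (at z)"
    by (rule has_derivative_mult[OF S I])
  note P = has_derivative_add[OF P0 P1]
  have t0: "norm z \<noteq> 0" using z by simp
  note der = has_derivative_divide'[OF P N t0]
  have fun_eq: "co e0 e1 \<epsilon> = (\<lambda>z. (cos (\<epsilon> * ln (norm z)) * (z \<bullet> e0) + sin (\<epsilon> * ln (norm z)) * (z \<bullet> e1)) / norm z)"
    by (auto simp: co_def rot_axis_def inner_add_right)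
  show ?thesis
    unfolding fun_eq
  proof (rule has_derivative_eq_rhs[OF der], rule ext)
    fix h
    let ?a = "(z \<bullet> h) / ?t"
    let ?c = "cos (\<epsilon> * ln ?t)" let ?s = "sin (\<epsilon> * ln ?t)"
    have Eh: "E \<bullet> h = ?c * (h \<bullet> e0) + ?s * (h \<bullet> e1)" by (simp add: E_def rot_axis_def inner_add_left inner_commute[of h])
    have zE: "z \<bullet> E' = - ?s * (z \<bullet> e0) + ?c * (z \<bullet> e1)" by (simp add: E'_def rot_axis'_def inner_add_right inner_diff_right)
    show "((?c * (h \<bullet> e0) + \<epsilon> * (1 / ?t * ?a) * - ?s * (z \<bullet> e0) + (?s * (h \<bullet> e1) + \<epsilon> * (1 / ?t * ?a) * ?c * (z \<bullet> e1))) * ?t -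
        (?c * (z \<bullet> e0) + ?s * (z \<bullet> e1)) * ?a) / (?t * ?t) =
      (E \<bullet> h - (?c * (z \<bullet> e0) + ?s * (z \<bullet> e1)) / ?t * (z \<bullet> h) / ?t + \<epsilon> * (z \<bullet> E' / ?t) * ?a) / ?t"
      unfolding Eh zE using t by (simp add: field_simps)
  qed
qed

lemma cc_has_derivative:
  assumes T: "(T has_derivative T') (at z)" and c: "(c has_derivative c') (at z)" and D: "0 < dd (T z) (c z)"
  shows "((\<lambda>z. cc (T z) (c z)) has_derivative (\<lambda>h. T' h - ((T z - c z) * T' h - T z * c' h) / dd (T z) (c z))) (at z)"
proof -
  let ?N = "\<lambda>z. (T z)\<^sup>2 + 1 - 2 * T z * c z"
  have pos: "0 < ?N z" using D by (simp add: dd_def)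
  have N: "(?N has_derivative (\<lambda>h. 2 * T z * T' h - 2 * (T' h * c z + T z * c' h))) (at z)"
    using T c by (auto intro!: derivative_eq_intros simp: algebra_simps)
  have "((\<lambda>z. sqrt (?N z)) has_derivative (\<lambda>h. (2 * T z * T' h - 2 * (T' h * c z + T z * c' h)) * (inverse (sqrt (?N z)) / 2))) (at z)"
    by (rule DERIV_compose_FDERIV[OF DERIV_real_sqrt[OF pos] N])
  note der = has_derivative_diff[OF T this]
  have eq: "(2 * T z * T' h - 2 * (T' h * c z + T z * c' h)) * (inverse S / 2) = ((T z - c z) * T' h - T z * c' h) / S" for h S
  proof -
    have "2 * T z * T' h - 2 * (T' h * c z + T z * c' h) = 2 * ((T z - c z) * T' h - T z * c' h)"
      by (simp add: algebra_simps)
    moreover have "X * (inverse S / 2) = Y / S" if "X = 2 * Y" for X Y :: real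
      unfolding that by (simp add: inverse_eq_divide)
    ultimately show ?thesis by blast
  qed
  from der show ?thesis unfolding cc_def dd_def eq .
qed

text \<open>The factor by which the rotation of the axis may increase the gradient.\<close>

definition sqm :: "real \<Rightarrow> real \<Rightarrow> real" where
  "sqm b T = (if T \<le> 1 + 1 / b then sqrt (1 + 2 * b) else sqrt (1 + 2 * b\<^sup>2))"

lemma sqm_pos: "0 < b \<Longrightarrow> 0 < sqm b T"
  by (auto simp: sqm_def intro: add_pos_nonneg)

text \<open>The term linear in \<open>\<epsilon>\<close> carries the factor
  \<open>sqrt (1 - c^2) / dd T c\<close>, which is at most 1, and at most \<open>b\<close> once
  \<open>T\<close> exceeds \<open>1 + 1 / b\<close>. So over most of the range the rotation costs
  only second order in \<open>b\<close>, which is negligible over a logarithmic length of order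
  \<open>1 / b\<close>.\<close>

lemma sqm_ge:
  assumes b: "0 < b" "b \<le> 1" "\<bar>\<epsilon>\<bar> \<le> b" and c: "\<bar>c\<bar> \<le> 1" and D: "0 < dd T c" and T: "0 < T"
  shows "1 + \<bar>\<epsilon>\<bar> * (sqrt (1 - c\<^sup>2) / dd T c) + \<epsilon>\<^sup>2 \<le> (sqm b T)\<^sup>2"
proof -
  let ?q = "sqrt (1 - c\<^sup>2) / dd T c"
  have c2: "c\<^sup>2 \<le> 1" using c by (simp add: abs_square_le_1)
  have q: "0 \<le> ?q" "?q \<le> 1" using D dd_ge(2)[OF c, of T] c2 by (auto simp: divide_le_eq)
  have e2: "\<epsilon>\<^sup>2 \<le> b\<^sup>2" using b by (metis abs_le_square_iff abs_of_pos)
  have bb: "b\<^sup>2 \<le> b" using b by (simp add: power2_eq_square mult_left_le)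
  show ?thesis
  proof (cases "T \<le> 1 + 1 / b")
    case True
    have "\<bar>\<epsilon>\<bar> * ?q \<le> b * 1" using b q by (intro mult_mono) auto
    then show ?thesis using True e2 bb b by (simp add: sqm_def)
  next
    case False
    then have T1: "1 / b < T - 1" by simp
    have "1 / b < dd T c" using T1 dd_bounds(1)[OF c T] by linarith
    then have "1 / dd T c < b" using b D by (simp add: field_simps)
    moreover have "sqrt (1 - c\<^sup>2) \<le> 1" by simp
    then have "?q \<le> 1 / dd T c" using D by (intro divide_right_mono) auto
    ultimately have "?q \<le> b" by linarith
    then have "\<bar>\<epsilon>\<bar> * ?q \<le> b * b" using b q by (intro mult_mono) auto
    then show ?thesis using False e2 by (simp add: sqm_def power2_eq_square)
  qed
qed

text \<open>The vector \<open>v\<close> of the proof is the radius times the gradient of the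
  spheroidal coordinate. Rotation adds the radial component \<open>f * \<mu>\<close>; in the squared
  norm \<open>grad_identity\<close> evaluates the unperturbed part, and \<open>sqm\<close> absorbs
  the mixed and the quadratic term. The case \<open>c' = - c\<close> serves the outer
  potential.\<close>

lemma gradient_bound:
  fixes zh E E' h :: "'a::real_inner"
  assumes z: "norm zh = 1" and E: "E \<bullet> E = 1" "E' \<bullet> E' = 1" "E \<bullet> E' = 0" and T: "0 < T"
    and c: "c = zh \<bullet> E" "c' = c \<or> c' = - c" and D: "0 < dd T c'"
    and b: "0 < b" "b \<le> 1" "\<bar>\<epsilon>\<bar> \<le> b"
  shows "\<bar>(T / dd T c') * (E \<bullet> h - c * (zh \<bullet> h) + \<epsilon> * (zh \<bullet> E') * (zh \<bullet> h)) + (1 - (cc T c')\<^sup>2) / (2 * dd T c') * (zh \<bullet> h)\<bar>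
    \<le> sqrt ((1 - (cc T c')\<^sup>2) * (T / dd T c')) * sqm b T * norm h"
proof -
  have zz: "zh \<bullet> zh = 1" using z by (simp add: norm_eq_1)
  have c1: "\<bar>c\<bar> \<le> 1" using Cauchy_Schwarz_ineq2[of zh E] z E(1) c by (simp add: norm_eq_sqrt_inner)
  then have c'1: "\<bar>c'\<bar> \<le> 1" using c by auto
  have c'2: "c'\<^sup>2 = c\<^sup>2" using c by auto
  have c2: "c\<^sup>2 \<le> 1" using c1 by (simp add: abs_square_le_1)
  define f where "f = T / dd T c'"
  define Y where "Y = 1 - (cc T c')\<^sup>2"
  define G where "G = Y / (2 * dd T c')"
  define \<mu> where "\<mu> = \<epsilon> * (zh \<bullet> E')"
  define s where "s = sqrt (1 - c\<^sup>2)"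
  have s: "0 \<le> s" "s\<^sup>2 = 1 - c\<^sup>2" using c2 by (auto simp: s_def)
  have f: "0 < f" using T D by (simp add: f_def)
  have "\<bar>cc T c'\<bar> \<le> 1" using cc_bounds[OF c'1 T] by auto
  then have Y: "0 \<le> Y" by (simp add: Y_def abs_square_le_1)
  then have G: "0 \<le> G" using D by (simp add: G_def)
  \<comment> \<open>A unit vector has along \<open>E'\<close> at most the sine of its angle to
    \<open>E\<close>.\<close>
  have bessel: "(zh \<bullet> E')\<^sup>2 \<le> s\<^sup>2"
  proof -
    have "0 \<le> (zh - (zh \<bullet> E) *\<^sub>R E - (zh \<bullet> E') *\<^sub>R E') \<bullet> (zh - (zh \<bullet> E) *\<^sub>R E - (zh \<bullet> E') *\<^sub>R E')" by simp
    also have "\<dots> = 1 - (zh \<bullet> E)\<^sup>2 - (zh \<bullet> E')\<^sup>2"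
      using zz E by (simp add: inner_diff_left inner_diff_right inner_commute power2_eq_square algebra_simps)
    finally show ?thesis using s c by simp
  qed
  then have "\<bar>zh \<bullet> E'\<bar> \<le> s" using s by (metis abs_le_square_iff abs_of_nonneg)
  then have \<mu>: "\<bar>\<mu>\<bar> \<le> \<bar>\<epsilon>\<bar> * s" by (simp add: \<mu>_def abs_mult mult_left_mono)
  define v where "v = f *\<^sub>R (E - c *\<^sub>R zh + \<mu> *\<^sub>R zh) + G *\<^sub>R zh"
  have vh: "v \<bullet> h = f * (E \<bullet> h - c * (zh \<bullet> h) + \<mu> * (zh \<bullet> h)) + G * (zh \<bullet> h)"
    by (simp add: v_def inner_add_left inner_diff_left)
  have "norm v ^ 2 = f\<^sup>2 * s\<^sup>2 + (f * \<mu> + G)\<^sup>2"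
    unfolding power2_norm_eq_inner v_def s(2) using zz E c(1)
    by (simp add: inner_diff_left inner_diff_right inner_add_left inner_add_right inner_commute power2_eq_square algebra_simps)
  also have "\<dots> = (f\<^sup>2 * s\<^sup>2 + G\<^sup>2) + 2 * f * G * \<mu> + f\<^sup>2 * \<mu>\<^sup>2" by (simp add: power2_eq_square algebra_simps)
  also have "f\<^sup>2 * s\<^sup>2 + G\<^sup>2 = Y * f"
  proof -
    have "f\<^sup>2 * s\<^sup>2 + G\<^sup>2 = (T\<^sup>2 * (1 - c'\<^sup>2) + (Y / 2)\<^sup>2) / (dd T c')\<^sup>2"
      unfolding s(2) c'2 by (simp add: f_def G_def power_divide add_divide_distrib power_mult_distrib)
    also have "\<dots> = T * dd T c' * Y / (dd T c')\<^sup>2" unfolding Y_def grad_identity[OF c'1] ..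
    also have "\<dots> = Y * f" using D by (simp add: f_def power2_eq_square)
    finally show ?thesis .
  qed
  also have "Y * f + 2 * f * G * \<mu> + f\<^sup>2 * \<mu>\<^sup>2 \<le> Y * f + Y * f * (\<bar>\<epsilon>\<bar> * (s / dd T c')) + Y * f * \<epsilon>\<^sup>2"
  proof (intro add_mono order_refl)
    have "2 * f * G * \<mu> \<le> 2 * f * G * (\<bar>\<epsilon>\<bar> * s)" using \<mu> f G by (intro mult_left_mono) auto
    also have "\<dots> = Y * f * (\<bar>\<epsilon>\<bar> * (s / dd T c'))" by (simp add: G_def)
    finally show "2 * f * G * \<mu> \<le> Y * f * (\<bar>\<epsilon>\<bar> * (s / dd T c'))" .
    have "\<mu>\<^sup>2 \<le> \<epsilon>\<^sup>2 * s\<^sup>2" using bessel by (simp add: \<mu>_def power_mult_distrib mult_left_mono)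
    then have "f\<^sup>2 * \<mu>\<^sup>2 \<le> f\<^sup>2 * (\<epsilon>\<^sup>2 * s\<^sup>2)" by (intro mult_left_mono) auto
    also have "\<dots> = f * \<epsilon>\<^sup>2 * (f * s\<^sup>2)" by (simp add: power2_eq_square)
    also have "f * s\<^sup>2 \<le> Y"
      using schwarz_pick[OF c'1 T] D by (simp add: f_def s(2) c'2 Y_def pos_divide_le_eq)
    then have "f * \<epsilon>\<^sup>2 * (f * s\<^sup>2) \<le> f * \<epsilon>\<^sup>2 * Y" using f by (intro mult_left_mono) auto
    finally show "f\<^sup>2 * \<mu>\<^sup>2 \<le> Y * f * \<epsilon>\<^sup>2" by (simp add: mult_ac)
  qed
  also have "\<dots> = Y * f * (1 + \<bar>\<epsilon>\<bar> * (s / dd T c') + \<epsilon>\<^sup>2)" by (simp add: algebra_simps)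
  also have "\<dots> \<le> Y * f * (sqm b T)\<^sup>2"
    using sqm_ge[OF b c'1 D T] Y f by (intro mult_left_mono) (auto simp: s_def c'2)
  finally have "norm v \<le> sqrt (Y * f * (sqm b T)\<^sup>2)" by (rule real_le_rsqrt)
  also have "\<dots> = sqrt (Y * f) * sqm b T" using sqm_pos[OF b(1), of T] by (simp add: real_sqrt_mult)
  finally have nv: "norm v \<le> sqrt (Y * f) * sqm b T" .
  have "\<bar>v \<bullet> h\<bar> \<le> norm v * norm h" by (rule Cauchy_Schwarz_ineq2)
  also have "\<dots> \<le> sqrt (Y * f) * sqm b T * norm h" using nv by (intro mult_right_mono) auto
  finally show ?thesis unfolding vh by (simp add: f_def Y_def G_def \<mu>_def)
qed

lemma chain_rule_inner:
  fixes T D c Y a w :: real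
  assumes "T \<noteq> 0" "D \<noteq> 0" "Y = 2 * T * (c - (T - D))"
  shows "a - ((T - c) * a - T * w) / D = (T / D) * w + Y / (2 * D) * (a / T)"
  using assms(1,2) unfolding assms(3) by (simp add: field_simps)

lemma chain_rule_outer:
  fixes T D c Y a w :: real
  assumes "D \<noteq> 0" "Y = 2 * T * (c - (T - D))"
  shows "- (- (T * a) - ((T - c) * - (T * a) - T * - w) / D) = (T / D) * w + Y / (2 * D) * a"
  using assms(1) unfolding assms(2) by (simp add: field_simps)

text \<open>The factor \<open>sqrt (1 - C^2)\<close> in the gradient of \<open>C\<close> and the
  derivative of \<open>Upot\<close> combine to the power \<open>1/2 - pe n\<close> that occurs in
  \<open>Rf\<close>.\<close>

lemma Upot_chain_slope:
  fixes C :: "'a::real_inner \<Rightarrow> real"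
  assumes U: "2 \<le> n" "0 < I" "(\<integral>\<^sup>+y. ennreal ((1 - y\<^sup>2) powr (- pe n)) * indicator {-1<..<1} y \<partial>lborel) = ennreal I"
    and C: "(C has_derivative C') (at z)" "-1 < C z" "C z < 1"
    and bd: "\<And>h. \<bar>C' h\<bar> \<le> sqrt ((1 - (C z)\<^sup>2) * q) * m / t * norm h" and q: "0 \<le> q"
  shows "slope_le (\<lambda>z. Upot n I (C z)) z (m * ((1 / I) * (1 - (C z)\<^sup>2) powr (1/2 - pe n) * sqrt q) / t)"
proof (rule slope_le_deriv)
  let ?Y = "1 - (C z)\<^sup>2"
  have Y: "0 < ?Y" using C by (simp add: abs_square_less_1 abs_less_iff)
  let ?d = "- (1 / I) * ?Y powr (- pe n)"
  show "((\<lambda>z. Upot n I (C z)) has_derivative (\<lambda>h. C' h * ?d)) (at z)"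
    by (rule DERIV_compose_FDERIV[OF Upot_deriv[OF U C(2,3)] C(1)])
  fix h
  have "\<bar>C' h * ?d\<bar> = \<bar>C' h\<bar> * ((1 / I) * ?Y powr (- pe n))" using U(2) by (simp add: abs_mult)
  also have "\<dots> \<le> (sqrt (?Y * q) * m / t * norm h) * ((1 / I) * ?Y powr (- pe n))"
    using bd[of h] U(2) by (intro mult_right_mono) auto
  also have "\<dots> = m * ((1 / I) * (sqrt ?Y * ?Y powr (- pe n)) * sqrt q) / t * norm h"
    by (simp add: real_sqrt_mult mult_ac)
  also have "sqrt ?Y * ?Y powr (- pe n) = ?Y powr (1/2 - pe n)"
    using Y powr_add[of ?Y "1/2" "- pe n"] by (simp add: powr_half_sqrt)
  finally show "\<bar>C' h * ?d\<bar> \<le> m * ((1 / I) * ?Y powr (1/2 - pe n) * sqrt q) / t * norm h" .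
qed

section \<open>Inner and outer potential around the rotating axis\<close>

text \<open>In the application \<open>x\<close> is moved to the origin, \<open>y\<close> to
  \<open>e0\<close>, and the boundary point has norm \<open>M\<close>. The parameter
  \<open>b\<close> bounds the speed of rotation, \<open>k\<close> is the logarithmic thickness of
  the shell in which the potentials are glued, and \<open>osc\<close> makes them differ by less than
  \<open>\<delta>\<close> at its outer rim.\<close>

locale rotating_potential =
  fixes e0 e1 :: "'a::euclidean_space" and \<epsilon> b M \<delta> k I :: real
  assumes o: "norm e0 = 1" "norm e1 = 1" "e0 \<bullet> e1 = 0" and n: "2 \<le> DIM('a)"
    and I: "0 < I" and hI: "(\<integral>\<^sup>+y. ennreal ((1 - y\<^sup>2) powr (- pe DIM('a))) * indicator {-1<..<1} y \<partial>lborel) = ennreal I"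
    and b: "0 < b" "b \<le> 1" "\<bar>\<epsilon>\<bar> \<le> b" and M: "1 < M" and k: "0 < k" "k \<le> ln M / 2" and \<delta>: "0 < \<delta>"
    and osc: "\<And>y y'. y \<in> {-1..1} \<Longrightarrow> y' \<in> {-1..1} \<Longrightarrow> \<bar>y - y'\<bar> \<le> (1 + exp k) / (2 * sqrt M) \<Longrightarrow>
      \<bar>Upot DIM('a) I y - Upot DIM('a) I y'\<bar> < \<delta>"
begin

abbreviation "cz \<equiv> co e0 e1 \<epsilon>"

text \<open>\<open>C1\<close> has its foci at the origin and at radius 1 on the axis.
  \<open>C2\<close> arises by inversion in the sphere of radius \<open>sqrt M\<close> and reversal
  of the axis, which puts the second focus at radius \<open>M\<close> on the negative axis; the
  outer minus sign restores -1 on the curve from the origin and 1 on the one to infinity.\<close>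

definition C1 :: "'a \<Rightarrow> real" where "C1 z = cc (norm z) (cz z)"
definition C2 :: "'a \<Rightarrow> real" where "C2 z = - cc (M / norm z) (- cz z)"

lemma cz_le: "\<bar>cz z\<bar> \<le> 1" "\<bar>- cz z\<bar> \<le> 1"
  using abs_co_le[OF o] by auto

lemma M_div: "z \<noteq> 0 \<Longrightarrow> 0 < M / norm z" using M by simp

text \<open>Both coordinates approximate the cosine \<open>cz\<close>, from opposite sides; the two
  error terms balance at the radius \<open>sqrt M\<close>, hence the gluing there.\<close>

lemma C_range:
  assumes "z \<noteq> 0"
  shows "C1 z \<in> {-1..1}" "C2 z \<in> {-1..1}" "C1 z \<le> cz z" "cz z \<le> C2 z"
    "C2 z - C1 z \<le> 1 / (2 * norm z) + norm z / (2 * M)"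
proof -
  have t: "0 < norm z" using assms by simp
  note a = cc_bounds[OF cz_le(1) t] cc_le[OF cz_le(1) t]
  note b = cc_bounds[OF cz_le(2) M_div[OF assms]] cc_le[OF cz_le(2) M_div[OF assms]]
  show "C1 z \<in> {-1..1}" "C1 z \<le> cz z" using a(1,2,4)[of z] by (auto simp: C1_def)
  show "C2 z \<in> {-1..1}" "cz z \<le> C2 z" using b(1,2,4)[of z] by (auto simp: C2_def)
  show "C2 z - C1 z \<le> 1 / (2 * norm z) + norm z / (2 * M)"
    using a(5)[of z] b(5)[of z] by (simp add: C1_def C2_def)
qed

lemma U_facts:
  "Upot DIM('a) I (-1) = 1" "Upot DIM('a) I 1 = 0" "continuous_on {-1..1} (Upot DIM('a) I)"
  "-1 \<le> y \<Longrightarrow> y \<le> y' \<Longrightarrow> y' \<le> 1 \<Longrightarrow> Upot DIM('a) I y' \<le> Upot DIM('a) I y"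
  "y \<in> {-1..1} \<Longrightarrow> 0 \<le> Upot DIM('a) I y \<and> Upot DIM('a) I y \<le> 1"
  using Upot_ends[OF n I hI] Upot_continuous[OF n I hI] Upot_mono[OF n I hI] Upot_range[OF n I hI] by auto

abbreviation "P1 z \<equiv> sqm b (norm z) * Rf DIM('a) I (norm z) (cz z)"
abbreviation "P2 z \<equiv> sqm b (M / norm z) * Rf DIM('a) I (M / norm z) (- cz z)"

lemma dd_pos:
  assumes "\<bar>c\<bar> \<le> 1" "0 < T" "cc T c < 1" shows "0 < dd T c"
proof (rule ccontr)
  assume "\<not> 0 < dd T c"
  then have "dd T c = 0" using dd_nonneg[OF assms(1), of T] by linarith
  then show False using dd_bounds(1)[OF assms(1,2)] assms(3) by (simp add: cc_def)
qed

lemma deriv_aux: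
  assumes z: "z \<noteq> 0" and c': "c' = cz z \<or> c' = - cz z" and D: "0 < dd T c'" and T: "0 < T"
  defines "E \<equiv> rot_axis e0 e1 \<epsilon> (ln (norm z))" and "E' \<equiv> rot_axis' e0 e1 \<epsilon> (ln (norm z))"
  shows "\<bar>(T / dd T c') * ((E \<bullet> h - cz z * (z \<bullet> h) / norm z + \<epsilon> * (z \<bullet> E' / norm z) * ((z \<bullet> h) / norm z)) / norm z) +
      (1 - (cc T c')\<^sup>2) / (2 * dd T c') * ((z \<bullet> h) / norm z / norm z)\<bar>
    \<le> sqrt ((1 - (cc T c')\<^sup>2) * (T / dd T c')) * sqm b T / norm z * norm h"
proof -
  let ?zh = "(1 / norm z) *\<^sub>R z"
  have zh: "norm ?zh = 1" using z by simp
  have "\<bar>(T / dd T c') * (E \<bullet> h - cz z * (?zh \<bullet> h) + \<epsilon> * (?zh \<bullet> E') * (?zh \<bullet> h)) + (1 - (cc T c')\<^sup>2) / (2 * dd T c') * (?zh \<bullet> h)\<bar>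
    \<le> sqrt ((1 - (cc T c')\<^sup>2) * (T / dd T c')) * sqm b T * norm h"
  proof (rule gradient_bound[OF zh _ _ _ T _ c' D b])
    show "E \<bullet> E = 1" "E' \<bullet> E' = 1" "E \<bullet> E' = 0" unfolding E_def E'_def using rot_axis_orthonormal[OF o] by auto
    show "cz z = ?zh \<bullet> E" by (simp add: co_def E_def)
  qed
  moreover have "E \<bullet> h - cz z * (?zh \<bullet> h) + \<epsilon> * (?zh \<bullet> E') * (?zh \<bullet> h) =
      E \<bullet> h - cz z * (z \<bullet> h) / norm z + \<epsilon> * (z \<bullet> E' / norm z) * ((z \<bullet> h) / norm z)"
    by simp
  moreover have "?zh \<bullet> h = (z \<bullet> h) / norm z" by simp
  moreover have "\<bar>f * (A / t) + G * (q / t)\<bar> \<le> R / t * N" if "\<bar>f * A + G * q\<bar> \<le> R * N" "0 < t" for f A G q R N t :: real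
  proof -
    have "f * (A / t) + G * (q / t) = (f * A + G * q) / t" by (simp add: add_divide_distrib)
    then show ?thesis using that by (simp add: abs_divide divide_right_mono)
  qed
  ultimately show ?thesis using z by (metis zero_less_norm_iff)
qed

lemma slope_G1:
  assumes z: "z \<noteq> 0" and C: "-1 < C1 z" "C1 z < 1"
  shows "slope_le (\<lambda>z. Upot DIM('a) I (C1 z)) z (P1 z / norm z)"
proof -
  let ?T = "norm z" let ?c = "cz z" let ?D = "dd ?T ?c"
  have t: "0 < ?T" using z by simp
  have D: "0 < ?D" using dd_pos[OF cz_le(1) t] C by (simp add: C1_def)
  define co' where "co' = (\<lambda>h. (rot_axis e0 e1 \<epsilon> (ln (norm z)) \<bullet> h - cz z * (z \<bullet> h) / norm z +
      \<epsilon> * (z \<bullet> rot_axis' e0 e1 \<epsilon> (ln (norm z)) / norm z) * ((z \<bullet> h) / norm z)) / norm z)"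
  have cd: "(cz has_derivative co') (at z)" unfolding co'_def by (rule co_has_derivative[OF z])
  have der: "(C1 has_derivative (\<lambda>h. (z \<bullet> h) / ?T - ((?T - ?c) * ((z \<bullet> h) / ?T) - ?T * co' h) / ?D)) (at z)"
    unfolding C1_def by (rule cc_has_derivative[OF norm_has_derivative[OF z] cd D])
  have key: "(z \<bullet> h) / ?T - ((?T - ?c) * ((z \<bullet> h) / ?T) - ?T * co' h) / ?D =
     (?T / ?D) * co' h + (1 - (cc ?T ?c)\<^sup>2) / (2 * ?D) * ((z \<bullet> h) / ?T / ?T)" for h
  proof -
    show ?thesis
      using t D one_minus_cc_sq[OF cz_le(1), of ?T z] by (intro chain_rule_inner) (auto simp: cc_def)
  qed
  have "slope_le (\<lambda>z. Upot DIM('a) I (C1 z)) z (sqm b ?T * ((1 / I) * (1 - (C1 z)\<^sup>2) powr (1/2 - pe DIM('a)) * sqrt (?T / ?D)) / ?T)"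
  proof (rule Upot_chain_slope[OF n I hI der C])
    show "\<bar>(z \<bullet> h) / ?T - ((?T - ?c) * ((z \<bullet> h) / ?T) - ?T * co' h) / ?D\<bar> \<le> sqrt ((1 - (C1 z)\<^sup>2) * (?T / ?D)) * sqm b ?T / ?T * norm h" for h
      unfolding key unfolding C1_def co'_def by (rule deriv_aux[OF z disjI1[OF refl] D t])
  qed (use t D in auto)
  then show ?thesis by (simp add: Rf_def C1_def)
qed

lemma slope_G2:
  assumes z: "z \<noteq> 0" and C: "-1 < C2 z" "C2 z < 1"
  shows "slope_le (\<lambda>z. Upot DIM('a) I (C2 z)) z (P2 z / norm z)"
proof -
  let ?T = "M / norm z" let ?c = "- cz z" let ?D = "dd ?T ?c"
  have t: "0 < norm z" using z by simp
  have T: "0 < ?T" using M_div[OF z] .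
  have D: "0 < ?D" using dd_pos[OF cz_le(2) T] C by (simp add: C2_def)
  define co' where "co' = (\<lambda>h. (rot_axis e0 e1 \<epsilon> (ln (norm z)) \<bullet> h - cz z * (z \<bullet> h) / norm z +
      \<epsilon> * (z \<bullet> rot_axis' e0 e1 \<epsilon> (ln (norm z)) / norm z) * ((z \<bullet> h) / norm z)) / norm z)"
  have cd: "(cz has_derivative co') (at z)" unfolding co'_def by (rule co_has_derivative[OF z])
  have Td: "((\<lambda>z. M / norm z) has_derivative (\<lambda>h. - (?T * ((z \<bullet> h) / norm z / norm z)))) (at z)"
    by (rule has_derivative_eq_rhs[OF has_derivative_divide'[OF has_derivative_const norm_has_derivative[OF z]]])
       (use z in \<open>auto simp: fun_eq_iff\<close>)
  have der: "(C2 has_derivative (\<lambda>h. - (- (?T * ((z \<bullet> h) / norm z / norm z)) - ((?T - ?c) * - (?T * ((z \<bullet> h) / norm z / norm z)) - ?T * - co' h) / ?D))) (at z)"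
    unfolding C2_def by (rule has_derivative_minus[OF cc_has_derivative[OF Td has_derivative_minus[OF cd] D]])
  have key: "- (- (?T * ((z \<bullet> h) / norm z / norm z)) - ((?T - ?c) * - (?T * ((z \<bullet> h) / norm z / norm z)) - ?T * - co' h) / ?D) =
     (?T / ?D) * co' h + (1 - (cc ?T ?c)\<^sup>2) / (2 * ?D) * ((z \<bullet> h) / norm z / norm z)" for h
  proof -
    show ?thesis
      using D one_minus_cc_sq[OF cz_le(2), of ?T z] by (intro chain_rule_outer) (auto simp: cc_def)
  qed
  have sq: "(C2 z)\<^sup>2 = (cc ?T ?c)\<^sup>2" by (simp add: C2_def)
  have "slope_le (\<lambda>z. Upot DIM('a) I (C2 z)) z (sqm b ?T * ((1 / I) * (1 - (C2 z)\<^sup>2) powr (1/2 - pe DIM('a)) * sqrt (?T / ?D)) / norm z)"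
  proof (rule Upot_chain_slope[OF n I hI der C])
    show "\<bar>- (- (?T * ((z \<bullet> h) / norm z / norm z)) - ((?T - ?c) * - (?T * ((z \<bullet> h) / norm z / norm z)) - ?T * - co' h) / ?D)\<bar> \<le>
        sqrt ((1 - (C2 z)\<^sup>2) * (?T / ?D)) * sqm b ?T / norm z * norm h" for h
      unfolding key sq unfolding co'_def by (rule deriv_aux[OF z disjI2[OF refl] D T])
  qed (rule less_imp_le[OF divide_pos_pos[OF T D]])
  then show ?thesis by (simp add: Rf_def sq)
qed

end

section \<open>Gluing the two potentials\<close>

context rotating_potential
begin

definition rim :: real where "rim = sqrt M * exp k"
definition eta :: "'a \<Rightarrow> real" where "eta z = max 0 (\<delta> / k * (ln (norm z) - ln M / 2))"
text \<open>Lowering the inner potential by the oscillation bound \<open>\<delta>\<close> while the radius grows by the factor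
  \<open>exp k\<close> makes the maximum pass continuously from the inner to the outer potential.\<close>

definition V1 :: "'a \<Rightarrow> real" where "V1 z = max (Upot DIM('a) I (C2 z)) (Upot DIM('a) I (C1 z) - eta z)"
definition upot :: "'a \<Rightarrow> real" where
  "upot z = (if z = 0 then 1 else if norm z \<le> rim then V1 z else Upot DIM('a) I (C2 z))"
text \<open>Inside the radius \<open>sqrt M\<close> the inner potential is the larger one, and
  beyond \<open>rim\<close> only the outer one is left; so both slopes, and the slope
  \<open>\<delta> / k\<close> of the lowering term, matter only in the shell between.\<close>

definition rho :: "'a \<Rightarrow> real" where
  "rho z = max (if norm z \<le> rim then P1 z + (if sqrt M \<le> norm z then \<delta> / k else 0) else 0)
       (if sqrt M \<le> norm z then P2 z else 0) / norm z"

lemma sqrtM: "1 < sqrt M" "ln (sqrt M) = ln M / 2" "sqrt M < rim" "rim \<le> M" "0 < rim"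
proof -
  show s: "1 < sqrt M" using M by simp
  show l: "ln (sqrt M) = ln M / 2" using M by (simp add: ln_sqrt)
  show r: "sqrt M < rim" using s k by (simp add: rim_def)
  then show "0 < rim" using s by linarith
  have "exp k \<le> exp (ln (sqrt M))" using k l by simp
  moreover have "exp (ln (sqrt M)) = sqrt M" by (rule exp_ln) (use s in linarith)
  ultimately have "exp k \<le> sqrt M" by simp
  then have "rim \<le> sqrt M * sqrt M" unfolding rim_def using s by (intro mult_left_mono) auto
  then show "rim \<le> M" using M by simp
qed

lemma eta_nonneg: "0 \<le> eta z" by (simp add: eta_def)

lemma eta_inner: "z \<noteq> 0 \<Longrightarrow> norm z \<le> sqrt M \<Longrightarrow> eta z = 0"
proof -
  assume z: "z \<noteq> 0" "norm z \<le> sqrt M"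
  then have "ln (norm z) \<le> ln (sqrt M)" using sqrtM by simp
  then have "\<delta> / k * (ln (norm z) - ln M / 2) \<le> 0" using sqrtM(2) \<delta> k by (intro mult_nonneg_nonpos) auto
  then show ?thesis by (simp add: eta_def)
qed

lemma upot_inner: "norm z < sqrt M \<Longrightarrow> upot z = Upot DIM('a) I (C1 z)"
proof (cases "z = 0")
  case True
  have "C1 z = -1" using True by (simp add: C1_def cc_def dd_def co_def)
  then show ?thesis using True U_facts(1) by (simp add: upot_def)
next
  case False
  assume "norm z < sqrt M"
  moreover from this have "norm z \<le> rim" using sqrtM by linarith
  moreover have "Upot DIM('a) I (C2 z) \<le> Upot DIM('a) I (C1 z)"
    using C_range[OF False] by (intro U_facts(4)) auto
  ultimately show ?thesis using False eta_inner[OF False] by (simp add: upot_def V1_def)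
qed

text \<open>At the rim the lowering has reached \<open>\<delta>\<close>, more than the potentials
  differ there. The strict inequality persists nearby, so the switch from \<open>V1\<close> to the
  outer potential is invisible locally.\<close>

lemma at_rim: "norm z = rim \<Longrightarrow> Upot DIM('a) I (C1 z) - eta z < Upot DIM('a) I (C2 z)"
proof -
  assume z: "norm z = rim"
  then have z0: "z \<noteq> 0" using sqrtM by auto
  have e: "eta z = \<delta>"
  proof -
    have "ln (norm z) = ln M / 2 + k" unfolding z rim_def using sqrtM(1,2) by (subst ln_mult) auto
    then show ?thesis using \<delta> k by (simp add: eta_def)
  qed
  have "1 / (2 * rim) + rim / (2 * M) \<le> (1 + exp k) / (2 * sqrt M)"
  proof -
    have "1 / (2 * rim) \<le> 1 / (2 * sqrt M)" using sqrtM by (intro divide_left_mono) auto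
    moreover have "rim / (2 * M) = exp k / (2 * sqrt M)"
      using M by (simp add: rim_def field_simps)
    ultimately show ?thesis by (simp add: add_divide_distrib)
  qed
  then have "C2 z - C1 z \<le> (1 + exp k) / (2 * sqrt M)" using C_range(5)[OF z0] z by simp
  then have "\<bar>C1 z - C2 z\<bar> \<le> (1 + exp k) / (2 * sqrt M)" using C_range(3,4)[OF z0] by simp
  then have "\<bar>Upot DIM('a) I (C1 z) - Upot DIM('a) I (C2 z)\<bar> < \<delta>"
    using C_range[OF z0] by (intro osc)
  then show ?thesis using e by linarith
qed

lemma isCont_cz: "z \<noteq> 0 \<Longrightarrow> isCont cz z"
  by (rule has_derivative_continuous[OF co_has_derivative])

text \<open>At the origin the cosine \<open>cz\<close> need not have a limit; there the lower bound
  for \<open>dd\<close> alone forces the value -1.\<close>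

lemma isCont_C1: "isCont C1 z"
proof (cases "z = 0")
  case True
  have C10: "C1 0 = -1" by (simp add: C1_def cc_def dd_def co_def)
  have "\<bar>C1 q - C1 0\<bar> \<le> 2 * norm q" for q
  proof (cases "q = 0")
    case False
    then show ?thesis
      using C_range(1)[OF False] dd_bounds(1)[OF cz_le(1), of "norm q" q] by (auto simp: C10) (auto simp: C1_def cc_def)
  qed (simp add: C10)
  note bd = this
  have "(C1 \<longlongrightarrow> C1 0) (at 0)"
  proof (rule LIM_I)
    fix r :: real assume "0 < r"
    then show "\<exists>s>0. \<forall>x. x \<noteq> 0 \<and> norm (x - 0) < s \<longrightarrow> norm (C1 x - C1 0) < r"
      using le_less_trans[OF bd] by (intro exI[of _ "r / 2"]) auto
  qed
  then show ?thesis using True by (simp add: isCont_def)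
next
  case False
  have *: "C1 = (\<lambda>z. norm z - sqrt ((norm z)\<^sup>2 + 1 - 2 * norm z * cz z))"
    by (auto simp: C1_def cc_def dd_def)
  show ?thesis unfolding * using isCont_cz[OF False] by (intro continuous_intros)
qed

lemma isCont_C2: "z \<noteq> 0 \<Longrightarrow> isCont C2 z"
proof -
  assume z: "z \<noteq> 0"
  have *: "C2 = (\<lambda>z. - (M / norm z - sqrt ((M / norm z)\<^sup>2 + 1 - 2 * (M / norm z) * - cz z)))"
    by (auto simp: C2_def cc_def dd_def)
  show ?thesis unfolding * using isCont_cz[OF z] z by (intro continuous_intros) auto
qed

lemma isCont_UC1: "isCont (\<lambda>z. Upot DIM('a) I (C1 z)) z"
proof -
  have "C1 z \<in> {-1..1}" for z
    using C_range(1)[of z] by (cases "z = 0") (auto simp: C1_def cc_def dd_def co_def)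
  then have "continuous_on UNIV (\<lambda>z. Upot DIM('a) I (C1 z))"
    using isCont_C1 by (intro continuous_on_compose2[OF U_facts(3)] continuous_at_imp_continuous_on) auto
  then show ?thesis by (simp add: continuous_on_eq_continuous_at)
qed

lemma isCont_UC2: assumes "z \<noteq> 0" shows "isCont (\<lambda>z. Upot DIM('a) I (C2 z)) z"
proof -
  have "continuous_on (-{0}) (\<lambda>z. Upot DIM('a) I (C2 z))"
  proof (rule continuous_on_compose2[OF U_facts(3)])
    show "continuous_on (-{0}) C2" using isCont_C2 by (intro continuous_at_imp_continuous_on) auto
    show "C2 ` (-{0}) \<subseteq> {-1..1}" using C_range(2) by blast
  qed
  then show ?thesis using assms by (subst (asm) continuous_on_eq_continuous_at) auto
qed

lemma isCont_eta: "z \<noteq> 0 \<Longrightarrow> isCont eta z"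
  unfolding eta_def[abs_def] by (intro continuous_intros) auto

lemma ev_inner: "norm z < sqrt M \<Longrightarrow> \<forall>\<^sub>F q in nhds z. upot q = Upot DIM('a) I (C1 q)"
  using upot_inner eventually_nhds_in_open[of "ball 0 (sqrt M)" z]
  by (auto elim!: eventually_mono)

lemma ev_middle: "z \<noteq> 0 \<Longrightarrow> norm z < rim \<Longrightarrow> \<forall>\<^sub>F q in nhds z. upot q = V1 q"
proof -
  assume "z \<noteq> 0" "norm z < rim"
  then have "\<forall>\<^sub>F q in nhds z. q \<in> ball 0 rim - {0}" by (intro eventually_nhds_in_open open_Diff) auto
  then show ?thesis by eventually_elim (auto simp: upot_def)
qed

lemma ev_outer:
  assumes "rim \<le> norm z"
  shows "\<forall>\<^sub>F q in nhds z. upot q = Upot DIM('a) I (C2 q)"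
proof (cases "norm z = rim")
  case True
  then have z: "z \<noteq> 0" using sqrtM by auto
  define g where "g = (\<lambda>q. Upot DIM('a) I (C2 q) - (Upot DIM('a) I (C1 q) - eta q))"
  have "isCont g z"
    unfolding g_def using isCont_UC1 isCont_UC2[OF z] isCont_eta[OF z] by (intro continuous_intros)
  then have "(g \<longlongrightarrow> g z) (nhds z)" by (simp only: isCont_def tendsto_at_iff_tendsto_nhds)
  moreover have "0 < g z" using at_rim[OF True] by (simp add: g_def)
  ultimately have "\<forall>\<^sub>F q in nhds z. 0 < g q" by (rule order_tendstoD(1))
  moreover have "\<forall>\<^sub>F q in nhds z. q \<in> -{0}" using z by (intro eventually_nhds_in_open) auto
  ultimately show ?thesis by eventually_elim (auto simp: upot_def V1_def g_def)
next
  case False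
  then have "\<forall>\<^sub>F q in nhds z. q \<in> - cball 0 rim" using assms by (intro eventually_nhds_in_open) auto
  then show ?thesis using sqrtM(5) by (auto elim!: eventually_mono simp: upot_def)
qed

lemma upot_continuous: "continuous_on UNIV upot"
proof (rule continuous_at_imp_continuous_on, rule ballI)
  fix z :: 'a
  consider "norm z < sqrt M" | "z \<noteq> 0" "norm z < rim" | "rim \<le> norm z" using sqrtM by fastforce
  then show "isCont upot z"
  proof cases
    case 1 then show ?thesis using isCont_cong[OF ev_inner] isCont_UC1 by blast
  next
    case 2
    have "isCont V1 z" unfolding V1_def[abs_def]
      using isCont_UC1 isCont_UC2 isCont_eta 2 by (intro continuous_intros) auto
    then show ?thesis using isCont_cong[OF ev_middle] 2 by blast
  next
    case 3
    then have "z \<noteq> 0" using sqrtM(5) by auto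
    then show ?thesis using isCont_cong[OF ev_outer[OF 3]] isCont_UC2 by blast
  qed
qed

lemma C2_end: "z \<noteq> 0 \<Longrightarrow> norm z \<le> M \<Longrightarrow> cz z = -1 \<Longrightarrow> C2 z = -1" "z \<noteq> 0 \<Longrightarrow> cz z = 1 \<Longrightarrow> C2 z = 1"
  using cc_end M_div by (auto simp: C2_def)

lemma upot_one: "z = 0 \<or> (norm z \<le> M \<and> cz z = -1) \<Longrightarrow> upot z = 1"
proof (cases "z = 0")
  case False
  assume "z = 0 \<or> (norm z \<le> M \<and> cz z = -1)"
  then have "C2 z = -1" using C2_end False by auto
  moreover have "Upot DIM('a) I (C1 z) - eta z \<le> 1"
    using U_facts(5)[OF C_range(1)[OF False]] eta_nonneg[of z] by linarith
  ultimately show ?thesis using False U_facts(1) by (auto simp: upot_def V1_def)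
qed (simp add: upot_def)

lemma upot_zero: assumes "1 \<le> norm z" "cz z = 1" shows "upot z = 0"
proof -
  have z: "z \<noteq> 0" using assms by auto
  have "C1 z = 1" "C2 z = 1" using assms z C2_end(2) cc_end(2) by (auto simp: C1_def)
  then show ?thesis using z U_facts(2) eta_nonneg[of z] by (auto simp: upot_def V1_def)
qed

lemma slope_eta: "z \<noteq> 0 \<Longrightarrow> slope_le eta z (\<delta> / k / norm z)"
  unfolding eta_def[abs_def]
proof (rule slope_le_max)
  assume z: "z \<noteq> 0"
  show "slope_le (\<lambda>z. 0) z (\<delta> / k / norm z)"
    using \<delta> k by (intro slope_le_deriv[OF has_derivative_const]) auto
  show "slope_le (\<lambda>z. \<delta> / k * (ln (norm z) - ln M / 2)) z (\<delta> / k / norm z)"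
  proof (rule slope_le_deriv)
    have t: "0 < norm z" using z by simp
    have "((\<lambda>z. ln (norm z)) has_derivative (\<lambda>h. (z \<bullet> h) / norm z * (1 / norm z))) (at z)"
      by (rule DERIV_compose_FDERIV[OF DERIV_ln_divide[OF t] norm_has_derivative[OF z]])
    from has_derivative_mult_right[OF has_derivative_diff[OF this has_derivative_const], of "\<delta> / k" "ln M / 2"]
    show "((\<lambda>z. \<delta> / k * (ln (norm z) - ln M / 2)) has_derivative (\<lambda>h. \<delta> / k * ((z \<bullet> h) / norm z * (1 / norm z) - 0))) (at z)" .
    fix h
    have "\<bar>z \<bullet> h\<bar> / norm z \<le> norm h" using Cauchy_Schwarz_ineq2[of z h] t by (simp add: divide_le_eq mult.commute)
    then have "\<delta> / k / norm z * (\<bar>z \<bullet> h\<bar> / norm z) \<le> \<delta> / k / norm z * norm h"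
      using \<delta> k t by (intro mult_left_mono) auto
    then show "\<bar>\<delta> / k * ((z \<bullet> h) / norm z * (1 / norm z) - 0)\<bar> \<le> \<delta> / k / norm z * norm h"
      using \<delta> k t by (simp add: abs_mult abs_divide)
  qed
qed

lemma P_nonneg: "z \<noteq> 0 \<Longrightarrow> 0 \<le> P1 z" "z \<noteq> 0 \<Longrightarrow> 0 \<le> P2 z"
  using Rf_nonneg[OF I _ cz_le(1)] Rf_nonneg[OF I M_div cz_le(2)]
  by (auto intro!: mult_nonneg_nonneg less_imp_le[OF sqm_pos[OF b(1)]])

lemma rho_nonneg: "0 \<le> rho z"
  using P_nonneg[of z] \<delta> k by (cases "z = 0") (auto simp: rho_def le_max_iff_disj)

lemma upot_slope:
  assumes u: "0 < upot z" "upot z < 1"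
  shows "slope_le upot z (rho z)"
proof -
  have z: "z \<noteq> 0" using u by (auto simp: upot_def)
  then have t: "0 < norm z" by simp
  consider "norm z < sqrt M" | "sqrt M \<le> norm z" "norm z < rim" | "rim \<le> norm z" by linarith
  then show ?thesis
  proof cases
    case 1
    have "C1 z \<noteq> -1" "C1 z \<noteq> 1" using u upot_inner[OF 1] U_facts(1,2) by auto
    then have "slope_le (\<lambda>z. Upot DIM('a) I (C1 z)) z (P1 z / norm z)"
      using C_range(1)[OF z] by (intro slope_G1[OF z]) auto
    moreover have "P1 z / norm z \<le> rho z" using 1 sqrtM t by (auto simp: rho_def intro!: divide_right_mono)
    ultimately show ?thesis using slope_le_cong[OF ev_inner[OF 1]] slope_le_mono by blast
  next
    case 2
    have uV: "upot z = V1 z" using 2 z by (simp add: upot_def)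
    \<comment> \<open>On the axis the potential is 1 or 0 in this shell, so \<open>z\<close> lies
      off the axis, where both coordinates are strictly between -1 and 1 and \<open>Upot\<close> is
      differentiable.\<close>
    have "cz z \<noteq> 1" using upot_zero[of z] u 2 sqrtM by auto
    moreover have "cz z \<noteq> -1" using upot_one[of z] u 2 sqrtM by auto
    ultimately have c: "\<bar>cz z\<bar> < 1" "\<bar>- cz z\<bar> < 1" using cz_le[of z] by auto
    have s1: "slope_le (\<lambda>z. Upot DIM('a) I (C1 z)) z (P1 z / norm z)"
      using cc_strict(1,2)[OF c(1) t] by (intro slope_G1[OF z]) (auto simp: C1_def)
    have s2: "slope_le (\<lambda>z. Upot DIM('a) I (C2 z)) z (P2 z / norm z)"
      using cc_strict(1,2)[OF c(2) M_div[OF z]] by (intro slope_G2[OF z]) (auto simp: C2_def)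
    have s3: "slope_le (\<lambda>z. Upot DIM('a) I (C1 z) - eta z) z (P1 z / norm z + \<delta> / k / norm z)"
      by (rule slope_le_diff[OF s1 slope_eta[OF z]])
    have "(P1 z + \<delta> / k) / norm z \<le> rho z" "P2 z / norm z \<le> rho z"
      using 2 t by (auto simp: rho_def intro!: divide_right_mono)
    then have "P2 z / norm z \<le> rho z" "P1 z / norm z + \<delta> / k / norm z \<le> rho z"
      by (simp_all only: add_divide_distrib)
    then have "slope_le V1 z (rho z)"
      unfolding V1_def[abs_def] by (intro slope_le_max slope_le_mono[OF s2] slope_le_mono[OF s3])
    then show ?thesis using slope_le_cong[OF ev_middle[OF z 2(2)]] by blast
  next
    case 3
    have "upot z = Upot DIM('a) I (C2 z)" using ev_outer[OF 3] by (rule eventually_nhds_x_imp_x)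
    then have "C2 z \<noteq> -1" "C2 z \<noteq> 1" using u U_facts(1,2) by auto
    then have "slope_le (\<lambda>z. Upot DIM('a) I (C2 z)) z (P2 z / norm z)"
      using C_range(2)[OF z] by (intro slope_G2[OF z]) auto
    moreover have "P2 z / norm z \<le> rho z" using 3 sqrtM t by (auto simp: rho_def intro!: divide_right_mono)
    ultimately show ?thesis using slope_le_cong[OF ev_outer[OF 3]] slope_le_mono by blast
  qed
qed

end

section \<open>Energy of the glued potential\<close>

context rotating_potential
begin

text \<open>The radius times \<open>rho\<close>, in terms of the logarithm \<open>\<xi>\<close> of
  the radius and the cosine \<open>c\<close> of the angle to the axis belonging to that
  radius.\<close>

definition phi :: "real \<Rightarrow> real \<Rightarrow> real" where
  "phi \<xi> c = max (if \<xi> \<le> ln M / 2 + k then sqm b (exp \<xi>) * Rf DIM('a) I (exp \<xi>) c + (if ln M / 2 \<le> \<xi> then \<delta> / k else 0) else 0)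
     (if ln M / 2 \<le> \<xi> then sqm b (exp (ln M - \<xi>)) * Rf DIM('a) I (exp (ln M - \<xi>)) (- c) else 0)"

lemma sqm_measurable [measurable]: "sqm b \<in> borel_measurable borel"
  unfolding sqm_def by measurable

lemma phi_measurable [measurable]: "(\<lambda>(\<xi>, c). phi \<xi> c) \<in> borel_measurable (borel \<Otimes>\<^sub>M borel)"
  unfolding phi_def by measurable

lemma rot_axis_measurable [measurable]: "rot_axis e0 e1 \<epsilon> \<in> borel_measurable borel"
  unfolding rot_axis_def by measurable

lemma rho_eq_phi:
  assumes "z \<noteq> 0"
  shows "rho z = phi (ln (norm z)) (sgn z \<bullet> rot_axis e0 e1 \<epsilon> (ln (norm z))) / norm z"
proof -
  have t: "0 < norm z" using assms by simp
  have 1: "exp (ln (norm z)) = norm z" "exp (ln M - ln (norm z)) = M / norm z"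
    using t M by (auto simp: exp_diff)
  have c: "sgn z \<bullet> rot_axis e0 e1 \<epsilon> (ln (norm z)) = cz z"
    by (simp add: co_def sgn_div_norm inverse_eq_divide)
  have 2: "sqrt M \<le> norm z \<longleftrightarrow> ln M / 2 \<le> ln (norm z)"
    unfolding sqrtM(2)[symmetric] using t sqrtM by (subst ln_le_cancel_iff) auto
  have "ln rim = ln M / 2 + k" unfolding rim_def using sqrtM(1,2) by (subst ln_mult) auto
  then have 3: "norm z \<le> rim \<longleftrightarrow> ln (norm z) \<le> ln M / 2 + k"
    using t sqrtM(5) by (metis ln_le_cancel_iff)
  show ?thesis unfolding rho_def phi_def 1 2 3 c ..
qed

lemma phi_nonneg: "\<bar>c\<bar> \<le> 1 \<Longrightarrow> 0 \<le> phi \<xi> c"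
  unfolding phi_def using Rf_nonneg[OF I exp_gt_zero] sqm_pos[OF b(1)] \<delta> k
  by (auto simp: le_max_iff_disj intro!: add_nonneg_nonneg mult_nonneg_nonneg less_imp_le[OF sqm_pos[OF b(1)]])

lemma rho_measurable [measurable]: "rho \<in> borel_measurable borel"
proof -
  have "(\<lambda>z. if z = 0 then 0 else phi (ln (norm z)) (sgn z \<bullet> rot_axis e0 e1 \<epsilon> (ln (norm z))) / norm z) \<in> borel_measurable borel"
    by measurable
  also have "(\<lambda>z. if z = 0 then 0 else phi (ln (norm z)) (sgn z \<bullet> rot_axis e0 e1 \<epsilon> (ln (norm z))) / norm z) = rho"
    using rho_eq_phi by (auto simp: rho_def)
  finally show ?thesis .
qed

definition Q :: "real \<Rightarrow> ennreal" where
  "Q \<xi> = (\<integral>\<^sup>+s. ennreal ((1 + s\<^sup>2) powr (- real DIM('a) / 2)) * ennreal (phi \<xi> (s / sqrt (1 + s\<^sup>2)) ^ DIM('a)) \<partial>lborel)"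

lemma Q_le:
  assumes "0 \<le> \<alpha>" "0 \<le> \<beta>" "0 \<le> \<gamma>"
    and J: "(\<integral>\<^sup>+s. ennreal ((1 + s\<^sup>2) powr (- real DIM('a) / 2)) \<partial>lborel) = ennreal J"
    and le: "\<And>c. \<bar>c\<bar> < 1 \<Longrightarrow> phi \<xi> c ^ DIM('a) \<le> \<alpha> * Rf DIM('a) I (exp \<xi>) c ^ DIM('a) + \<beta> + \<gamma> * Rf DIM('a) I (exp (ln M - \<xi>)) (- c) ^ DIM('a)"
  shows "Q \<xi> \<le> ennreal \<alpha> * slice_energy DIM('a) I (exp \<xi>) + ennreal \<beta> * ennreal J + ennreal \<gamma> * slice_energy DIM('a) I (exp (ln M - \<xi>))"
proof -
  let ?n = "DIM('a)"
  let ?w = "\<lambda>s::real. ennreal ((1 + s\<^sup>2) powr (- real ?n / 2))"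
  let ?c = "\<lambda>s::real. s / sqrt (1 + s\<^sup>2)"
  let ?R1 = "\<lambda>c. Rf ?n I (exp \<xi>) c" let ?R2 = "\<lambda>c. Rf ?n I (exp (ln M - \<xi>)) c"
  have "Q \<xi> \<le> (\<integral>\<^sup>+s. ennreal \<alpha> * (?w s * ennreal (?R1 (?c s) ^ ?n)) + ennreal \<beta> * ?w s + ennreal \<gamma> * (?w s * ennreal (?R2 (- ?c s) ^ ?n)) \<partial>lborel)"
    unfolding Q_def
  proof (rule nn_integral_mono)
    fix s :: real
    have c: "\<bar>?c s\<bar> < 1" by (rule abs_cot_to_cos)
    have R: "0 \<le> ?R1 (?c s)" "0 \<le> ?R2 (- ?c s)" using Rf_nonneg[OF I exp_gt_zero] c by auto
    have "ennreal (phi \<xi> (?c s) ^ ?n) \<le> ennreal (\<alpha> * ?R1 (?c s) ^ ?n + \<beta> + \<gamma> * ?R2 (- ?c s) ^ ?n)"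
      using le[OF c] by (rule ennreal_leI)
    also have "\<dots> = ennreal \<alpha> * ennreal (?R1 (?c s) ^ ?n) + ennreal \<beta> + ennreal \<gamma> * ennreal (?R2 (- ?c s) ^ ?n)"
      using assms R by (simp add: ennreal_plus ennreal_mult)
    finally have "?w s * ennreal (phi \<xi> (?c s) ^ ?n) \<le> ?w s * (ennreal \<alpha> * ennreal (?R1 (?c s) ^ ?n) + ennreal \<beta> + ennreal \<gamma> * ennreal (?R2 (- ?c s) ^ ?n))"
      by (rule mult_left_mono) simp
    then show "?w s * ennreal (phi \<xi> (?c s) ^ ?n) \<le> ennreal \<alpha> * (?w s * ennreal (?R1 (?c s) ^ ?n)) + ennreal \<beta> * ?w s + ennreal \<gamma> * (?w s * ennreal (?R2 (- ?c s) ^ ?n))"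
      by (simp add: distrib_left mult_ac)
  qed
  also have "\<dots> = ennreal \<alpha> * (\<integral>\<^sup>+s. ?w s * ennreal (?R1 (?c s) ^ ?n) \<partial>lborel) + ennreal \<beta> * (\<integral>\<^sup>+s. ?w s \<partial>lborel) +
      ennreal \<gamma> * (\<integral>\<^sup>+s. ?w s * ennreal (?R2 (- ?c s) ^ ?n) \<partial>lborel)"
    by (subst nn_integral_add, measurable, subst nn_integral_add, measurable, simp add: nn_integral_cmult)
  also have "(\<integral>\<^sup>+s. ?w s * ennreal (?R2 (- ?c s) ^ ?n) \<partial>lborel) = slice_energy ?n I (exp (ln M - \<xi>))"
    unfolding slice_energy_def
    using nn_integral_real_reflect[of "\<lambda>s. ?w s * ennreal (?R2 (?c s) ^ ?n)" 0] by simp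
  finally show ?thesis unfolding J slice_energy_def .
qed

text \<open>On a single sphere the axis is a fixed unit vector, so \<open>sphint_axis\<close>
  applies there and the direction of the axis drops out; the only trace of the rotation is the
  factor \<open>sqm\<close>.\<close>

lemma energy_eq:
  assumes \<kappa>: "\<And>e::'a. norm e = 1 \<Longrightarrow> (\<integral>\<^sup>+w. perp_weight e w \<partial>lborel) = ennreal \<kappa>"
  shows "(\<integral>\<^sup>+z. ennreal (rho z) ^ DIM('a) \<partial>lborel) = ennreal \<kappa> * (\<integral>\<^sup>+\<xi>. Q \<xi> \<partial>lborel)"
proof -
  let ?n = "DIM('a)"
  have "(\<integral>\<^sup>+z. ennreal (rho z) ^ ?n \<partial>lborel) =
    (\<integral>\<^sup>+z. ennreal (1 / norm z ^ ?n) * ennreal (phi (ln (norm z)) (sgn z \<bullet> rot_axis e0 e1 \<epsilon> (ln (norm z))) ^ ?n) \<partial>lborel)"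
  proof (rule nn_integral_cong_AE)
    show "AE z in lborel. ennreal (rho z) ^ ?n = ennreal (1 / norm z ^ ?n) * ennreal (phi (ln (norm z)) (sgn z \<bullet> rot_axis e0 e1 \<epsilon> (ln (norm z))) ^ ?n)"
      using AE_lborel_singleton[of "0::'a"]
    proof eventually_elim
      case (elim z)
      define p where "p = phi (ln (norm z)) (sgn z \<bullet> rot_axis e0 e1 \<epsilon> (ln (norm z)))"
      have "sgn z \<bullet> rot_axis e0 e1 \<epsilon> (ln (norm z)) = cz z" by (simp add: co_def sgn_div_norm inverse_eq_divide)
      then have p: "0 \<le> p" unfolding p_def using phi_nonneg cz_le by simp
      have "ennreal (rho z) ^ ?n = ennreal ((p / norm z) ^ ?n)"
        using rho_eq_phi[OF elim] p by (simp add: p_def ennreal_power)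
      also have "\<dots> = ennreal (1 / norm z ^ ?n) * ennreal (p ^ ?n)"
        using p by (subst ennreal_mult[symmetric]) (auto simp: power_divide)
      finally show ?case unfolding p_def .
    qed
  qed
  also have "\<dots> = (\<integral>\<^sup>+\<xi>. sphint (\<lambda>q::'a. ennreal (phi \<xi> (q \<bullet> rot_axis e0 e1 \<epsilon> \<xi>) ^ ?n)) \<partial>lborel)"
    by (rule nn_integral_polar) measurable
  also have "\<dots> = (\<integral>\<^sup>+\<xi>. ennreal \<kappa> * Q \<xi> \<partial>lborel)"
  proof (rule nn_integral_cong)
    fix \<xi> :: real
    have e: "norm (rot_axis e0 e1 \<epsilon> \<xi>) = 1" by (rule rot_axis_orthonormal(4)[OF o])
    have [measurable]: "(\<lambda>c. ennreal (phi \<xi> c ^ ?n)) \<in> borel_measurable borel" by measurable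
    show "sphint (\<lambda>q::'a. ennreal (phi \<xi> (q \<bullet> rot_axis e0 e1 \<epsilon> \<xi>) ^ ?n)) = ennreal \<kappa> * Q \<xi>"
      unfolding Q_def \<kappa>[OF e, symmetric] by (rule sphint_axis[OF _ e n]) measurable
  qed
  also have "\<dots> = ennreal \<kappa> * (\<integral>\<^sup>+\<xi>. Q \<xi> \<partial>lborel)"
    unfolding Q_def by (rule nn_integral_cmult) measurable
  finally show ?thesis .
qed

text \<open>The factor \<open>m1\<close> is charged at all radii, the surplus \<open>m0 - m1\<close>
  only up to the radius \<open>1 + 1 / b\<close>, where the logarithm is merely of the order of
  \<open>ln (1 / b)\<close>.\<close>

lemma sqm_power_integral:
  defines "m0 \<equiv> sqrt (1 + 2 * b) ^ DIM('a)" and "m1 \<equiv> sqrt (1 + 2 * b\<^sup>2) ^ DIM('a)"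
  shows "(\<integral>\<^sup>+\<xi>. indicator {..X} \<xi> * (ennreal (sqm b (exp \<xi>) ^ DIM('a)) * slice_energy DIM('a) I (exp \<xi>)) \<partial>lborel) \<le>
    ennreal (1 / I ^ (DIM('a) - 1) * (m1 * ln (4 * exp X + 2) + (m0 - m1) * ln (4 * (1 + 1 / b) + 2)))"
proof -
  let ?n = "DIM('a)"
  let ?W = "\<lambda>\<xi>. slice_energy ?n I (exp \<xi>)"
  have lin: "a * (q * x) + d * (q * y) = q * (a * x + d * y)" for a d q x y :: real by (simp add: algebra_simps)
  define T0 where "T0 = 1 + 1 / b"
  have T0: "0 < T0" using b by (simp add: T0_def add_pos_pos)
  have "b\<^sup>2 \<le> b" using b by (simp add: power2_eq_square mult_left_le)
  then have m: "0 \<le> m1" "m1 \<le> m0" unfolding m0_def m1_def using b by (auto intro!: power_mono)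
  have l: "0 \<le> ln (4 * T0 + 2)" "0 \<le> ln (4 * exp X + 2)" using T0 by (auto intro!: ln_ge_zero add_increasing)
  have "(\<integral>\<^sup>+\<xi>. indicator {..X} \<xi> * (ennreal (sqm b (exp \<xi>) ^ ?n) * ?W \<xi>) \<partial>lborel) \<le>
     (\<integral>\<^sup>+\<xi>. ennreal m1 * (indicator {..X} \<xi> * ?W \<xi>) + ennreal (m0 - m1) * (indicator {..ln T0} \<xi> * ?W \<xi>) \<partial>lborel)"
  proof (rule nn_integral_mono)
    fix \<xi> :: real
    have iff: "exp \<xi> \<le> T0 \<longleftrightarrow> \<xi> \<le> ln T0" using T0 by (metis exp_le_cancel_iff exp_ln)
    have "ennreal (sqm b (exp \<xi>) ^ ?n) \<le> ennreal m1 + ennreal (m0 - m1) * indicator {..ln T0} \<xi>"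
    proof (cases "\<xi> \<le> ln T0")
      case True
      then have "sqm b (exp \<xi>) ^ ?n = m1 + (m0 - m1)" using iff by (simp add: sqm_def m0_def T0_def)
      then show ?thesis using True m by (simp add: ennreal_plus[symmetric] del: ennreal_plus)
    next
      case False
      then show ?thesis using iff by (simp add: sqm_def m1_def T0_def)
    qed
    then have "ennreal (sqm b (exp \<xi>) ^ ?n) * ?W \<xi> \<le> (ennreal m1 + ennreal (m0 - m1) * indicator {..ln T0} \<xi>) * ?W \<xi>"
      by (rule mult_right_mono) simp
    then have "indicator {..X} \<xi> * (ennreal (sqm b (exp \<xi>) ^ ?n) * ?W \<xi>) \<le> indicator {..X} \<xi> * ((ennreal m1 + ennreal (m0 - m1) * indicator {..ln T0} \<xi>) * ?W \<xi>)"
      by (rule mult_left_mono) simp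
    also have "\<dots> \<le> ennreal m1 * (indicator {..X} \<xi> * ?W \<xi>) + ennreal (m0 - m1) * (indicator {..ln T0} \<xi> * ?W \<xi>)"
      by (auto simp: indicator_def distrib_right)
    finally show "indicator {..X} \<xi> * (ennreal (sqm b (exp \<xi>) ^ ?n) * ?W \<xi>) \<le> ennreal m1 * (indicator {..X} \<xi> * ?W \<xi>) + ennreal (m0 - m1) * (indicator {..ln T0} \<xi> * ?W \<xi>)" .
  qed
  also have "\<dots> = ennreal m1 * (\<integral>\<^sup>+\<xi>. indicator {..X} \<xi> * ?W \<xi> \<partial>lborel) + ennreal (m0 - m1) * (\<integral>\<^sup>+\<xi>. indicator {..ln T0} \<xi> * ?W \<xi> \<partial>lborel)"
    by (subst nn_integral_add) (auto simp: nn_integral_cmult)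
  also have "\<dots> \<le> ennreal m1 * ennreal (1 / I ^ (?n - 1) * ln (4 * exp X + 2)) + ennreal (m0 - m1) * ennreal (1 / I ^ (?n - 1) * ln (4 * exp (ln T0) + 2))"
    by (intro add_mono mult_left_mono slice_energy_integral[OF n I hI]) auto
  also have "\<dots> = ennreal (m1 * (1 / I ^ (?n - 1) * ln (4 * exp X + 2)) + (m0 - m1) * (1 / I ^ (?n - 1) * ln (4 * T0 + 2)))"
    using m l I T0 by (simp add: ennreal_mult[symmetric] ennreal_plus[symmetric] del: ennreal_plus)
  also have "m1 * (1 / I ^ (?n - 1) * ln (4 * exp X + 2)) + (m0 - m1) * (1 / I ^ (?n - 1) * ln (4 * T0 + 2)) =
     1 / I ^ (?n - 1) * (m1 * ln (4 * exp X + 2) + (m0 - m1) * ln (4 * T0 + 2))"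
    by (rule lin)
  finally show ?thesis unfolding T0_def .
qed

text \<open>Replacing \<open>\<xi>\<close> by \<open>ln M - \<xi>\<close> turns the outer half into
  the inner one, hence twice the same term. The inner potential reaches beyond \<open>sqrt M\<close>
  into the gluing shell; this overlap and the lowering cost \<open>k\<close> times the constant in
  the last summand.\<close>

lemma energy_le:
  assumes \<kappa>: "0 < \<kappa>" "\<And>e::'a. norm e = 1 \<Longrightarrow> (\<integral>\<^sup>+w. perp_weight e w \<partial>lborel) = ennreal \<kappa>"
    and J: "0 \<le> J" "(\<integral>\<^sup>+s. ennreal ((1 + s\<^sup>2) powr (- real DIM('a) / 2)) \<partial>lborel) = ennreal J"
    and \<theta>: "0 < \<theta>" "\<theta> < 1" and big: "2 \<le> sqrt M" "1 + 1 / b < sqrt M"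
  defines "m0 \<equiv> sqrt (1 + 2 * b) ^ DIM('a)" and "m1 \<equiv> sqrt (1 + 2 * b\<^sup>2) ^ DIM('a)"
    and "c' \<equiv> 1 / I ^ (DIM('a) - 1)"
  shows "(\<integral>\<^sup>+z. ennreal (rho z) ^ DIM('a) \<partial>lborel) \<le>
    ennreal (\<kappa> * (2 * (c' * (m1 * ln (4 * sqrt M + 2) + (m0 - m1) * ln (4 * (1 + 1 / b) + 2))) +
      k * (m1 / (1 - \<theta>) ^ (DIM('a) - 1) * (3/2 * c') + (\<delta> / k) ^ DIM('a) / \<theta> ^ (DIM('a) - 1) * J)))"
proof -
  let ?n = "DIM('a)"
  let ?W = "\<lambda>\<xi>. slice_energy ?n I (exp \<xi>)"
  let ?L = "ln M / 2"
  define Bc where "Bc = (\<delta> / k) ^ ?n / \<theta> ^ (?n - 1)"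
  define th where "th = (1 - \<theta>) ^ (?n - 1)"
  define Z where "Z = m1 / th * (3/2 * c') + Bc * J"
  define E where "E = c' * (m1 * ln (4 * sqrt M + 2) + (m0 - m1) * ln (4 * (1 + 1 / b) + 2))"
  have th: "0 < th" using \<theta> by (simp add: th_def)
  have Bc: "0 \<le> Bc" using \<delta> k \<theta> by (simp add: Bc_def)
  have c'0: "0 < c'" using I by (simp add: c'_def)
  have "b\<^sup>2 \<le> b" using b by (simp add: power2_eq_square mult_left_le)
  then have m: "0 \<le> m1" "m1 \<le> m0" unfolding m0_def m1_def using b by (auto intro!: power_mono)
  have Z0: "0 \<le> Z" using m th c'0 Bc J by (simp add: Z_def)
  have l: "0 \<le> ln (4 * (1 + 1 / b) + 2)" "0 \<le> ln (4 * sqrt M + 2)" using b sqrtM(1) by (auto intro!: ln_ge_zero add_increasing)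
  have E0: "0 \<le> E" unfolding E_def using l m c'0 by (intro mult_nonneg_nonneg add_nonneg_nonneg) auto
  have q0: "0 \<le> sqm b T ^ ?n" for T using sqm_pos[OF b(1), of T] by simp
  have n0: "?n \<noteq> 0" using n by linarith
  have Qb: "Q \<xi> \<le> indicator {..?L} \<xi> * (ennreal (sqm b (exp \<xi>) ^ ?n) * ?W \<xi>) + indicator {?L..?L + k} \<xi> * ennreal Z +
      indicator {?L..} \<xi> * (ennreal (sqm b (exp (ln M - \<xi>)) ^ ?n) * ?W (ln M - \<xi>))" for \<xi>
  proof -
    let ?a1 = "sqm b (exp \<xi>) ^ ?n" let ?a2 = "sqm b (exp (ln M - \<xi>)) ^ ?n"
    consider "\<xi> < ?L" | "?L \<le> \<xi>" "\<xi> \<le> ?L + k" | "?L + k < \<xi>" using k by linarith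
    then show ?thesis
    proof cases
      case 1
      have "Q \<xi> \<le> ennreal ?a1 * ?W \<xi> + ennreal 0 * ennreal J + ennreal 0 * ?W (ln M - \<xi>)"
      proof (rule Q_le[OF q0 _ _ J(2)])
        fix c :: real assume "\<bar>c\<bar> < 1"
        then have "0 \<le> sqm b (exp \<xi>) * Rf ?n I (exp \<xi>) c"
          using Rf_nonneg[OF I exp_gt_zero, of c ?n] by (intro mult_nonneg_nonneg less_imp_le[OF sqm_pos[OF b(1)]]) auto
        then have "phi \<xi> c = sqm b (exp \<xi>) * Rf ?n I (exp \<xi>) c"
          using 1 k by (simp add: phi_def)
        then show "phi \<xi> c ^ ?n \<le> ?a1 * Rf ?n I (exp \<xi>) c ^ ?n + 0 + 0 * Rf ?n I (exp (ln M - \<xi>)) (- c) ^ ?n"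
          by (simp add: power_mult_distrib)
      qed auto
      then show ?thesis using 1 by (simp add: indicator_def)
    next
      case 2
      have "Q \<xi> \<le> ennreal (?a1 / th) * ?W \<xi> + ennreal Bc * ennreal J + ennreal ?a2 * ?W (ln M - \<xi>)"
      proof (rule Q_le[OF _ Bc q0 J(2)])
        show "0 \<le> ?a1 / th" using q0 th by simp
        fix c :: real assume c: "\<bar>c\<bar> < 1"
        let ?A = "sqm b (exp \<xi>) * Rf ?n I (exp \<xi>) c" let ?B = "sqm b (exp (ln M - \<xi>)) * Rf ?n I (exp (ln M - \<xi>)) (- c)"
        have AB: "0 \<le> ?A" "0 \<le> ?B"
          using c Rf_nonneg[OF I exp_gt_zero, of c ?n] Rf_nonneg[OF I exp_gt_zero, of "- c" ?n]
          by (auto intro!: mult_nonneg_nonneg less_imp_le[OF sqm_pos[OF b(1)]])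
        have "phi \<xi> c = max (?A + \<delta> / k) ?B" using 2 by (simp add: phi_def)
        \<comment> \<open>The maximum is estimated by the sum of the powers: the outer potential
          keeps its full energy, and the inner one counts as surplus.\<close>
        then have "phi \<xi> c ^ ?n \<le> (?A + \<delta> / k) ^ ?n + ?B ^ ?n"
          using AB \<delta> k by (auto simp: max_def)
        also have "(?A + \<delta> / k) ^ ?n \<le> ?A ^ ?n / th + Bc"
          unfolding th_def Bc_def using AB \<delta> k \<theta> n by (intro power_add_le_convex) auto
        finally show "phi \<xi> c ^ ?n \<le> ?a1 / th * Rf ?n I (exp \<xi>) c ^ ?n + Bc + ?a2 * Rf ?n I (exp (ln M - \<xi>)) (- c) ^ ?n"
          by (simp add: power_mult_distrib)
      qed
      moreover have "ennreal (?a1 / th) * ?W \<xi> + ennreal Bc * ennreal J \<le> ennreal Z"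
      proof -
        \<comment> \<open>The shell lies beyond the radius \<open>1 + 1 / b\<close>, so the smaller
          factor \<open>m1\<close> applies, and beyond the radius 2, as
          \<open>slice_energy_large\<close> requires.\<close>
        have e: "sqrt M \<le> exp \<xi>" using 2(1) sqrtM(1,2) by (metis exp_le_cancel_iff exp_ln less_trans zero_less_one)
        then have "?a1 = m1" using big by (simp add: sqm_def m1_def)
        moreover have "?W \<xi> \<le> ennreal (3/2 * c')" unfolding c'_def using e big by (intro slice_energy_large[OF n I hI]) linarith
        ultimately have "ennreal (?a1 / th) * ?W \<xi> + ennreal Bc * ennreal J \<le> ennreal (m1 / th) * ennreal (3/2 * c') + ennreal Bc * ennreal J"
          by (simp add: mult_left_mono add_mono)
        also have "\<dots> = ennreal (m1 / th * (3/2 * c') + Bc * J)"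
        proof -
          have "0 \<le> m1 / th" "0 \<le> 3/2 * c'" using m th c'0 by auto
          then show ?thesis using Bc J(1) by (simp only: ennreal_mult ennreal_plus mult_nonneg_nonneg)
        qed
        finally show ?thesis unfolding Z_def .
      qed
      ultimately have "Q \<xi> \<le> ennreal Z + ennreal ?a2 * ?W (ln M - \<xi>)"
        by (meson add_mono order_refl order_trans)
      also have "\<dots> \<le> indicator {..?L} \<xi> * (ennreal ?a1 * ?W \<xi>) + (ennreal Z + ennreal ?a2 * ?W (ln M - \<xi>))"
        by (rule add_increasing) auto
      finally show ?thesis using 2 by (simp add: indicator_def add.assoc)
    next
      case 3
      have "Q \<xi> \<le> ennreal 0 * ?W \<xi> + ennreal 0 * ennreal J + ennreal ?a2 * ?W (ln M - \<xi>)"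
      proof (rule Q_le[OF _ _ q0 J(2)])
        fix c :: real assume "\<bar>c\<bar> < 1"
        then have "0 \<le> sqm b (exp (ln M - \<xi>)) * Rf ?n I (exp (ln M - \<xi>)) (- c)"
          using Rf_nonneg[OF I exp_gt_zero, of "- c" ?n] by (intro mult_nonneg_nonneg less_imp_le[OF sqm_pos[OF b(1)]]) auto
        then have "phi \<xi> c = sqm b (exp (ln M - \<xi>)) * Rf ?n I (exp (ln M - \<xi>)) (- c)"
          using 3 k by (simp add: phi_def)
        then show "phi \<xi> c ^ ?n \<le> 0 * Rf ?n I (exp \<xi>) c ^ ?n + 0 + ?a2 * Rf ?n I (exp (ln M - \<xi>)) (- c) ^ ?n"
          by (simp add: power_mult_distrib)
      qed auto
      then show ?thesis using 3 k by (simp add: indicator_def)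
    qed
  qed
  have half: "(\<integral>\<^sup>+\<xi>. indicator {..?L} \<xi> * (ennreal (sqm b (exp \<xi>) ^ ?n) * ?W \<xi>) \<partial>lborel) \<le> ennreal E"
  proof -
    have "exp ?L = sqrt M" using sqrtM(1,2) by (metis exp_ln less_trans zero_less_one)
    then show ?thesis using sqm_power_integral[of ?L] unfolding E_def m0_def m1_def c'_def by simp
  qed
  have "(\<integral>\<^sup>+\<xi>. Q \<xi> \<partial>lborel) \<le> (\<integral>\<^sup>+\<xi>. indicator {..?L} \<xi> * (ennreal (sqm b (exp \<xi>) ^ ?n) * ?W \<xi>) + indicator {?L..?L + k} \<xi> * ennreal Z +
      indicator {?L..} \<xi> * (ennreal (sqm b (exp (ln M - \<xi>)) ^ ?n) * ?W (ln M - \<xi>)) \<partial>lborel)"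
    by (rule nn_integral_mono) (rule Qb)
  also have "\<dots> = (\<integral>\<^sup>+\<xi>. indicator {..?L} \<xi> * (ennreal (sqm b (exp \<xi>) ^ ?n) * ?W \<xi>) \<partial>lborel) + (\<integral>\<^sup>+\<xi>. indicator {?L..?L + k} \<xi> * ennreal Z \<partial>lborel) +
      (\<integral>\<^sup>+\<xi>. indicator {?L..} \<xi> * (ennreal (sqm b (exp (ln M - \<xi>)) ^ ?n) * ?W (ln M - \<xi>)) \<partial>lborel)"
    by (subst nn_integral_add, measurable, subst nn_integral_add, measurable)
  also have "(\<integral>\<^sup>+\<xi>. indicator {?L..} \<xi> * (ennreal (sqm b (exp (ln M - \<xi>)) ^ ?n) * ?W (ln M - \<xi>)) \<partial>lborel) =
      (\<integral>\<^sup>+\<xi>. indicator {..?L} \<xi> * (ennreal (sqm b (exp \<xi>) ^ ?n) * ?W \<xi>) \<partial>lborel)"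
  proof -
    have "(indicator {?L..} \<xi> :: ennreal) = indicator {..?L} (ln M - \<xi>)" for \<xi> by (auto simp: indicator_def)
    then show ?thesis
      using nn_integral_real_reflect[of "\<lambda>\<xi>. indicator {..?L} \<xi> * (ennreal (sqm b (exp \<xi>) ^ ?n) * ?W \<xi>)" "ln M"] by simp
  qed
  also have "(\<integral>\<^sup>+\<xi>. indicator {?L..?L + k} \<xi> * ennreal Z \<partial>lborel) = ennreal k * ennreal Z"
    using k by (simp add: nn_integral_multc)
  also have "(\<integral>\<^sup>+\<xi>. indicator {..?L} \<xi> * (ennreal (sqm b (exp \<xi>) ^ ?n) * ?W \<xi>) \<partial>lborel) + ennreal k * ennreal Z +
      (\<integral>\<^sup>+\<xi>. indicator {..?L} \<xi> * (ennreal (sqm b (exp \<xi>) ^ ?n) * ?W \<xi>) \<partial>lborel) \<le> ennreal E + ennreal k * ennreal Z + ennreal E"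
    by (intro add_mono half order_refl)
  also have "\<dots> = ennreal (2 * E + k * Z)"
    using E0 k Z0 by (simp add: ennreal_mult[symmetric] ennreal_plus[symmetric] del: ennreal_plus)
  finally have "ennreal \<kappa> * (\<integral>\<^sup>+\<xi>. Q \<xi> \<partial>lborel) \<le> ennreal \<kappa> * ennreal (2 * E + k * Z)"
    by (rule mult_left_mono) simp
  also have "\<dots> = ennreal (\<kappa> * (2 * E + k * Z))" using \<kappa>(1) E0 k Z0 by (subst ennreal_mult) auto
  finally have bd: "ennreal \<kappa> * (\<integral>\<^sup>+\<xi>. Q \<xi> \<partial>lborel) \<le> ennreal (\<kappa> * (2 * E + k * Z))" .
  have "(\<integral>\<^sup>+z. ennreal (rho z) ^ ?n \<partial>lborel) = ennreal \<kappa> * (\<integral>\<^sup>+\<xi>. Q \<xi> \<partial>lborel)"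
    by (rule energy_eq) (rule \<kappa>(2))
  with bd show ?thesis unfolding E_def Z_def Bc_def th_def by simp
qed

end

subsection \<open>Curves to the boundary\<close>

lemma openin_extended_cases:
  fixes U :: "'a::euclidean_space option set"
  assumes "openin extended_space U"
  shows "open {p. Some p \<in> U}"
    and "None \<in> U \<Longrightarrow> \<exists>C. compact C \<and> (\<forall>p. p \<notin> C \<longrightarrow> Some p \<in> U)"
proof -
  consider V where "open V" "U = Some ` V" | C where "compact C" "closed C" "U = insert None (Some ` (UNIV - C))"
    using assms unfolding openin_Alexandroff_compactification by auto
  then have "open {p. Some p \<in> U} \<and> (None \<in> U \<longrightarrow> (\<exists>C. compact C \<and> (\<forall>p. p \<notin> C \<longrightarrow> Some p \<in> U)))"
  proof cases
    case (1 V)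
    then have "{p. Some p \<in> U} = V" by auto
    then show ?thesis using 1 by auto
  next
    case (2 C)
    then have "{p. Some p \<in> U} = - C" by auto
    then show ?thesis using 2 by auto
  qed
  then show "open {p. Some p \<in> U}" "None \<in> U \<Longrightarrow> \<exists>C. compact C \<and> (\<forall>p. p \<notin> C \<longrightarrow> Some p \<in> U)" by auto
qed

text \<open>Convergence to a single point \<open>q\<close> outside \<open>D\<close> suffices: the
  curve stays in \<open>D\<close>, so \<open>q\<close> is in the closure of \<open>D\<close> and
  hence in its extended boundary.\<close>

lemma tends_to_boundary_limit:
  fixes \<gamma> :: "real \<Rightarrow> 'a::euclidean_space"
  assumes \<gamma>: "\<gamma> ` {0..<1} \<subseteq> D"
    and near: "\<And>U. openin extended_space U \<Longrightarrow> q \<in> U \<Longrightarrow> \<forall>\<^sub>F t in at_left 1. Some (\<gamma> t) \<in> U"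
    and q: "q \<notin> Some ` D"
  shows "tends_to_boundary \<gamma> D"
proof -
  have "\<exists>p\<in>Some ` D. p \<in> T" if "q \<in> T" "openin extended_space T" for T
  proof -
    have "\<forall>\<^sub>F t in at_left (1::real). t \<in> {0<..<1}" using eventually_at_left_real[of 0 1] by simp
    with near[OF that(2,1)] have "\<forall>\<^sub>F t in at_left 1. Some (\<gamma> t) \<in> T \<and> t \<in> {0<..<1}" by eventually_elim auto
    then obtain t where "Some (\<gamma> t) \<in> T" "t \<in> {0<..<1}"
      using eventually_happens[of _ "at_left (1::real)"] by (auto simp: trivial_limit_at_left_real)
    moreover from this have "\<gamma> t \<in> D" using \<gamma> by auto
    ultimately show ?thesis by blast
  qed
  moreover have "q \<in> topspace extended_space" by (cases q) auto
  ultimately have "q \<in> extended_space closure_of (Some ` D)" unfolding in_closure_of by auto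
  then have "q \<in> extended_boundary D"
    using q interior_of_subset[of extended_space "Some ` D"] unfolding extended_boundary_def frontier_of_def by blast
  then show ?thesis using near unfolding tends_to_boundary_def by blast
qed

text \<open>The complement of \<open>D\<close> is closed, so there is a first exit time
  \<open>s\<close>; stopped there, the curve has the limit \<open>g s\<close> outside
  \<open>D\<close>.\<close>

lemma curve_to_boundary_exit:
  fixes g :: "real \<Rightarrow> 'a::euclidean_space"
  assumes D: "open D" and g: "continuous_on {0..S} g" "g 0 \<in> D" "g S \<notin> D" "0 \<le> S"
  shows "\<exists>C\<in>curves_to_boundary D (g 0). C \<subseteq> g ` {0..S}"
proof -
  let ?A = "{0..S} \<inter> g -` (- D)"
  have "closed ?A" using D g(1) by (intro continuous_closed_preimage) auto
  then have "compact ?A" by (auto simp: compact_eq_bounded_closed intro: bounded_subset[OF bounded_closed_interval])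
  then obtain s where s: "s \<in> ?A" "\<And>t. t \<in> ?A \<Longrightarrow> s \<le> t"
    using compact_attains_inf[of ?A] g(3,4) by (metis IntI atLeastAtMost_iff empty_iff order_refl vimageI ComplI)
  have s0: "0 < s" "s \<le> S" "g s \<notin> D" using s g by (auto simp: less_le)
  have inD: "g t \<in> D" if "0 \<le> t" "t < s" for t using s(2)[of t] that s0 by auto
  define \<gamma> where "\<gamma> t = g (s * t)" for t
  have st: "s * t \<in> {0..<s}" if "t \<in> {0..<1}" for t using that s0 by auto
  have cont1: "continuous_on {0..1} \<gamma>"
    unfolding \<gamma>_def using s0 by (intro continuous_on_compose2[OF g(1)] continuous_intros) (auto intro: order_trans[OF mult_left_le])
  have sub: "\<gamma> ` {0..<1} \<subseteq> D" using inD st by (auto simp: \<gamma>_def)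
  have lim: "(\<gamma> \<longlongrightarrow> g s) (at_left 1)"
    using continuous_on_Icc_at_leftD[OF cont1] by (simp add: \<gamma>_def)
  have "tends_to_boundary \<gamma> D"
  proof (rule tends_to_boundary_limit[OF sub, of "Some (g s)"])
    fix U assume "openin extended_space U" "Some (g s) \<in> U"
    then show "\<forall>\<^sub>F t in at_left 1. Some (\<gamma> t) \<in> U"
      using topological_tendstoD[OF lim openin_extended_cases(1)] by auto
  qed (use s0 in auto)
  then have "\<gamma> ` {0..<1} \<in> curves_to_boundary D (g 0)"
    unfolding curves_to_boundary_def using sub continuous_on_subset[OF cont1 atLeastLessThan_subseteq_atLeastAtMost_iff[THEN iffD2]]
    by (intro CollectI exI[of _ \<gamma>]) (auto simp: \<gamma>_def)
  moreover have "\<gamma> ` {0..<1} \<subseteq> g ` {0..S}"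
  proof (intro subsetI, elim imageE)
    fix q t assume "q = \<gamma> t" "t \<in> {0..<1::real}"
    moreover from this have "s * t \<in> {0..S}"
      using atLeastLessThan_iff[THEN iffD1, OF st[of t]] s0
      by (intro atLeastAtMost_iff[THEN iffD2] conjI) linarith+
    ultimately show "q \<in> g ` {0..S}" unfolding \<gamma>_def by (intro image_eqI)
  qed
  ultimately show ?thesis by blast
qed

text \<open>Either the curve leaves \<open>D\<close> and is stopped at its exit, or it stays in
  \<open>D\<close> and tends to infinity, which then is a boundary point. Thus a spiral to infinity
  can be drawn in any domain.\<close>

lemma curve_to_boundary_unbounded:
  fixes g :: "real \<Rightarrow> 'a::euclidean_space"
  assumes D: "open D" and g: "continuous_on {0..} g" "g 0 \<in> D" "filterlim (\<lambda>s. norm (g s)) at_top at_top"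
  shows "\<exists>C\<in>curves_to_boundary D (g 0). C \<subseteq> g ` {0..}"
proof (cases "g ` {0..} \<subseteq> D")
  case False
  then obtain S where "0 \<le> S" "g S \<notin> D" by auto
  then show ?thesis
    using curve_to_boundary_exit[OF D continuous_on_subset[OF g(1), of "{0..S}"] g(2)] image_mono[of "{0..S}" "{0..}" g]
    by (meson Icc_subset_Ici_iff order_refl subset_trans)
next
  case True
  define \<gamma> where "\<gamma> t = g (t / (1 - t))" for t
  have sub: "\<gamma> ` {0..<1} \<subseteq> g ` {0..}" by (auto simp: \<gamma>_def)
  have cont: "continuous_on {0..<1} \<gamma>"
    unfolding \<gamma>_def by (intro continuous_on_compose2[OF g(1)] continuous_intros) auto
  have "filterlim (\<lambda>t::real. t / (1 - t)) at_top (at_left 1)"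
  proof (rule filterlim_at_top_gt[of _ _ 0, THEN iffD2], intro allI impI)
    fix Z :: real assume Z: "0 < Z"
    then have "\<forall>\<^sub>F t in at_left (1::real). t \<in> {Z / (1 + Z)<..<1}" by (intro eventually_at_left_real) auto
    then show "\<forall>\<^sub>F t in at_left (1::real). Z \<le> t / (1 - t)"
      by eventually_elim (use Z in \<open>auto simp: field_simps\<close>)
  qed
  then have lim: "filterlim (\<lambda>t. norm (\<gamma> t)) at_top (at_left 1)"
    unfolding \<gamma>_def by (rule filterlim_compose[OF g(3)])
  have "tends_to_boundary \<gamma> D"
  proof (rule tends_to_boundary_limit[of _ _ None])
    show "\<gamma> ` {0..<1} \<subseteq> D" using sub True by blast
    fix U :: "'a option set" assume "openin extended_space U" "None \<in> U"
    then obtain C where C: "compact C" "\<And>p. p \<notin> C \<Longrightarrow> Some p \<in> U" using openin_extended_cases(2) by blast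
    then obtain B where B: "\<And>p. p \<in> C \<Longrightarrow> norm p \<le> B" using compact_imp_bounded bounded_iff by metis
    have "\<forall>\<^sub>F t in at_left 1. B < norm (\<gamma> t)" using lim by (simp add: filterlim_at_top_dense)
    then show "\<forall>\<^sub>F t in at_left 1. Some (\<gamma> t) \<in> U"
      by eventually_elim (use C(2) B in force)
  qed auto
  then have "\<gamma> ` {0..<1} \<in> curves_to_boundary D (g 0)"
    unfolding curves_to_boundary_def using sub True cont
    by (intro CollectI exI[of _ \<gamma>]) (auto simp: \<gamma>_def)
  with sub show ?thesis by blast
qed

text \<open>The rotation takes place in the plane of \<open>e0\<close> and \<open>u\<close>, with
  the total angle \<open>arccos (u \<bullet> e0) \<le> pi\<close> spread evenly over the logarithmic
  length \<open>L\<close>; for parallel vectors any plane through \<open>e0\<close> serves.\<close>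

lemma unit_vector_rot_axis:
  fixes e0 u :: "'a::euclidean_space"
  assumes n: "2 \<le> DIM('a)" and e: "norm e0 = 1" "norm u = 1" and L: "0 < L"
  obtains e1 \<epsilon> where "norm e1 = 1" "e0 \<bullet> e1 = 0" "\<bar>\<epsilon>\<bar> \<le> pi / L" "rot_axis e0 e1 \<epsilon> L = u"
proof -
  define c where "c = u \<bullet> e0"
  define w where "w = u - c *\<^sub>R e0"
  have ee: "e0 \<bullet> e0 = 1" "u \<bullet> u = 1" using e by (auto simp: norm_eq_1)
  have c1: "\<bar>c\<bar> \<le> 1" using Cauchy_Schwarz_ineq2[of u e0] e by (simp add: c_def)
  have "w \<bullet> w = 1 - c\<^sup>2"
    using ee by (simp add: w_def c_def inner_diff_left inner_diff_right inner_commute power2_eq_square)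
  then have w: "norm w = sqrt (1 - c\<^sup>2)" by (simp add: norm_eq_sqrt_inner)
  have w0: "e0 \<bullet> w = 0" using ee by (simp add: w_def c_def inner_diff_right inner_commute)
  obtain e1 where e1: "norm e1 = 1" "e0 \<bullet> e1 = 0" "norm w *\<^sub>R e1 = w"
  proof (cases "w = 0")
    case True
    obtain v where "v \<noteq> 0" "orthogonal e0 v"
      using orthogonal_to_vector_exists[OF n] by metis
    then show ?thesis using that[of "sgn v"] True by (simp add: norm_sgn orthogonal_def sgn_div_norm)
  next
    case False
    then show ?thesis using that[of "sgn w"] w0 by (simp add: norm_sgn sgn_div_norm)
  qed
  have "rot_axis e0 e1 (arccos c / L) L = u"
    using L c1 w e1(3) by (simp add: rot_axis_def sin_arccos_abs w_def)
  moreover have "\<bar>arccos c / L\<bar> \<le> pi / L"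
    using L c1 arccos_bounded[of c] by (auto simp: abs_le_iff divide_right_mono)
  ultimately show ?thesis using that e1 by blast
qed

lemma continuous_on_spiral: "continuous_on {0..} (\<lambda>s. s *\<^sub>R rot_axis e0 e1 \<epsilon> (ln s))"
  unfolding continuous_on_eq_continuous_within
proof
  fix s :: real assume s: "s \<in> {0..}"
  show "continuous (at s within {0..}) (\<lambda>s. s *\<^sub>R rot_axis e0 e1 \<epsilon> (ln s))"
  proof (cases "s = 0")
    case True
    have "norm (rot_axis e0 e1 \<epsilon> t) \<le> norm e0 + norm e1" for t
      unfolding rot_axis_def
      by (rule order_trans[OF norm_triangle_ineq]) (auto intro!: add_mono mult_left_le_one_le)
    then have "\<forall>\<^sub>F t in at 0 within {0..}. norm (t *\<^sub>R rot_axis e0 e1 \<epsilon> (ln t)) \<le> \<bar>t\<bar> * (norm e0 + norm e1)"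
      by (intro always_eventually allI) (simp add: mult_left_mono)
    moreover have "((\<lambda>t. \<bar>t\<bar> * (norm e0 + norm e1)) \<longlongrightarrow> 0) (at (0::real) within {0..})"
      by (rule tendsto_eq_intros refl | simp)+
    ultimately have "((\<lambda>t. t *\<^sub>R rot_axis e0 e1 \<epsilon> (ln t)) \<longlongrightarrow> 0) (at 0 within {0..})"
      by (rule Lim_null_comparison)
    then show ?thesis using True by (simp add: continuous_within)
  next
    case False
    then show ?thesis using s unfolding rot_axis_def by (intro continuous_intros) auto
  qed
qed

section \<open>The test function for a pair of spirals\<close>

context rotating_potential
begin

lemma admissible_scaled:
  assumes r: "0 < r"
    and E: "\<And>p. p \<in> E \<Longrightarrow> upot ((p - x) /\<^sub>R r) = 1" and F: "\<And>p. p \<in> F \<Longrightarrow> upot ((p - x) /\<^sub>R r) = 0"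
  shows "admissible (joining_curves E F D) (\<lambda>p. ennreal (rho ((p - x) /\<^sub>R r) / r))"
  unfolding admissible_def
proof (intro conjI ballI impI)
  show "(\<lambda>p. ennreal (rho ((p - x) /\<^sub>R r) / r)) \<in> borel_measurable borel" by measurable
  fix \<gamma> assume \<gamma>: "\<gamma> \<in> joining_curves E F D" "rectifiable \<gamma>"
  show "1 \<le> line_integral (\<lambda>p. ennreal (rho ((p - x) /\<^sub>R r) / r)) \<gamma>"
  proof (rule line_integral_ge_one[where u = "\<lambda>p. upot ((p - x) /\<^sub>R r)"])
    show "path \<gamma>" "upot ((\<gamma> 0 - x) /\<^sub>R r) = 1" "upot ((\<gamma> 1 - x) /\<^sub>R r) = 0"
      using \<gamma> E F by (auto simp: joining_curves_def pathstart_def pathfinish_def)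
    show "continuous_on UNIV (\<lambda>p. upot ((p - x) /\<^sub>R r))"
      by (intro continuous_on_compose2[OF upot_continuous] continuous_intros) auto
    show "0 \<le> rho ((p - x) /\<^sub>R r) / r" for p using rho_nonneg r by simp
    fix p \<eta> assume p: "0 < upot ((p - x) /\<^sub>R r)" "upot ((p - x) /\<^sub>R r) < 1" and \<eta>: "0 < (\<eta>::real)"
    have ev: "\<forall>\<^sub>F z in nhds ((p - x) /\<^sub>R r). \<bar>upot z - upot ((p - x) /\<^sub>R r)\<bar> \<le> (rho ((p - x) /\<^sub>R r) + \<eta> * r) * norm (z - (p - x) /\<^sub>R r)"
      using upot_slope[OF p] \<eta> r unfolding slope_le_def by simp
    have "isCont (\<lambda>q. (q - x) /\<^sub>R r) p" by (intro continuous_intros)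
    then have "filterlim (\<lambda>q. (q - x) /\<^sub>R r) (nhds ((p - x) /\<^sub>R r)) (nhds p)"
      using tendsto_at_iff_tendsto_nhds[of "\<lambda>q. (q - x) /\<^sub>R r" p] by (simp add: isCont_def)
    from eventually_compose_filterlim[OF ev this]
    show "\<forall>\<^sub>F q in nhds p. \<bar>upot ((q - x) /\<^sub>R r) - upot ((p - x) /\<^sub>R r)\<bar> \<le> (rho ((p - x) /\<^sub>R r) / r + \<eta>) * norm (q - p)"
    proof eventually_elim
      case (elim q)
      have "(q - x) /\<^sub>R r - (p - x) /\<^sub>R r = (q - p) /\<^sub>R r" by (simp add: algebra_simps)
      then have "norm ((q - x) /\<^sub>R r - (p - x) /\<^sub>R r) = norm (q - p) / r" using r by (simp add: divide_inverse_commute)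
      moreover have "(R + \<eta> * r) * (N / r) = (R / r + \<eta>) * N" for R N using r by (simp add: field_simps)
      ultimately show ?case using elim by metis
    qed
  qed (use \<gamma> in measurable)
qed

text \<open>Conformal invariance: dividing the density by \<open>r\<close> and raising it to the
  power of the dimension compensates the Jacobian.\<close>

lemma scaled_energy:
  assumes r: "0 < r"
  shows "(\<integral>\<^sup>+p. ennreal (rho ((p - x) /\<^sub>R r) / r) ^ DIM('a) \<partial>lborel) = (\<integral>\<^sup>+z. ennreal (rho z) ^ DIM('a) \<partial>lborel)"
proof -
  let ?n = "DIM('a)"
  let ?f = "\<lambda>p. ennreal (rho ((p - x) /\<^sub>R r) / r) ^ ?n"
  have "(\<integral>\<^sup>+p. ?f p \<partial>lborel) = (\<integral>\<^sup>+p. ?f (x + p) \<partial>lborel)"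
    by (rule nn_integral_lborel_translate[symmetric]) measurable
  also have "\<dots> = ennreal (\<bar>r\<bar> ^ ?n) * (\<integral>\<^sup>+p. ?f (x + r *\<^sub>R p) \<partial>lborel)"
    using r by (intro nn_integral_lborel_scale) auto
  also have "\<dots> = (\<integral>\<^sup>+p. ennreal (r ^ ?n) * ?f (x + r *\<^sub>R p) \<partial>lborel)"
    using r by (subst nn_integral_cmult) auto
  also have "\<dots> = (\<integral>\<^sup>+z. ennreal (rho z) ^ ?n \<partial>lborel)"
  proof (rule nn_integral_cong)
    fix p :: 'a
    have "ennreal (r ^ ?n) * ennreal ((rho p / r) ^ ?n) = ennreal (rho p ^ ?n)"
      using r rho_nonneg[of p] by (subst ennreal_mult[symmetric]) (auto simp: power_divide)
    then show "ennreal (r ^ ?n) * ?f (x + r *\<^sub>R p) = ennreal (rho p) ^ ?n"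
      using r rho_nonneg[of p] by (simp add: ennreal_power)
  qed
  finally show ?thesis .
qed

lemma upot_on_spirals:
  assumes "0 \<le> s"
  shows "s \<le> M \<Longrightarrow> upot (- (s *\<^sub>R rot_axis e0 e1 \<epsilon> (ln s))) = 1"
    and "1 \<le> s \<Longrightarrow> upot (s *\<^sub>R rot_axis e0 e1 \<epsilon> (ln s)) = 0"
proof -
  let ?z = "s *\<^sub>R rot_axis e0 e1 \<epsilon> (ln s)"
  have N: "norm ?z = s" using assms rot_axis_orthonormal(4)[OF o] by simp
  have c: "cz ?z = 1" "cz (- ?z) = -1" if "s \<noteq> 0"
    unfolding co_def norm_minus_cancel N using that rot_axis_orthonormal(1)[OF o] by auto
  show "upot (- ?z) = 1" if "s \<le> M"
    by (rule upot_one) (use c N that in fastforce)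
  show "upot ?z = 0" if "1 \<le> s" by (rule upot_zero) (use c N that in auto)
qed

end

text \<open>One spiral follows the negative axis from \<open>x\<close> to \<open>p\<close>, the
  other the positive axis from \<open>y\<close> to infinity. Cutting them at their exits from
  \<open>D\<close> only shrinks the two sets, so the test function built for the whole spirals
  remains admissible.\<close>

lemma lambda_mod_le_energy:
  fixes x y :: "real ^ 'n"
  assumes n: "2 \<le> CARD('n)" and D: "open D" "x \<in> D" "y \<in> D" "p \<notin> D" and xy: "x \<noteq> y" "dist x y < dist x p"
    and I: "0 < I" "(\<integral>\<^sup>+t. ennreal ((1 - t\<^sup>2) powr (- pe CARD('n))) * indicator {-1<..<1} t \<partial>lborel) = ennreal I"
    and \<kappa>: "0 < \<kappa>" "\<And>e::real^'n. norm e = 1 \<Longrightarrow> (\<integral>\<^sup>+w. perp_weight e w \<partial>lborel) = ennreal \<kappa>"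
    and J: "0 \<le> J" "(\<integral>\<^sup>+s. ennreal ((1 + s\<^sup>2) powr (- real CARD('n) / 2)) \<partial>lborel) = ennreal J"
  defines "M \<equiv> dist x p / dist x y"
  assumes b: "b = pi / ln M" "b \<le> 1" and k: "0 < k" "k \<le> ln M / 2" and \<delta>: "0 < \<delta>"
    and osc: "\<And>t t'. t \<in> {-1..1} \<Longrightarrow> t' \<in> {-1..1} \<Longrightarrow> \<bar>t - t'\<bar> \<le> (1 + exp k) / (2 * sqrt M) \<Longrightarrow>
      \<bar>Upot CARD('n) I t - Upot CARD('n) I t'\<bar> < \<delta>"
    and \<theta>: "0 < \<theta>" "\<theta> < 1" and big: "2 \<le> sqrt M" "1 + 1 / b < sqrt M"
  defines "m0 \<equiv> sqrt (1 + 2 * b) ^ CARD('n)" and "m1 \<equiv> sqrt (1 + 2 * b\<^sup>2) ^ CARD('n)"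
    and "c' \<equiv> 1 / I ^ (CARD('n) - 1)"
  shows "lambda_mod D x y \<le>
    ennreal (\<kappa> * (2 * (c' * (m1 * ln (4 * sqrt M + 2) + (m0 - m1) * ln (4 * (1 + 1 / b) + 2))) +
      k * (m1 / (1 - \<theta>) ^ (CARD('n) - 1) * (3/2 * c') + (\<delta> / k) ^ CARD('n) / \<theta> ^ (CARD('n) - 1) * J)))"
proof -
  define r where "r = dist x y"
  have r: "0 < r" using xy by (simp add: r_def)
  have M: "1 < M" "dist x p = r * M" using xy by (auto simp: M_def r_def)
  then have L: "0 < ln M" by simp
  define e0 where "e0 = (y - x) /\<^sub>R r"
  \<comment> \<open>The curve from \<open>x\<close> lies on the negative axis, so at the radius
    \<open>r * M\<close> the axis must point from \<open>p\<close> to \<open>x\<close>.\<close>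
  define u where "u = (x - p) /\<^sub>R (r * M)"
  have "norm (y - x) = r" "norm (x - p) = r * M" using M by (auto simp: r_def dist_norm norm_minus_commute)
  then have eu: "norm e0 = 1" "norm u = 1"
    unfolding e0_def u_def norm_scaleR using r M by (simp_all add: field_simps)
  obtain e1 \<epsilon> where e1: "norm e1 = 1" "e0 \<bullet> e1 = 0" "\<bar>\<epsilon>\<bar> \<le> pi / ln M" "rot_axis e0 e1 \<epsilon> (ln M) = u"
    using unit_vector_rot_axis[of e0 u "ln M"] n eu L by auto
  interpret rotating_potential e0 e1 \<epsilon> b M \<delta> k I
    using n I b k \<delta> osc eu e1 L M by unfold_locales auto
  define h where "h s = s *\<^sub>R rot_axis e0 e1 \<epsilon> (ln s)" for s
  have h: "continuous_on {0..} h" unfolding h_def by (rule continuous_on_spiral)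
  define gE where "gE s = x - r *\<^sub>R h s" for s
  \<comment> \<open>The shift by 1 starts the curve at the radius \<open>r\<close>, where the
    logarithm of the scaled radius vanishes and the axis is \<open>e0\<close>, that is, at
    \<open>y\<close>.\<close>
  define gF where "gF s = x + r *\<^sub>R h (1 + s)" for s
  have "(r * M) *\<^sub>R u = x - p"
    unfolding u_def scaleR_scaleR by (subst right_inverse) (use r M(1) in auto)
  then have "gE M = p" unfolding gE_def h_def e1(4) by simp
  moreover have "gE 0 = x" "gF 0 = y" using r by (auto simp: gE_def gF_def h_def e0_def rot_axis_def)
  ultimately have ends: "gE 0 = x" "gE M = p" "gF 0 = y" by auto
  obtain CE where CE: "CE \<in> curves_to_boundary D x" "CE \<subseteq> gE ` {0..M}"
  proof -
    have "continuous_on {0..M} gE" unfolding gE_def by (intro continuous_intros continuous_on_subset[OF h]) auto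
    then show ?thesis using curve_to_boundary_exit[of D M gE] D M ends that by auto
  qed
  obtain CF where CF: "CF \<in> curves_to_boundary D y" "CF \<subseteq> gF ` {0..}"
  proof -
    have c: "continuous_on {0..} gF"
      unfolding gF_def by (intro continuous_intros continuous_on_compose2[OF h]) auto
    have "filterlim (\<lambda>s. norm (gF s)) at_top at_top"
    proof (rule filterlim_at_top_mono)
      show "filterlim (\<lambda>s. - norm x + r * s) at_top at_top"
        using r by (intro filterlim_tendsto_add_at_top[OF tendsto_const] filterlim_tendsto_pos_mult_at_top[OF tendsto_const]) (auto simp: filterlim_ident)
      show "\<forall>\<^sub>F s in at_top. - norm x + r * s \<le> norm (gF s)"
        using eventually_ge_at_top[of 0]
      proof eventually_elim
        case (elim s)
        have "norm (r *\<^sub>R h (1 + s)) = r * (1 + s)"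
          using elim r rot_axis_orthonormal(4)[OF o] by (simp add: h_def)
        moreover have "norm (r *\<^sub>R h (1 + s)) \<le> norm (gF s) + norm x"
          using norm_triangle_ineq4[of "gF s" x] by (simp add: gF_def)
        ultimately show ?case using r by (simp add: algebra_simps)
      qed
    qed
    with c show ?thesis using curve_to_boundary_unbounded[of D gF] D ends that by auto
  qed
  have rr: "inverse r * (r * s) = s" for s using r by (simp add: mult.assoc[symmetric])
  let ?G = "joining_curves CE CF D"
  have "admissible ?G (\<lambda>q. ennreal (rho ((q - x) /\<^sub>R r) / r))"
  proof (rule admissible_scaled[OF r])
    show "upot ((q - x) /\<^sub>R r) = 1" if q: "q \<in> CE" for q
    proof -
      obtain s where "0 \<le> s" "s \<le> M" "q = gE s" using q CE(2) by (meson atLeastAtMost_iff imageE subsetD)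
      then show ?thesis using upot_on_spirals(1)[of s] by (simp add: gE_def h_def rr)
    qed
    show "upot ((q - x) /\<^sub>R r) = 0" if q: "q \<in> CF" for q
    proof -
      obtain s where "0 \<le> s" "q = gF s" using q CF(2) by (meson atLeast_iff imageE subsetD)
      then show ?thesis using upot_on_spirals(2)[of "1 + s"] by (simp add: gF_def h_def rr)
    qed
  qed
  then have "modulus ?G \<le> (\<integral>\<^sup>+q. ennreal (rho ((q - x) /\<^sub>R r) / r) ^ CARD('n) \<partial>lborel)"
    unfolding modulus_def by (intro INF_lower) auto
  also have "\<dots> = (\<integral>\<^sup>+z. ennreal (rho z) ^ CARD('n) \<partial>lborel)" using scaled_energy[OF r, of x] by simp
  also have "\<dots> \<le> ennreal (\<kappa> * (2 * (c' * (m1 * ln (4 * sqrt M + 2) + (m0 - m1) * ln (4 * (1 + 1 / b) + 2))) +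
      k * (m1 / (1 - \<theta>) ^ (CARD('n) - 1) * (3/2 * c') + (\<delta> / k) ^ CARD('n) / \<theta> ^ (CARD('n) - 1) * J)))"
    using energy_le[OF \<kappa> J(1) _ \<theta> big] J(2) unfolding c'_def m0_def m1_def by simp
  finally have "modulus ?G \<le> \<dots>" .
  moreover have "lambda_mod D x y \<le> modulus ?G"
    unfolding lambda_mod_def using CE(1) CF(1) by (intro INF_lower2[of "(CE, CF)"]) auto
  ultimately show ?thesis by (rule order_trans[rotated])
qed

section \<open>Asymptotics as the ratio \<open>M\<close> grows\<close>

text \<open>The derivative at 0 linearises the power, so the product behaves like a constant times
  \<open>b * g\<close>.\<close>

lemma powr_minus_one_times_tendsto:
  fixes a :: real
  assumes b: "filterlim b (at 0) F" and bg: "((\<lambda>x. b x * g x) \<longlongrightarrow> 0) F"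
  shows "((\<lambda>x. ((1 + 2 * b x) powr a - 1) * g x) \<longlongrightarrow> 0) F"
proof -
  have "((\<lambda>t. (1 + 2 * t) powr a) has_real_derivative 2 * a) (at 0)"
    by (auto intro!: derivative_eq_intros)
  then have "((\<lambda>t. ((1 + 2 * t) powr a - 1) / t) \<longlongrightarrow> 2 * a) (at 0)" by (simp add: DERIV_def)
  from tendsto_mult[OF filterlim_compose[OF this b] bg]
  have "((\<lambda>x. ((1 + 2 * b x) powr a - 1) / b x * (b x * g x)) \<longlongrightarrow> 0) F" by simp
  then show ?thesis
  proof (rule Lim_transform_eventually)
    have "\<forall>\<^sub>F x in F. b x \<noteq> 0" using b by (simp add: filterlim_at)
    then show "\<forall>\<^sub>F x in F. ((1 + 2 * b x) powr a - 1) / b x * (b x * g x) = ((1 + 2 * b x) powr a - 1) * g x"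
      by eventually_elim simp
  qed
qed

text \<open>With \<open>b = pi / ln M\<close>, the excess of \<open>(1 + 2 * b^2) powr a\<close>
  over 1 is of order \<open>b^2\<close> and meets a factor of order \<open>ln M\<close>, that of
  \<open>(1 + 2 * b) powr a\<close> is of order \<open>b\<close> and meets one of order
  \<open>ln (ln M)\<close>; both products vanish. The two halves leave \<open>ln (16 * M)\<close>,
  and \<open>33/80 + 1/10\<close> is the cost of gluing.\<close>

lemma spiral_energy_limit:
  fixes a :: real
  shows "((\<lambda>M. 2 * ((1 + 2 * (pi / ln M)\<^sup>2) powr a * ln (4 * sqrt M + 2) +
      ((1 + 2 * (pi / ln M)) powr a - (1 + 2 * (pi / ln M)\<^sup>2) powr a) * ln (4 * (1 + 1 / (pi / ln M)) + 2))
      + 33/80 * (1 + 2 * (pi / ln M)\<^sup>2) powr a + 1/10 - ln (16 * M)) \<longlongrightarrow> 41/80) at_top"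
proof -
  define b :: "real \<Rightarrow> real" where "b M = pi / ln M" for M
  define A where "A M = ln (4 * sqrt M + 2)" for M :: real
  define B where "B M = ln (4 * (1 + 1 / b M) + 2)" for M :: real
  have "(b \<longlongrightarrow> 0) at_top" unfolding b_def by real_asymp
  moreover have "\<forall>\<^sub>F M in at_top. b M \<noteq> 0"
    using eventually_gt_at_top[of 1] by eventually_elim (auto simp: b_def)
  ultimately have b: "filterlim b (at 0) at_top" "filterlim (\<lambda>M. (b M)\<^sup>2) (at 0) at_top"
    by (auto simp: filterlim_at intro!: tendsto_eq_intros elim!: eventually_mono)
  have "((\<lambda>M. (b M)\<^sup>2 * A M) \<longlongrightarrow> 0) at_top" unfolding b_def A_def by real_asymp
  note l1 = powr_minus_one_times_tendsto[OF b(2) this, of a]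
  have "((\<lambda>M. b M * B M) \<longlongrightarrow> 0) at_top" unfolding b_def B_def by real_asymp
  note l2 = powr_minus_one_times_tendsto[OF b(1) this, of a]
  have "((\<lambda>M. (b M)\<^sup>2 * B M) \<longlongrightarrow> 0) at_top" unfolding b_def B_def by real_asymp
  note l3 = powr_minus_one_times_tendsto[OF b(2) this, of a]
  have "((\<lambda>M. (b M)\<^sup>2 * 1) \<longlongrightarrow> 0) at_top" unfolding b_def by real_asymp
  note l4 = powr_minus_one_times_tendsto[OF b(2) this, of a]
  have "2 * ln 4 - ln 16 = (0::real)" using ln_realpow[of "4::real" 2] by simp
  moreover have "((\<lambda>M. 2 * A M - ln (16 * M)) \<longlongrightarrow> 2 * ln 4 - ln 16) at_top" unfolding A_def by real_asymp
  ultimately have l5: "((\<lambda>M. 2 * A M - ln (16 * M)) \<longlongrightarrow> 0) at_top" by simp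
  have lim: "((\<lambda>M. 2 * (((1 + 2 * (b M)\<^sup>2) powr a - 1) * A M) + 2 * (((1 + 2 * b M) powr a - 1) * B M - ((1 + 2 * (b M)\<^sup>2) powr a - 1) * B M)
      + 33/80 * (((1 + 2 * (b M)\<^sup>2) powr a - 1) * 1) + (2 * A M - ln (16 * M)) + 41/80) \<longlongrightarrow> 2 * 0 + 2 * (0 - 0) + 33/80 * 0 + 0 + 41/80) at_top"
    by (intro tendsto_intros l1 l2 l3 l4 l5)
  have eq: "2 * ((p - 1) * u) + 2 * ((q - 1) * v - (p - 1) * v) + 33/80 * ((p - 1) * 1) + (2 * u - l) + 41/80 =
      2 * (p * u + (q - p) * v) + 33/80 * p + 1/10 - l" for p q u v l :: real by (simp add: field_simps)
  from lim show ?thesis unfolding eq A_def[symmetric] b_def[symmetric] B_def[symmetric] by simp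
qed

lemma spiral_conditions:
  assumes "0 < \<omega>"
  shows "\<forall>\<^sub>F M in at_top. pi / ln M \<le> 1 \<and> 2 \<le> sqrt M \<and> 1 + 1 / (pi / ln M) < sqrt M \<and> 1/4 \<le> ln M / 2 \<and>
    (1 + exp (1/4)) / (2 * sqrt M) < (\<omega>::real)"
proof (intro eventually_conj)
  have "((\<lambda>M. pi / ln M) \<longlongrightarrow> 0) at_top" by real_asymp
  from order_tendstoD(2)[OF this, of 1] show "\<forall>\<^sub>F M in at_top. pi / ln M \<le> 1" by (auto elim!: eventually_mono)
  show "\<forall>\<^sub>F M in at_top. 2 \<le> sqrt M" by real_asymp
  show "\<forall>\<^sub>F M in at_top. 1 + 1 / (pi / ln M) < sqrt M" by real_asymp
  show "\<forall>\<^sub>F M in at_top. 1/4 \<le> ln M / (2::real)" by real_asymp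
  have "((\<lambda>M. (1 + exp (1/4)) / (2 * sqrt M)) \<longlongrightarrow> 0) at_top" by real_asymp
  from order_tendstoD(2)[OF this assms] show "\<forall>\<^sub>F M in at_top. (1 + exp (1/4)) / (2 * sqrt M) < \<omega>" .
qed

subsection \<open>Comparison of distances\<close>

text \<open>The gluing cost has to fit between \<open>ln (16 * M)\<close> and
  \<open>ln (31 * M)\<close>; taking 31 and not 32 leaves room for the term -1 in the lower
  bound.\<close>

lemma ln_31_16: "41/80 < ln (31/16 :: real)"
proof -
  have "exp (41/80) \<le> 1 + 41/80 + (41/80 :: real)\<^sup>2" by (rule exp_bound) auto
  also have "\<dots> < 31/16" by (simp add: power2_eq_square)
  finally have "ln (exp (41/80)) < ln (31/16 :: real)" by (subst ln_less_cancel_iff) auto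
  then show ?thesis by simp
qed

text \<open>Order of the choices: the shell has the fixed thickness \<open>k = 1/4\<close>; then
  come \<open>\<theta>\<close>, \<open>\<delta>\<close> depending on \<open>\<theta>\<close>, the
  modulus of continuity \<open>\<omega>\<close> of \<open>Upot\<close> for \<open>\<delta>\<close>,
  and \<open>M\<close> last.\<close>

lemma lambda_mod_le_log:
  fixes \<kappa> I :: real
  assumes n: "2 \<le> CARD('n)"
    and \<kappa>: "0 < \<kappa>" "\<And>e::real^'n. norm e = 1 \<Longrightarrow> (\<integral>\<^sup>+w. perp_weight e w \<partial>lborel) = ennreal \<kappa>"
    and I: "0 < I" "(\<integral>\<^sup>+s. ennreal ((1 + s\<^sup>2) powr (- (real CARD('n) / (2 * (real CARD('n) - 1))))) \<partial>lborel) = ennreal I"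
  obtains M0 where "16 \<le> M0"
    "\<And>D (x::real^'n) y p. open D \<Longrightarrow> x \<in> D \<Longrightarrow> y \<in> D \<Longrightarrow> p \<notin> D \<Longrightarrow> x \<noteq> y \<Longrightarrow> M0 * dist x y \<le> dist x p \<Longrightarrow>
      lambda_mod D x y \<le> ennreal (\<kappa> / I ^ (CARD('n) - 1) * ln (31 * (dist x p / dist x y)))"
proof -
  let ?n = "CARD('n)"
  define c' where "c' = 1 / I ^ (?n - 1)"
  have c': "0 < c'" using I by (simp add: c'_def)
  have "pe ?n - 3/2 = - (real ?n / (2 * (real ?n - 1)))" using n by (simp add: pe_def field_simps)
  then have hI: "(\<integral>\<^sup>+t. ennreal ((1 - t\<^sup>2) powr (- pe ?n)) * indicator {-1<..<1} t \<partial>lborel) = ennreal I"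
    unfolding nn_integral_cos_eq_cot using I(2) by simp
  have "(\<integral>\<^sup>+s. ennreal ((1 + s\<^sup>2) powr (- (real ?n / 2))) \<partial>lborel) < \<infinity>"
    using n by (intro nn_integral_one_plus_square_finite) auto
  then obtain J where J: "0 \<le> J" "(\<integral>\<^sup>+s. ennreal ((1 + s\<^sup>2) powr (- real ?n / 2)) \<partial>lborel) = ennreal J"
    by (auto simp: less_top[symmetric] elim: ennreal_cases)
  \<comment> \<open>With the thickness \<open>1/4\<close> and the bound \<open>3/2\<close> of
    \<open>slice_energy_large\<close>, the factor \<open>11/10\<close> yields the summand
    \<open>33/80\<close>.\<close>
  obtain \<theta> :: real where \<theta>: "0 < \<theta>" "\<theta> < 1" "1 / (1 - \<theta>) ^ (?n - 1) < 11/10"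
  proof -
    have "((\<lambda>\<theta>::real. 1 / (1 - \<theta>) ^ (?n - 1)) \<longlongrightarrow> 1 / (1 - 0) ^ (?n - 1)) (at_right 0)"
      by (intro tendsto_intros) auto
    then have "\<forall>\<^sub>F \<theta> in at_right (0::real). 1 / (1 - \<theta>) ^ (?n - 1) < 11/10"
      by (rule order_tendstoD) simp
    moreover have "\<forall>\<^sub>F \<theta> in at_right (0::real). \<theta> \<in> {0<..<1}" using eventually_at_right_real[of 0 1] by simp
    ultimately have "\<forall>\<^sub>F \<theta> in at_right (0::real). 1 / (1 - \<theta>) ^ (?n - 1) < 11/10 \<and> \<theta> \<in> {0<..<1}"
      by eventually_elim auto
    from eventually_happens[OF this] show ?thesis using that by (auto simp: trivial_limit_at_right_real)
  qed
  \<comment> \<open>A small \<open>\<delta>\<close> keeps the cost of the lowering term below the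
    summand \<open>1/10\<close>.\<close>
  obtain \<delta> :: real where \<delta>: "0 < \<delta>" "1/4 * ((\<delta> / (1/4)) ^ ?n / \<theta> ^ (?n - 1) * J) < c' / 10"
  proof -
    have "((\<lambda>\<delta>::real. 1/4 * ((\<delta> / (1/4)) ^ ?n / \<theta> ^ (?n - 1) * J)) \<longlongrightarrow> 1/4 * ((0 / (1/4)) ^ ?n / \<theta> ^ (?n - 1) * J)) (at_right 0)"
      using \<theta> by (intro tendsto_intros) auto
    then have "\<forall>\<^sub>F \<delta> in at_right (0::real). 1/4 * ((\<delta> / (1/4)) ^ ?n / \<theta> ^ (?n - 1) * J) < c' / 10"
      by (rule order_tendstoD) (use c' n in \<open>simp add: power_0_left\<close>)
    moreover have "\<forall>\<^sub>F \<delta> in at_right (0::real). \<delta> \<in> {0<..<1}" using eventually_at_right_real[of 0 1] by simp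
    ultimately have "\<forall>\<^sub>F \<delta> in at_right (0::real). 1/4 * ((\<delta> / (1/4)) ^ ?n / \<theta> ^ (?n - 1) * J) < c' / 10 \<and> \<delta> \<in> {0<..<1}"
      by eventually_elim auto
    from eventually_happens[OF this] show ?thesis using that by (auto simp: trivial_limit_at_right_real)
  qed
  obtain \<omega> where \<omega>: "\<omega> > 0" "\<And>t t'. t \<in> {-1..1} \<Longrightarrow> t' \<in> {-1..1} \<Longrightarrow> \<bar>t - t'\<bar> < \<omega> \<Longrightarrow> \<bar>Upot ?n I t - Upot ?n I t'\<bar> < \<delta>"
    using Upot_unif[OF n I(1) hI \<delta>(1)] by blast
  define mm where "mm t = sqrt (1 + 2 * t) ^ ?n" for t :: real
  have mm: "mm t = (1 + 2 * t) powr (real ?n / 2)" if "0 \<le> t" for t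
    unfolding mm_def using that by (simp add: powr_half_sqrt[symmetric] powr_realpow[symmetric] powr_powr)
  define \<Phi> where "\<Phi> M = 2 * (mm ((pi / ln M)\<^sup>2) * ln (4 * sqrt M + 2) +
      (mm (pi / ln M) - mm ((pi / ln M)\<^sup>2)) * ln (4 * (1 + 1 / (pi / ln M)) + 2)) + 33/80 * mm ((pi / ln M)\<^sup>2) + 1/10" for M
  have "\<forall>\<^sub>F M in at_top. \<Phi> M \<le> ln (31 * M)"
    using order_tendstoD(2)[OF spiral_energy_limit[of "real ?n / 2"] ln_31_16] eventually_gt_at_top[of 1]
  proof eventually_elim
    case (elim M)
    have "0 \<le> pi / ln M" using elim(2) by simp
    then have "\<Phi> M - ln (16 * M) < ln (31/16)" using elim(1) unfolding \<Phi>_def by (simp only: mm zero_le_power2)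
    moreover have "ln (31 * M) = ln (16 * M) + ln (31/16)" using elim(2) ln_mult[of "16 * M" "31/16"] by simp
    ultimately show ?case by linarith
  qed
  with spiral_conditions[OF \<omega>(1)]
  have "\<forall>\<^sub>F M in at_top. \<Phi> M \<le> ln (31 * M) \<and> pi / ln M \<le> 1 \<and> 2 \<le> sqrt M \<and> 1 + 1 / (pi / ln M) < sqrt M \<and> 1/4 \<le> ln M / 2 \<and>
    (1 + exp (1/4)) / (2 * sqrt M) < \<omega>" by eventually_elim blast
  then obtain M1 where M1: "\<And>M. M1 \<le> M \<Longrightarrow> \<Phi> M \<le> ln (31 * M) \<and> pi / ln M \<le> 1 \<and> 2 \<le> sqrt M \<and> 1 + 1 / (pi / ln M) < sqrt M \<and> 1/4 \<le> ln M / 2 \<and>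
    (1 + exp (1/4)) / (2 * sqrt M) < \<omega>" unfolding eventually_at_top_linorder by blast
  show thesis
  proof (rule that[of "max 16 M1"])
    fix D and x y p :: "real ^ 'n"
    assume D: "open D" "x \<in> D" "y \<in> D" "p \<notin> D" and xy: "x \<noteq> y" "max 16 M1 * dist x y \<le> dist x p"
    define M where "M = dist x p / dist x y"
    have M: "max 16 M1 \<le> M" using xy by (simp add: M_def pos_le_divide_eq del: max.bounded_iff)
    then have M': "M1 \<le> M" "16 \<le> M" by auto
    note c = M1[OF M'(1)]
    have lt: "dist x y < dist x p" using M'(2) xy(1) by (simp add: M_def pos_le_divide_eq) (smt (verit) zero_less_dist_iff)
    define b where "b = pi / ln M"
    have osc: "\<bar>Upot ?n I t - Upot ?n I t'\<bar> < \<delta>"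
      if "t \<in> {-1..1}" "t' \<in> {-1..1}" "\<bar>t - t'\<bar> \<le> (1 + exp (1/4)) / (2 * sqrt M)" for t t'
      using \<omega>(2)[OF that(1,2)] that(3) c by linarith
    have "lambda_mod D x y \<le>
      ennreal (\<kappa> * (2 * (c' * (mm (b\<^sup>2) * ln (4 * sqrt M + 2) + (mm b - mm (b\<^sup>2)) * ln (4 * (1 + 1 / b) + 2))) +
        1/4 * (mm (b\<^sup>2) / (1 - \<theta>) ^ (?n - 1) * (3/2 * c') + (\<delta> / (1/4)) ^ ?n / \<theta> ^ (?n - 1) * J)))"
      unfolding mm_def c'_def M_def
      by (rule lambda_mod_le_energy[OF n D xy(1) lt I(1) hI \<kappa> J _ _ _ _ \<delta>(1) _ \<theta>(1,2)])
        (use c osc in \<open>simp_all add: b_def M_def[symmetric]\<close>)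
    also have "\<dots> \<le> ennreal (\<kappa> * (c' * ln (31 * M)))"
    proof (intro ennreal_leI mult_left_mono)
      have m0: "0 \<le> mm (b\<^sup>2)" by (simp add: mm_def)
      then have "mm (b\<^sup>2) * (1 / (1 - \<theta>) ^ (?n - 1)) * (3/8 * c') \<le> mm (b\<^sup>2) * (11/10) * (3/8 * c')"
        using \<theta>(3) c' by (intro mult_right_mono mult_left_mono) auto
      moreover have "2 * (c' * X) + 1/4 * (m / T * (3/2 * c') + Z) \<le> c' * (2 * X + 33/80 * m + 1/10)"
        if "m * (1 / T) * (3/8 * c') \<le> m * (11/10) * (3/8 * c')" "1/4 * Z < c' / 10" for X m T Z :: real
      proof -
        have "1/4 * (m / T * (3/2 * c') + Z) = m * (1 / T) * (3/8 * c') + 1/4 * Z" by (simp add: distrib_left)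
        moreover have "c' * (2 * X + 33/80 * m + 1/10) = 2 * (c' * X) + m * (11/10) * (3/8 * c') + c' / 10"
          by (simp add: distrib_left)
        ultimately show ?thesis using that by linarith
      qed
      ultimately have "2 * (c' * X) + 1/4 * (mm (b\<^sup>2) / (1 - \<theta>) ^ (?n - 1) * (3/2 * c') + (\<delta> / (1/4)) ^ ?n / \<theta> ^ (?n - 1) * J)
        \<le> c' * (2 * X + 33/80 * mm (b\<^sup>2) + 1/10)" for X
        using \<delta>(2) by blast
      then have "2 * (c' * (mm (b\<^sup>2) * ln (4 * sqrt M + 2) + (mm b - mm (b\<^sup>2)) * ln (4 * (1 + 1 / b) + 2))) +
        1/4 * (mm (b\<^sup>2) / (1 - \<theta>) ^ (?n - 1) * (3/2 * c') + (\<delta> / (1/4)) ^ ?n / \<theta> ^ (?n - 1) * J) \<le> c' * \<Phi> M"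
        unfolding \<Phi>_def b_def .
      also have "\<dots> \<le> c' * ln (31 * M)" using c c' by (intro mult_left_mono) auto
      finally show "2 * (c' * (mm (b\<^sup>2) * ln (4 * sqrt M + 2) + (mm b - mm (b\<^sup>2)) * ln (4 * (1 + 1 / b) + 2))) +
        1/4 * (mm (b\<^sup>2) / (1 - \<theta>) ^ (?n - 1) * (3/2 * c') + (\<delta> / (1/4)) ^ ?n / \<theta> ^ (?n - 1) * J) \<le> c' * ln (31 * M)" .
    qed (use \<kappa>(1) in simp)
    finally show "lambda_mod D x y \<le> ennreal (\<kappa> / I ^ (?n - 1) * ln (31 * (dist x p / dist x y)))"
      by (simp add: M_def c'_def)
  qed simp
qed

text \<open>With \<open>q = d / r\<close> and \<open>q' = d' / r'\<close> the hypothesis becomes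
  \<open>2 * q - 1 \<le> 31 * q'\<close>, and \<open>q' \<ge> 1\<close> absorbs the -1.\<close>

lemma distance_comparison:
  fixes c r r' d d' :: real
  assumes c: "0 < c" and r: "0 < r" "16 * r \<le> d" and r': "0 < r'" "16 * r' \<le> d'"
    and le: "ennreal (c * ln (2 * d / r - 1)) \<le> ennreal (c * ln (31 * (d' / r')))"
  shows "d * r' \<le> 16 * (d' * r)"
proof -
  have q: "16 \<le> d / r" "16 \<le> d' / r'" using r r' by (auto simp: pos_le_divide_eq)
  then have "0 \<le> ln (31 * (d' / r'))" by (intro ln_ge_zero) linarith
  then have "c * ln (2 * d / r - 1) \<le> c * ln (31 * (d' / r'))" using le c by (simp add: ennreal_le_iff)
  then have "ln (2 * (d / r) - 1) \<le> ln (31 * (d' / r'))" using c by simp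
  then have "2 * (d / r) - 1 \<le> 31 * (d' / r')" by (subst (asm) ln_le_cancel_iff) (use q in linarith)+
  then have "d / r \<le> 16 * (d' / r')" using q by linarith
  then show ?thesis using r r' by (simp add: field_simps)
qed

lemma nearest_boundary_point:
  fixes D :: "'a::euclidean_space set"
  assumes "open D" "D \<noteq> UNIV" "x \<in> D"
  obtains p where "p \<notin> D" "x \<noteq> p" "ball x (dist x p) \<subseteq> D"
proof -
  obtain p where p: "p \<in> - D" "infdist x (- D) = dist x p"
    using infdist_attains_inf[of "- D" x] assms by (auto simp: closed_Compl)
  have "ball x (dist x p) \<subseteq> D"
  proof
    fix q assume "q \<in> ball x (dist x p)"
    then show "q \<in> D" using infdist_le[of q "- D" x] p(2) by (cases "q \<in> D") auto
  qed
  then show thesis using that[of p] p(1) assms by auto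
qed

theorem theorem1p2:
  fixes D D' :: "(real ^ 'n) set" and f :: "real ^ 'n \<Rightarrow> real ^ 'n"
  assumes "2 \<le> CARD('n)"
    and "proper_subdomain D" and "proper_subdomain D'"
    and "\<exists>g. homeomorphism D D' f g"
    and "\<forall>x\<in>D. \<forall>y\<in>D. x \<noteq> y \<longrightarrow> lambda_mod D' (f x) (f y) = lambda_mod D x y"
  shows "quasiconformal D D' f \<and> (\<forall>x\<in>D. linear_dilatation f x \<le> 256)"
proof -
  let ?n = "CARD('n)"
  have D: "open D" "D \<noteq> UNIV" "open D'" "D' \<noteq> UNIV" using assms(2,3) by (auto simp: proper_subdomain_def)
  obtain g where g: "homeomorphism D D' f g" using assms(4) by blast
  have fD: "f z \<in> D'" if "z \<in> D" for z using g that by (auto simp: homeomorphism_def)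
  have inj: "f z \<noteq> f w" if "z \<in> D" "w \<in> D" "z \<noteq> w" for z w using g that by (metis homeomorphism_apply1)
  obtain \<kappa> where \<kappa>: "0 < \<kappa>" "\<And>e::real^'n. norm e = 1 \<Longrightarrow> (\<integral>\<^sup>+w. perp_weight e w \<partial>lborel) = ennreal \<kappa>"
    using perp_weight_const[where 'a = "real ^ 'n"] assms(1) by auto
  let ?a = "real ?n / (2 * (real ?n - 1))"
  have "1/2 < ?a" using assms(1) by (simp add: field_simps)
  then have fin: "(\<integral>\<^sup>+s. ennreal ((1 + s\<^sup>2) powr (- ?a)) \<partial>lborel) < \<infinity>"
    by (rule nn_integral_one_plus_square_finite)
  have "(\<integral>\<^sup>+s. ennreal ((1 + s\<^sup>2) powr (- ?a)) \<partial>lborel) \<noteq> 0"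
  proof
    assume "(\<integral>\<^sup>+s. ennreal ((1 + s\<^sup>2) powr (- ?a)) \<partial>lborel) = 0"
    then have "AE s::real in lborel. ennreal ((1 + s\<^sup>2) powr (- ?a)) = 0"
      by (subst (asm) nn_integral_0_iff_AE) auto
    then have "AE s::real in lborel. False"
    proof eventually_elim
      case (elim s)
      have "0 < 1 + s\<^sup>2" by (simp add: add_pos_nonneg)
      then have "0 < (1 + s\<^sup>2) powr (- ?a)" by simp
      then show ?case using elim by simp
    qed
    then show False by (simp add: ae_filter_eq_bot_iff trivial_limit_def[symmetric] eventually_False)
  qed
  with fin obtain I where I: "0 < I" "(\<integral>\<^sup>+s. ennreal ((1 + s\<^sup>2) powr (- ?a)) \<partial>lborel) = ennreal I"
    by (cases "\<integral>\<^sup>+s. ennreal ((1 + s\<^sup>2) powr (- ?a)) \<partial>lborel") (auto simp: less_le)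
  obtain M0 where M0: "16 \<le> M0"
    "\<And>D (x::real^'n) y p. open D \<Longrightarrow> x \<in> D \<Longrightarrow> y \<in> D \<Longrightarrow> p \<notin> D \<Longrightarrow> x \<noteq> y \<Longrightarrow> M0 * dist x y \<le> dist x p \<Longrightarrow>
      lambda_mod D x y \<le> ennreal (\<kappa> / I ^ (?n - 1) * ln (31 * (dist x p / dist x y)))"
    using lambda_mod_le_log[OF assms(1) \<kappa> I] by blast
  have c: "0 < \<kappa> / I ^ (?n - 1)" using \<kappa> I by simp
  have dil: "linear_dilatation f x \<le> 256" if x: "x \<in> D" for x
  proof -
    obtain p where p: "p \<notin> D" "x \<noteq> p" "ball x (dist x p) \<subseteq> D" using nearest_boundary_point[OF D(1,2) x] .
    obtain p' where p': "p' \<notin> D'" "f x \<noteq> p'" "ball (f x) (dist (f x) p') \<subseteq> D'"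
      using nearest_boundary_point[OF D(3,4) fD[OF x]] .
    define d where "d = dist x p"
    define d' where "d' = dist (f x) p'"
    have d: "0 < d" "0 < d'" using p p' by (auto simp: d_def d'_def)
    have "isCont f x" using g x D(1) by (auto simp: homeomorphism_def continuous_on_eq_continuous_at)
    \<comment> \<open>The upper bound in \<open>D'\<close> also requires a large ratio, so the image
      distance must be small against \<open>d'\<close>; continuity of \<open>f\<close> provides
      this.\<close>
    then obtain s where s: "0 < s" "\<And>y. dist y x < s \<Longrightarrow> dist (f y) (f x) < d' / M0"
      using d M0(1) unfolding continuous_at_eps_delta by (metis divide_pos_pos less_le_trans zero_less_numeral)
    define r0 where "r0 = min s (d / M0)"
    have r0: "0 < r0" using s d M0(1) by (simp add: r0_def)
    have key: "y \<in> D" "x \<noteq> y" "0 < dist (f x) (f y)" "d * dist (f x) (f y) \<le> 16 * (d' * r)" "d' * r \<le> 16 * (d * dist (f x) (f y))"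
      if r: "0 < r" "r < r0" and y: "dist x y = r" for r y
    proof -
      have rd: "M0 * r \<le> d" using r M0(1) by (simp add: r0_def pos_less_divide_eq mult.commute)
      then have s16: "16 * r \<le> d" using M0(1) r by (meson mult_right_mono less_imp_le order_trans)
      then have "r < d" using r by linarith
      then show yD: "y \<in> D" using p(3) y by (auto simp: d_def)
      show xy: "x \<noteq> y" using y r by auto
      then have fxy: "f x \<noteq> f y" using inj[OF x yD] by simp
      then show r': "0 < dist (f x) (f y)" by simp
      have "dist (f y) (f x) < d' / M0" using s(2)[of y] r y by (simp add: r0_def dist_commute)
      then have rd': "M0 * dist (f x) (f y) \<le> d'" using M0(1) by (simp add: pos_less_divide_eq mult.commute dist_commute)
      then have s16': "16 * dist (f x) (f y) \<le> d'" using M0(1) r' by (meson mult_right_mono less_imp_le order_trans)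
      have lam: "lambda_mod D' (f x) (f y) = lambda_mod D x y" using assms(5) x yD xy by blast
      \<comment> \<open>The lower bound in \<open>D\<close> is played against the upper bound in
        \<open>D'\<close>; below, the roles are exchanged for the reverse estimate.\<close>
      have "ennreal (\<kappa> / I ^ (?n - 1) * ln (2 * d / r - 1)) \<le> lambda_mod D x y"
        using lambda_mod_ge_log[OF assms(1) D(1) p(3) xy _ \<kappa> I] \<open>r < d\<close> y by (simp add: d_def)
      also have "\<dots> \<le> ennreal (\<kappa> / I ^ (?n - 1) * ln (31 * (d' / dist (f x) (f y))))"
        unfolding lam[symmetric] d'_def using rd' by (intro M0(2) D fD x yD p' fxy) (simp add: d'_def)
      finally show "d * dist (f x) (f y) \<le> 16 * (d' * r)" by (rule distance_comparison[OF c r(1) s16 r' s16'])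
      have "dist (f x) (f y) < d'" using s16' r' by linarith
      then have "ennreal (\<kappa> / I ^ (?n - 1) * ln (2 * d' / dist (f x) (f y) - 1)) \<le> lambda_mod D' (f x) (f y)"
        unfolding d'_def by (rule lambda_mod_ge_log[OF assms(1) D(3) p'(3) fxy _ \<kappa> I])
      also have "\<dots> \<le> ennreal (\<kappa> / I ^ (?n - 1) * ln (31 * (d / r)))"
        unfolding lam d_def y[symmetric] using rd y by (intro M0(2) D x yD p xy) (simp add: d_def)
      finally show "d' * r \<le> 16 * (d * dist (f x) (f y))" by (rule distance_comparison[OF c r' s16' r(1) s16])
    qed
    have ratio: "norm (f x - f y) / norm (f x - f z) \<le> 256" if r: "0 < r" "r < r0" and yz: "dist x y = r" "dist x z = r" for r y z
    proof -
      \<comment> \<open>The image distances for \<open>y\<close> and \<open>z\<close> are compared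
        through the common value \<open>d' * r\<close>, each time at the cost of a factor
        16.\<close>
      have "d * dist (f x) (f y) \<le> 16 * (16 * (d * dist (f x) (f z)))"
        using key(4)[OF r yz(1)] key(5)[OF r yz(2)] by linarith
      then have "d * dist (f x) (f y) \<le> d * (256 * dist (f x) (f z))" by simp
      then have "dist (f x) (f y) \<le> 256 * dist (f x) (f z)" using d(1) by simp
      then show ?thesis using key(3)[OF r yz(2)] by (simp add: dist_norm divide_le_eq)
    qed
    show ?thesis unfolding linear_dilatation_def
    proof (rule Limsup_bounded)
      have "\<forall>\<^sub>F r in at_right 0. r \<in> {0<..<r0}" using eventually_at_right_real[OF r0] .
      then show "\<forall>\<^sub>F r in at_right 0. (SUP (y, z)\<in>sphere x r \<times> sphere x r. ereal (norm (f x - f y) / norm (f x - f z))) \<le> 256"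
      proof eventually_elim
        case (elim r)
        show ?case
        proof (rule SUP_least, clarify)
          fix y z assume "y \<in> sphere x r" "z \<in> sphere x r"
          then have "ereal (norm (f x - f y) / norm (f x - f z)) \<le> ereal 256" using ratio[of r y z] elim by simp
          then show "ereal (norm (f x - f y) / norm (f x - f z)) \<le> 256" by simp
        qed
      qed
    qed
  qed
  moreover have "linear_dilatation f x \<le> ereal 256" if "x \<in> D" for x using dil[OF that] by simp
  ultimately show ?thesis using assms(4) unfolding quasiconformal_def by blast
qed

end
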